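(* Consider the quantum lattice system and its local specification $\{\pi_\Lambda\}_{\Lambda\Subset\mathbb Z^d}$ described in the context, and fix any boundary condition $\xi\in\Omega$. Then for all $\delta>0$, $\alpha\in[0,\frac12)$ and $Q\ge1$: (a) if $\sup_{k\in\mathbb Z^d}|\xi_k|_{C^\alpha_\beta}<\infty$, then $$\sup_{\Lambda\Subset\mathbb Z^d}\ \sup_{k\in\mathbb Z^d}\int_\Omega|\omega_k|^Q_{C^\alpha_\beta}\,\pi_\Lambda(d\omega|\xi)<\infty;$$ (b) if $\xi\in\Omega_t$, then $$\sup_{\Lambda\Subset\mathbb Z^d}\ \sum_{k\in\Lambda}e^{-\delta|k|}\int_\Omega|\omega_k|^Q_{C^\alpha_\beta}\,\pi_\Lambda(d\omega|\xi)<\infty .$$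
   Context: Fix $d\in\mathbb N$, $\beta>0$ (inverse temperature), $\mathfrak m>0$ (mass), $a^2>0$, $J>0$. The formal Hamiltonian is $-\frac1{2\mathfrak m}\sum_{k\in\mathbb Z^d}\frac{d^2}{dq_k^2}+\frac{a^2}2\sum_k q_k^2+\sum_k V(q_k)+J\sum_{\langle k,k'\rangle}(q_k-q_{k'})^2$, where $\langle k,k'\rangle$ runs over unordered pairs in $\mathbb Z^d$ with $|k-k'|=1$. The self-interaction $V\in C^2(\mathbb R)$ satisfies: there are constants $P>2$ and $K_V,C_V>0$ such that for all $q\in\mathbb R$ and $l=0,1,2$ $$K_V^{-1}|q|^{P-l}-C_V\le(\mathrm{sgn}\,q)^l\,V^{(l)}(q)\le K_V|q|^{P-l}+C_V .$$ Put $W(q,q'):=J(q-q')^2$. Loop spaces: $S_\beta$ is the circle of length $\beta$ with Lebesgue measure $d\tau$ and circle distance $\rho$; $C_\beta=C^0_\beta$ is the space of continuous functions $S_\beta\to\mathbb R$ with sup-norm; for $0<\alpha<1$, $C^\alpha_\beta$ is the usual Banach space of $\alpha$-Hölder continuous functions with norm $|\upsilon|_{C^\alpha_\beta}=\sup_\tau|\upsilon(\tau)|+\sup_{\tau\ne\tau'}|\upsilon(\tau)-\upsilon(\tau')|/\rho(\tau,\tau')^\alpha$ (equal to $+\infty$ off $C^\alpha_\beta$); $L^2_\beta=L^2(S_\beta,d\tau)$. $\gamma_\beta$ is the centered Gaussian measure on $C_\beta$ with correlation (covariance) operator $A_\beta^{-1}$ in $L^2_\beta$, where $A_\beta=-\mathfrak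 m\,\Delta_\beta+a^2\mathbf 1$ and $\Delta_\beta=d^2/d\tau^2$ is the Laplace operator on $S_\beta$. The configuration space is $\Omega=[C_\beta]^{\mathbb Z^d}\ni\omega=(\omega_k)_{k\in\mathbb Z^d}$ with the product topology and Borel $\sigma$-algebra $\mathcal B(\Omega)$. Tempered configurations: $$\Omega_t=\Big\{\omega\in\Omega:\ \sum_{k}e^{-\delta|k|}|\omega_k|^2_{L^2_\beta}<\infty\ \ \forall\delta\in(0,1)\Big\}.$$ Local specification: $\Lambda\Subset\mathbb Z^d$ means $\Lambda$ is finite and non-empty, $\Lambda^c=\mathbb Z^d\setminus\Lambda$, $\omega_\Lambda=(\omega_k)_{k\in\Lambda}$. For $\Lambda\Subset\mathbb Z^d$, $\xi\in\Omega$, $\Delta\in\mathcal B(\Omega)$, $$\pi_\Lambda(\Delta|\xi)=Z_\Lambda(\xi)^{-1}\int_{[C_\beta]^\Lambda}e^{-\mathcal I_\Lambda(\omega|\xi)}\mathbf 1_\Delta(\omega_\Lambda,\xi_{\Lambda^c})\prod_{k\in\Lambda}d\gamma_\beta(\omega_k),$$ $$\mathcal I_\Lambda(\omega|\xi)=\int_{S_\beta}\Big[\sum_{k\in\Lambda}V(\omega_k)+\sum_{\langle k,k'\rangle\subset\Lambda}W(\omega_k,\omega_{k'})+\sum_{k\in\Lambda,\,k'\in\Lambda^c,\,|k-k'|=1}W(\omega_k,\xi_{k'})\Big]d\tau,$$ with $Z_\Lambda(\xi)$ the normalization making $\pi_\Lambda(\cdot|\xi)$ a probability measure. *)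

theory Defs
  imports "HOL-Probability.Probability"
begin

section \<open>The lattice\<close>

definition lat_norm :: "int ^ 'd \<Rightarrow> real" where
  "lat_norm k = norm (\<chi> i. real_of_int (k $ i))"

definition adjacent :: "int ^ 'd \<Rightarrow> int ^ 'd \<Rightarrow> bool" where
  "adjacent k k' \<longleftrightarrow> lat_norm (k - k') = 1"


section \<open>The interaction\<close>

definition W :: "real \<Rightarrow> real \<Rightarrow> real \<Rightarrow> real" where
  "W J q q' = J * (q - q')\<^sup>2"

definition C2 :: "(real \<Rightarrow> real) \<Rightarrow> bool" where
  "C2 V \<longleftrightarrow> (\<forall>q. V differentiable (at q)) \<and> (\<forall>q. deriv V differentiable (at q)) \<and>
     continuous_on UNIV (deriv (deriv V))"

definition polynomial_growth :: "(real \<Rightarrow> real) \<Rightarrow> bool" where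
  "polynomial_growth V \<longleftrightarrow> (\<exists>P>2. \<exists>K>0. \<exists>C>0. \<forall>q. \<forall>l\<in>{0, 1, 2 :: nat}.
     inverse K * \<bar>q\<bar> powr (P - real l) - C \<le> sgn q ^ l * (deriv ^^ l) V q \<and>
     sgn q ^ l * (deriv ^^ l) V q \<le> K * \<bar>q\<bar> powr (P - real l) + C)"


section \<open>Loop spaces\<close>

text \<open>
  The circle of length \<open>\<beta>\<close> is the real line modulo \<open>\<beta>\<close>: its points are represented by
  \<open>{0..<\<beta>}\<close>, and the continuous functions on it are the continuous \<open>\<beta>\<close>-periodic functions
  on the line. The norm and the metric of the type of bounded continuous functions restrict to
  the sup-norm and its metric on \<open>loops \<beta>\<close>.
\<close>

type_synonym loop = "real \<Rightarrow>\<^sub>C real"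

definition loops :: "real \<Rightarrow> loop set" where
  "loops \<beta> = {\<upsilon> :: loop. \<forall>\<tau>. \<upsilon> (\<tau> + \<beta>) = \<upsilon> \<tau>}"

definition circle :: "real \<Rightarrow> real set" where
  "circle \<beta> = {0..<\<beta>}"

definition circle_dist :: "real \<Rightarrow> real \<Rightarrow> real \<Rightarrow> real" where
  "circle_dist \<beta> \<tau> \<tau>' = min \<bar>\<tau> - \<tau>'\<bar> (\<beta> - \<bar>\<tau> - \<tau>'\<bar>)" \<comment> \<open>for representatives in \<open>circle \<beta>\<close>\<close>

abbreviation circle_integral :: "real \<Rightarrow> (real \<Rightarrow> real) \<Rightarrow> real" where
  "circle_integral \<beta> f \<equiv> (LINT \<tau>:circle \<beta>|lborel. f \<tau>)"

definition circle_L2 :: "real \<Rightarrow> (real \<Rightarrow> real) set" where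
  "circle_L2 \<beta> = {\<phi> \<in> borel_measurable borel. set_integrable lborel (circle \<beta>) (\<lambda>\<tau>. (\<phi> \<tau>)\<^sup>2)}"

definition L2_inner :: "real \<Rightarrow> (real \<Rightarrow> real) \<Rightarrow> (real \<Rightarrow> real) \<Rightarrow> real" where
  "L2_inner \<beta> \<phi> \<psi> = circle_integral \<beta> (\<lambda>\<tau>. \<phi> \<tau> * \<psi> \<tau>)"

definition L2_norm :: "real \<Rightarrow> (real \<Rightarrow> real) \<Rightarrow> real" where
  "L2_norm \<beta> \<phi> = sqrt (L2_inner \<beta> \<phi> \<phi>)"

text \<open>
  The norm of \<open>C\<^sup>\<alpha>\<close>, with value \<open>\<infinity>\<close> off that space; for \<open>\<alpha> = 0\<close> it is the sup-norm.
\<close>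

definition holder_norm :: "real \<Rightarrow> real \<Rightarrow> loop \<Rightarrow> ennreal" where
  "holder_norm \<beta> \<alpha> \<upsilon> = (SUP \<tau>\<in>circle \<beta>. ennreal \<bar>\<upsilon> \<tau>\<bar>) +
     (if \<alpha> = 0 then 0
      else SUP (\<tau>, \<tau>')\<in>{(\<tau>, \<tau>'). \<tau> \<in> circle \<beta> \<and> \<tau>' \<in> circle \<beta> \<and> \<tau> \<noteq> \<tau>'}.
             ennreal (\<bar>\<upsilon> \<tau> - \<upsilon> \<tau>'\<bar> / circle_dist \<beta> \<tau> \<tau>' powr \<alpha>))"

definition ennreal_powr :: "ennreal \<Rightarrow> real \<Rightarrow> ennreal" where
  "ennreal_powr x Q = (if x = \<infinity> then \<infinity> else ennreal (enn2real x powr Q))" \<comment> \<open>for \<open>Q > 0\<close>\<close>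


section \<open>The Gaussian loop measure\<close>

text \<open>
  \<open>laplacian \<beta> u g\<close> says that \<open>u\<close> lies in the domain of the Laplace operator on the circle, i.e.
  in the Sobolev space of order two, and that \<open>g\<close> represents \<open>u''\<close> in \<open>L\<^sup>2\<close>. Elements of
  the domain are identified with their continuously differentiable representatives; periodicity
  of the derivative follows from that of \<open>u\<close>.
\<close>

definition laplacian :: "real \<Rightarrow> loop \<Rightarrow> (real \<Rightarrow> real) \<Rightarrow> bool" where
  "laplacian \<beta> u g \<longleftrightarrow> u \<in> loops \<beta> \<and> g \<in> circle_L2 \<beta> \<and>
     (\<forall>\<tau>. apply_bcontfun u differentiable (at \<tau>)) \<and>
     (\<forall>\<tau>\<in>{0..\<beta>}. deriv u \<tau> = deriv u 0 + (LINT s:{0..\<tau>}|lborel. g s))"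

text \<open>\<open>A_op \<beta> m a u \<psi>\<close>: \<open>u\<close> is in the domain of \<open>A = - m \<Delta> + a\<^sup>2\<close> and \<open>A u = \<psi>\<close>.\<close>

definition A_op :: "real \<Rightarrow> real \<Rightarrow> real \<Rightarrow> loop \<Rightarrow> (real \<Rightarrow> real) \<Rightarrow> bool" where
  "A_op \<beta> m a u \<psi> \<longleftrightarrow> (\<exists>g. laplacian \<beta> u g \<and> \<psi> = (\<lambda>\<tau>. - m * g \<tau> + a\<^sup>2 * u \<tau>))"

definition centered_gaussian :: "real measure \<Rightarrow> bool" where
  "centered_gaussian M \<longleftrightarrow>
     M = return borel 0 \<or> (\<exists>\<sigma>>0. M = density lborel (\<lambda>x. ennreal (normal_density 0 \<sigma> x)))"

text \<open>
  A centered Gaussian measure on the Banach space \<open>loops \<beta>\<close> is a Borel probability measure under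
  which every continuous linear functional has a centered Gaussian law. By the Hahn-Banach theorem
  the continuous linear functionals on \<open>loops \<beta>\<close> are the restrictions of those on the whole type.
  The last clause states that the covariance operator \<open>C\<close>, characterised by
  \<open>\<langle>\<phi>, C \<psi>\<rangle> = \<integral> \<langle>\<phi>, \<upsilon>\<rangle> \<langle>\<psi>, \<upsilon>\<rangle> d\<gamma>\<close>, maps \<open>\<psi>\<close> to \<open>A\<inverse> \<psi>\<close>.
\<close>

definition gaussian_loop_measure :: "real \<Rightarrow> real \<Rightarrow> real \<Rightarrow> loop measure \<Rightarrow> bool" where
  "gaussian_loop_measure \<beta> m a \<gamma> \<longleftrightarrow>
     prob_space \<gamma> \<and> sets \<gamma> = sets (restrict_space borel (loops \<beta>)) \<and>
     (\<forall>f :: loop \<Rightarrow> real. bounded_linear f \<longrightarrow> centered_gaussian (distr \<gamma> borel f)) \<and>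
     (\<forall>\<phi>\<in>circle_L2 \<beta>. \<forall>\<psi>\<in>circle_L2 \<beta>. \<forall>u. A_op \<beta> m a u \<psi> \<longrightarrow>
        (\<integral>\<upsilon>. L2_inner \<beta> \<phi> \<upsilon> * L2_inner \<beta> \<psi> \<upsilon> \<partial>\<gamma>) = L2_inner \<beta> \<phi> u)"


section \<open>Configurations and the local specification\<close>

type_synonym 'd config = "int ^ 'd \<Rightarrow> loop"

definition configs :: "real \<Rightarrow> 'd::finite config set" where
  "configs \<beta> = {\<omega> :: 'd config. \<forall>k. \<omega> k \<in> loops \<beta>}"

text \<open>Here \<open>borel\<close> refers to the product topology on the function type.\<close>

definition config_borel :: "real \<Rightarrow> 'd::finite config measure" where
  "config_borel \<beta> = restrict_space borel (configs \<beta>)"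

definition tempered_configs :: "real \<Rightarrow> 'd::finite config set" where
  "tempered_configs \<beta> = {\<omega> \<in> configs \<beta>. \<forall>\<delta>. 0 < \<delta> \<and> \<delta> < 1 \<longrightarrow>
     (\<lambda>k. exp (- \<delta> * lat_norm k) * (L2_norm \<beta> (\<omega> k))\<^sup>2) summable_on UNIV}"

text \<open>
  As \<open>W\<close> is symmetric, the sum over unordered neighbouring pairs inside \<open>\<Lambda>\<close> is half the sum
  over the ordered ones.
\<close>

definition local_energy ::
  "real \<Rightarrow> (real \<Rightarrow> real) \<Rightarrow> real \<Rightarrow> (int ^ 'd) set \<Rightarrow> 'd::finite config \<Rightarrow> 'd config \<Rightarrow> real" where
  "local_energy \<beta> V J \<Lambda> \<xi> \<omega> = circle_integral \<beta> (\<lambda>\<tau>.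
     (\<Sum>k\<in>\<Lambda>. V (\<omega> k \<tau>)) +
     (\<Sum>k\<in>\<Lambda>. \<Sum>k'\<in>{k'\<in>\<Lambda>. adjacent k k'}. W J (\<omega> k \<tau>) (\<omega> k' \<tau>)) / 2 +
     (\<Sum>k\<in>\<Lambda>. \<Sum>k'\<in>{k'\<in>- \<Lambda>. adjacent k k'}. W J (\<omega> k \<tau>) (\<xi> k' \<tau>)))"

definition glue :: "(int ^ 'd) set \<Rightarrow> 'd::finite config \<Rightarrow> 'd config \<Rightarrow> 'd config" where
  "glue \<Lambda> \<xi> \<omega> = (\<lambda>k. if k \<in> \<Lambda> then \<omega> k else \<xi> k)"

definition partition_function ::
  "real \<Rightarrow> (real \<Rightarrow> real) \<Rightarrow> real \<Rightarrow> loop measure \<Rightarrow> (int ^ 'd) set \<Rightarrow> 'd::finite config \<Rightarrow> ennreal" where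
  "partition_function \<beta> V J \<gamma> \<Lambda> \<xi> =
     (\<integral>\<^sup>+\<omega>. ennreal (exp (- local_energy \<beta> V J \<Lambda> \<xi> \<omega>)) \<partial>(\<Pi>\<^sub>M k\<in>\<Lambda>. \<gamma>))"

text \<open>
  The law, under the normalised weight \<open>exp (- I) / Z\<close> on \<open>\<Prod>\<^sub>k \<gamma>\<close>, of the configuration that equals
  \<open>\<omega>\<close> on \<open>\<Lambda>\<close> and \<open>\<xi>\<close> off it.
\<close>

definition local_spec ::
  "real \<Rightarrow> (real \<Rightarrow> real) \<Rightarrow> real \<Rightarrow> loop measure \<Rightarrow> (int ^ 'd) set \<Rightarrow> 'd::finite config
     \<Rightarrow> 'd config measure" where
  "local_spec \<beta> V J \<gamma> \<Lambda> \<xi> =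
     distr
       (density (\<Pi>\<^sub>M k\<in>\<Lambda>. \<gamma>)
          (\<lambda>\<omega>. ennreal (exp (- local_energy \<beta> V J \<Lambda> \<xi> \<omega>)) / partition_function \<beta> V J \<gamma> \<Lambda> \<xi>))
       (config_borel \<beta>) (glue \<Lambda> \<xi>)"

end

(*
  Write n_k for the logarithm of the Gibbs expectation of exp (kappa |omega_k|^2 + |omega_k|_alpha),
  with |.| the L^2 norm and |.|_alpha the Hoelder norm of exponent alpha. Conditioning on all sites
  but k leaves an integral over a single loop, weighted by exp (- V - W). As V grows faster than
  quadratically, its numerator is bounded for every kappa, whereas its normalisation is at least
  exp (- C - 2 J sum |omega_l|^2), the sum running over the neighbours l of k. Hoelder's inequality
  then gives
    n_k <= C + 2 J (sum over l outside Lambda) |xi_l|^2 + (2 J / kappa) (sum over l inside Lambda) n_l.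
  The factor 2 J does not depend on kappa, so that for large kappa this is a contraction in the
  sup-norm with weight exp (- eps |k|), uniformly in Lambda: n_k <= M exp (eps |k|).
  Polynomial moments grow at most polynomially in n_k.

  That exp |omega|_alpha is integrable for the Gaussian measure follows by dyadic chaining from
  Var (omega(t) - omega(s)) <= |t - s| / m. This is an energy estimate: if A u = phi, where phi is an
  approximation of delta_t - delta_s, then Var <phi, omega> = <phi, u> is both at least m |u'|^2
  and, up to the approximation error, at most |u(t) - u(s)| <= |t - s|^(1/2) |u'|.
*)
theory Submission
  imports Defs
begin

section \<open>Dyadic chaining\<close>

text \<open>The logarithms n_k are the natural unknowns: a neighbour enters the one-site bound
  through exp (2 J |omega_l|^2), which polynomial moments do not control, while Hoelder's inequality
  makes the bound linear in the n_l. The L^2 part of the weight drives this recursion; the Hoelder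
  norm is only carried along and meets the Gaussian measure in a single integral. A contraction says
  something about finite numbers only. So each n_k is first shown to be finite by a crude bound that
  grows with the size of Lambda; the uniform bound then comes from the recursion at a site where the
  weighted maximum is attained. The choice eps = 0 serves bounded boundary conditions. For tempered
  ones eps > 0 is so small that the Q-th power of exp (eps |k|) uses up at most half of the decay
  exp (- delta |k|), and the other half is summable. The Gaussian measure is given by its covariance
  operator alone and tested against functions, so the variance of an increment is read off the
  differential equation A u = phi, without the integral kernel of the inverse of A, and reaches
  point values by a limit.\<close>

lemma dyadic_scale:
  fixes d :: real
  assumes "0 < d" "d \<le> 1"
  obtains n :: nat where "d \<le> 1 / 2 ^ n" "1 / 2 ^ n < 2 * d"
proof -
  define n where "n = nat \<lfloor>log 2 (1 / d)\<rfloor>"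
  have nn: "log 2 (1 / d) \<ge> 0" using assms by (simp add: field_simps)
  have 1: "real n \<le> log 2 (1 / d)" "log 2 (1 / d) < real n + 1"
    using nn unfolding n_def by linarith+
  have "2 powr real n \<le> 2 powr log 2 (1 / d)" "2 powr log 2 (1 / d) < 2 powr (real n + 1)"
    using 1 by auto
  then have "2 ^ n \<le> 1 / d" "1 / d < 2 * 2 ^ n"
    using assms by (simp_all add: powr_add powr_realpow)
  then have "d \<le> 1 / 2 ^ n" "1 / 2 ^ n < 2 * d" using assms by (simp_all add: field_simps)
  then show ?thesis by (rule that)
qed

text \<open>From one level to the next the rounded point stays or moves by one step of the finer
  grid, which is what chaining exploits. The same rounding later reduces joint measurability in loop
  and time to countably many times.\<close>

definition dyadic_floor :: "nat \<Rightarrow> real \<Rightarrow> real" where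
  "dyadic_floor n x = \<lfloor>2 ^ n * x\<rfloor> / 2 ^ n"

lemma dyadic_floor_tendsto: "(\<lambda>n. dyadic_floor n x) \<longlonglongrightarrow> x"
proof (rule tendsto_sandwich)
  have "x - (1/2) ^ n \<le> dyadic_floor n x" for n
  proof -
    have "x - (1/2) ^ n = (2 ^ n * x - 1) / 2 ^ n" by (simp add: field_simps)
    also have "\<dots> \<le> dyadic_floor n x"
      unfolding dyadic_floor_def by (intro divide_right_mono) (linarith, simp)
    finally show ?thesis .
  qed
  then show "\<forall>\<^sub>F n in sequentially. x - (1/2) ^ n \<le> dyadic_floor n x" by simp
  show "\<forall>\<^sub>F n in sequentially. dyadic_floor n x \<le> x"
    by (auto simp: dyadic_floor_def field_simps)
  show "(\<lambda>n. x - (1/2) ^ n) \<longlonglongrightarrow> x"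
    by (rule tendsto_eq_intros LIMSEQ_realpow_zero refl | simp)+
qed simp

text \<open>The bracket collects one grid step at the scale of the two points and a geometric tail
  for each of them; \<open>2 powr \<alpha>\<close> is the price of replacing the scale
  \<open>1 / 2 ^ n\<close> by the distance, which exceeds half of it.\<close>

definition chaining_const :: "real \<Rightarrow> real" where
  "chaining_const \<alpha> = 2 powr \<alpha> * (1 + 2 * (\<Sum>n. 2 powr (- \<alpha> * real (Suc n))))"

lemma chaining_summable:
  assumes "\<alpha> > 0"
  shows "summable (\<lambda>n. (2::real) powr (- \<alpha> * real (Suc n)))"
proof -
  have "(2::real) powr (- \<alpha> * real (Suc n)) = (2 powr (- \<alpha>)) ^ Suc n" for n
    by (subst powr_realpow[symmetric]) (simp_all add: powr_powr del: power_Suc of_nat_Suc)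
  moreover have "(2::real) powr - \<alpha> < 1" using assms by (simp add: powr_less_one)
  ultimately show ?thesis by (simp add: summable_mult)
qed

lemma chaining_const_nonneg: "\<alpha> > 0 \<Longrightarrow> 0 \<le> chaining_const \<alpha>"
  unfolding chaining_const_def
  by (intro mult_nonneg_nonneg add_nonneg_nonneg suminf_nonneg chaining_summable) auto

text \<open>The deterministic half of Kolmogorov's continuity theorem. At a level \<open>n\<close>
  with mesh comparable to the distance, the roundings of the two points agree or are neighbours.
  Each point is joined to its rounding by a telescoping series with at most one grid increment per
  finer level, and continuity identifies the limit of the series.\<close>

lemma dyadic_chaining:
  fixes f :: "real \<Rightarrow> real"
  assumes cont: "continuous_on {0..1} f" and \<alpha>: "\<alpha> > 0"
    and M: "\<And>n j. j < 2 ^ n \<Longrightarrow>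
      \<bar>f ((real j + 1) / 2 ^ n) - f (real j / 2 ^ n)\<bar> \<le> M * 2 powr (- \<alpha> * real n)"
    and xy: "x \<in> {0..1}" "y \<in> {0..1}"
  shows "\<bar>f x - f y\<bar> \<le> chaining_const \<alpha> * M * \<bar>x - y\<bar> powr \<alpha>"
proof -
  define S where "S = (\<Sum>n. (2::real) powr (- \<alpha> * real (Suc n)))"
  have S0: "S \<ge> 0" unfolding S_def by (intro suminf_nonneg chaining_summable \<alpha>) auto
  have M0: "M \<ge> 0" using M[of 0 0] by simp
  have grid: "\<bar>f (of_int (i + 1) / 2 ^ n) - f (of_int i / 2 ^ n)\<bar> \<le> M * 2 powr (- \<alpha> * real n)"
    if "0 \<le> i" "i < 2 ^ n" for i :: int and n :: nat
  proof -
    define j where "j = nat i"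
    have j: "i = int j" using that(1) by (simp add: j_def)
    have "j < 2 ^ n" using that(2) j by simp
    from M[OF this] show ?thesis by (simp add: j add.commute)
  qed
  have df: "dyadic_floor n z \<in> {0..1}" if "z \<in> {0..1}" for n z
  proof -
    have "\<lfloor>2 ^ n * z\<rfloor> \<ge> 0" using that by simp
    moreover have "\<lfloor>2 ^ n * z\<rfloor> \<le> 2 ^ n * z" by linarith
    moreover have "2 ^ n * z \<le> 2 ^ n" using that by (simp add: mult_left_le)
    ultimately have "0 \<le> real_of_int \<lfloor>2 ^ n * z\<rfloor>" "real_of_int \<lfloor>2 ^ n * z\<rfloor> \<le> 2 ^ n" by linarith+
    then show ?thesis unfolding dyadic_floor_def by (simp add: divide_le_eq_1)
  qed
  have step: "\<bar>f (dyadic_floor (Suc n) z) - f (dyadic_floor n z)\<bar> \<le> M * 2 powr (- \<alpha> * real (Suc n))"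
    if z: "z \<in> {0..1}" for n z
  proof -
    define i where "i = \<lfloor>2 ^ n * z\<rfloor>"
    have i: "of_int i \<le> 2 ^ n * z" "2 ^ n * z < of_int i + 1" unfolding i_def by linarith+
    have "\<lfloor>2 ^ Suc n * z\<rfloor> = 2 * i \<or> \<lfloor>2 ^ Suc n * z\<rfloor> = 2 * i + 1"
    proof -
      have "2 ^ Suc n * z = 2 * (2 ^ n * z)" by simp
      then show ?thesis using i by linarith
    qed
    moreover have eq: "dyadic_floor n z = of_int (2 * i) / 2 ^ Suc n"
      by (simp add: dyadic_floor_def i_def)
    ultimately consider "dyadic_floor (Suc n) z = dyadic_floor n z"
      | "dyadic_floor (Suc n) z = of_int (2 * i + 1) / 2 ^ Suc n" "\<lfloor>2 ^ Suc n * z\<rfloor> = 2 * i + 1"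
      unfolding dyadic_floor_def by force
    then show ?thesis
    proof cases
      case 1
      then show ?thesis using M0 by simp
    next
      case 2
      have "i \<ge> 0" using z by (simp add: i_def)
      \<comment> \<open>The increment starts at the grid point with index \<open>2 * i\<close>, and
        \<open>grid\<close> wants this index strictly below \<open>2 ^ Suc n\<close>, so its right
        end has to be shown to lie in the unit interval.\<close>
      moreover have "2 * i + 1 \<le> 2 ^ Suc n"
      proof -
        have "of_int (2 * i + 1) \<le> 2 ^ Suc n * z" using 2(2) by linarith
        also have "\<dots> \<le> 2 ^ Suc n" using z by (simp add: mult_left_le)
        finally show ?thesis by (simp only: of_int_le_numeral_power_cancel_iff)
      qed
      ultimately have "\<bar>f (of_int (2 * i + 1) / 2 ^ Suc n) - f (of_int (2 * i) / 2 ^ Suc n)\<bar>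
          \<le> M * 2 powr (- \<alpha> * real (Suc n))"
        by (intro grid) auto
      then show ?thesis using 2(1) eq by simp
    qed
  qed
  have tele: "\<bar>f z - f (dyadic_floor n z)\<bar> \<le> M * 2 powr (- \<alpha> * real n) * S"
    if z: "z \<in> {0..1}" for n z
  proof -
    have part: "\<bar>f (dyadic_floor (n + k) z) - f (dyadic_floor n z)\<bar>
        \<le> M * 2 powr (- \<alpha> * real n) * (\<Sum>i<k. 2 powr (- \<alpha> * real (Suc i)))" for k
    proof (induction k)
      case (Suc k)
      have "M * 2 powr (- \<alpha> * real (Suc (n + k)))
          = M * 2 powr (- \<alpha> * real n) * 2 powr (- \<alpha> * real (Suc k))"
        by (simp add: powr_add[symmetric] algebra_simps)
      then have "\<bar>f (dyadic_floor (Suc (n + k)) z) - f (dyadic_floor n z)\<bar>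
          \<le> M * 2 powr (- \<alpha> * real n) * (\<Sum>i<k. 2 powr (- \<alpha> * real (Suc i)))
            + M * 2 powr (- \<alpha> * real n) * 2 powr (- \<alpha> * real (Suc k))"
        using Suc step[OF z, of "n + k"] by linarith
      then show ?case by (simp add: distrib_left)
    qed simp
    have "(\<lambda>k. f (dyadic_floor (n + k) z)) \<longlonglongrightarrow> f z"
      by (rule continuous_on_tendsto_compose[OF cont])
        (use z df LIMSEQ_ignore_initial_segment[OF dyadic_floor_tendsto[of z], of n]
          in \<open>auto simp: add.commute\<close>)
    then have "(\<lambda>k. \<bar>f (dyadic_floor (n + k) z) - f (dyadic_floor n z)\<bar>)
        \<longlonglongrightarrow> \<bar>f z - f (dyadic_floor n z)\<bar>"
      by (intro tendsto_intros)
    moreover have "\<bar>f (dyadic_floor (n + k) z) - f (dyadic_floor n z)\<bar>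
        \<le> M * 2 powr (- \<alpha> * real n) * S" for k
    proof (rule order_trans[OF part])
      show "M * 2 powr (- \<alpha> * real n) * (\<Sum>i<k. 2 powr (- \<alpha> * real (Suc i)))
          \<le> M * 2 powr (- \<alpha> * real n) * S"
        unfolding S_def using M0
        by (intro mult_left_mono sum_le_suminf chaining_summable \<alpha>) auto
    qed
    ultimately show ?thesis by (intro LIMSEQ_le_const2) auto
  qed
  have main: "\<bar>f x - f y\<bar> \<le> chaining_const \<alpha> * M * \<bar>x - y\<bar> powr \<alpha>"
    if xy: "x \<in> {0..1}" "y \<in> {0..1}" "x < y" for x y
  proof -
    obtain n where n: "y - x \<le> 1 / 2 ^ n" "1 / 2 ^ n < 2 * (y - x)"
      by (rule dyadic_scale[of "y - x"]) (use xy in auto)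
    define i where "i = \<lfloor>2 ^ n * x\<rfloor>"
    define i' where "i' = \<lfloor>2 ^ n * y\<rfloor>"
    have "2 ^ n * y \<le> 2 ^ n * x + 1" using n(1) by (simp add: field_simps)
    moreover have "2 ^ n * x \<le> 2 ^ n * y" using xy by simp
    ultimately have ii: "i' = i \<or> i' = i + 1" unfolding i_def i'_def by linarith
    have i0: "i \<ge> 0" using xy by (simp add: i_def)
    have i2: "i' \<le> 2 ^ n"
    proof -
      have "of_int i' \<le> 2 ^ n * y" unfolding i'_def by linarith
      also have "\<dots> \<le> 2 ^ n" using xy by (simp add: mult_left_le)
      finally show ?thesis by (simp only: of_int_le_numeral_power_cancel_iff)
    qed
    have "\<bar>f (dyadic_floor n y) - f (dyadic_floor n x)\<bar> \<le> M * 2 powr (- \<alpha> * real n)"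
      using ii
    proof
      assume "i' = i" then show ?thesis using M0 by (simp add: dyadic_floor_def i_def i'_def)
    next
      assume "i' = i + 1"
      then show ?thesis using grid[of i n] i0 i2 by (simp add: dyadic_floor_def i_def i'_def)
    qed
    then have "\<bar>f x - f y\<bar> \<le> M * 2 powr (- \<alpha> * real n) * (1 + 2 * S)"
      using tele[OF xy(1), of n] tele[OF xy(2), of n] by (simp add: algebra_simps)
    also have "2 powr (- \<alpha> * real n) \<le> 2 powr \<alpha> * \<bar>x - y\<bar> powr \<alpha>"
    proof -
      have "2 powr (- \<alpha> * real n) = (1 / 2 ^ n) powr \<alpha>"
        by (simp add: powr_realpow[symmetric] powr_powr powr_minus_divide powr_divide mult.commute)
      also have "\<dots> \<le> (2 * (y - x)) powr \<alpha>" using n(2) \<alpha> by (intro powr_mono2) auto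
      also have "\<dots> = 2 powr \<alpha> * \<bar>x - y\<bar> powr \<alpha>" using xy powr_mult[of 2 "y - x" \<alpha>]
        by (simp del: right_diff_distrib_numeral)
      finally show ?thesis .
    qed
    finally have "\<bar>f x - f y\<bar> \<le> M * (2 powr \<alpha> * \<bar>x - y\<bar> powr \<alpha>) * (1 + 2 * S)"
      using M0 S0 by (simp add: mult_left_mono mult_right_mono)
    moreover have "chaining_const \<alpha> = 2 powr \<alpha> * (1 + 2 * S)"
      by (simp only: chaining_const_def S_def)
    ultimately show ?thesis by (simp add: algebra_simps)
  qed
  show ?thesis
  proof (cases x y rule: linorder_cases)
    case less then show ?thesis using main xy by blast
  next
    case greater then show ?thesis using main[of y x] xy by (simp add: abs_minus_commute)
  qed simp
qed

section \<open>Periodic equations on the circle\<close>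

lemma continuous_has_antiderivative:
  fixes f :: "real \<Rightarrow> real"
  assumes "continuous_on UNIV f"
  obtains F where "\<And>x. (F has_real_derivative f x) (at x)"
proof -
  have "isCont f x" for x using assms by (simp add: continuous_on_eq_continuous_at)
  then have "\<exists>F. \<forall>x::real. - \<infinity> < ereal x \<longrightarrow> ereal x < \<infinity> \<longrightarrow> (F has_vector_derivative f x) (at x)"
    by (intro einterval_antiderivative) auto
  then show ?thesis using that by (auto simp: has_real_derivative_iff_has_vector_derivative)
qed

text \<open>Variation of constants: \<open>exp (c * t) * (F t + k)\<close> is a solution for each
  \<open>k\<close>. The function \<open>G\<close>, the defect of \<open>F\<close> over one period,
  is constant, so periodicity is a single linear equation for \<open>k\<close>, solvable because
  \<open>exp (c * \<beta>)\<close> differs from 1.\<close>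

lemma periodic_linear_ode:
  fixes f :: "real \<Rightarrow> real"
  assumes "c \<noteq> 0" "\<beta> > 0" and f: "continuous_on UNIV f" and per: "\<And>t. f (t + \<beta>) = f t"
  obtains v where "\<And>t. (v has_real_derivative c * v t + f t) (at t)" "\<And>t. v (t + \<beta>) = v t"
proof -
  have "continuous_on UNIV (\<lambda>s. exp (- c * s) * f s)" by (intro continuous_intros f)
  then obtain F where F: "\<And>x. (F has_real_derivative exp (- c * x) * f x) (at x)"
    using continuous_has_antiderivative by blast
  have Fc: "((\<lambda>x. F (x + \<beta>)) has_real_derivative exp (- c * (x + \<beta>)) * f x) (at x)" for x
    using DERIV_shift[of F "exp (- c * (x + \<beta>)) * f (x + \<beta>)" x \<beta>] F[of "x + \<beta>"] per by simp
  define G where "G x = F (x + \<beta>) - exp (- c * \<beta>) * F x" for x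
  have "(G has_real_derivative 0) (at x)" for x
  proof -
    have e: "exp (- c * (x + \<beta>)) = exp (- c * \<beta>) * exp (- c * x)"
      by (simp add: exp_add[symmetric] algebra_simps)
    have "(G has_real_derivative exp (- c * (x + \<beta>)) * f x - exp (- c * \<beta>) * (exp (- c * x) * f x)) (at x)"
      unfolding G_def by (intro DERIV_diff DERIV_cmult Fc F)
    then show ?thesis unfolding e by (simp add: mult.assoc)
  qed
  then have G: "G x = G 0" for x
    using DERIV_const_ratio_const[of 0 x G 0] by (cases "x = 0") (auto dest: DERIV_isconst_all)
  define k where "k = exp (c * \<beta>) * G 0 / (1 - exp (c * \<beta>))"
  have "exp (c * \<beta>) \<noteq> 1" using assms by simp
  then have k: "exp (c * \<beta>) * (G 0 + k) = k" by (simp add: k_def field_simps)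
  define v where "v t = exp (c * t) * (F t + k)" for t
  show ?thesis
  proof
    fix t
    show "(v has_real_derivative c * v t + f t) (at t)"
      unfolding v_def
      by (rule derivative_eq_intros F refl | simp add: algebra_simps)+
        (simp add: mult.assoc[symmetric] exp_add[symmetric])
    have "v (t + \<beta>) = exp (c * t) * (exp (c * \<beta>) * (F (t + \<beta>) + k))"
      by (simp add: v_def algebra_simps exp_add)
    also have "F (t + \<beta>) = exp (- c * \<beta>) * F t + G 0" using G[of t] by (simp add: G_def)
    also have "exp (c * \<beta>) * (exp (- c * \<beta>) * F t + G 0 + k)
        = exp (c * \<beta>) * exp (- c * \<beta>) * F t + exp (c * \<beta>) * (G 0 + k)" by (simp add: algebra_simps)
    also have "\<dots> = F t + k" unfolding k by (simp add: exp_add[symmetric])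
    finally show "v (t + \<beta>) = v t" by (simp add: v_def)
  qed
qed

text \<open>With c^2 = a^2 / m the operator d^2/dt^2 - c^2 factors into (d/dt - c) (d/dt + c), so
  two periodic first-order equations are solved one after the other, first for \<open>v\<close> and
  then for \<open>u\<close>.\<close>

lemma periodic_elliptic_equation:
  fixes \<phi> :: "real \<Rightarrow> real"
  assumes "m > 0" "a \<noteq> 0" "\<beta> > 0"
    and \<phi>: "continuous_on UNIV \<phi>" and per: "\<And>t. \<phi> (t + \<beta>) = \<phi> t"
  obtains u u' where "\<And>t. (u has_real_derivative u' t) (at t)"
    "\<And>t. (u' has_real_derivative (a\<^sup>2 * u t - \<phi> t) / m) (at t)"
    "\<And>t. u (t + \<beta>) = u t" "\<And>t. u' (t + \<beta>) = u' t"
proof -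
  define c where "c = \<bar>a\<bar> / sqrt m"
  have c: "c \<noteq> 0" "c\<^sup>2 = a\<^sup>2 / m" using assms by (simp_all add: c_def power_divide)
  obtain v where v: "\<And>t. (v has_real_derivative c * v t + - \<phi> t / m) (at t)" "\<And>t. v (t + \<beta>) = v t"
    by (rule periodic_linear_ode[of c \<beta> "\<lambda>t. - \<phi> t / m"]) (use assms c in \<open>auto intro!: continuous_intros \<phi>\<close>)
  have "continuous_on UNIV v"
    using v(1) by (meson DERIV_isCont continuous_at_imp_continuous_on)
  then obtain u where u: "\<And>t. (u has_real_derivative (- c) * u t + v t) (at t)" "\<And>t. u (t + \<beta>) = u t"
    using periodic_linear_ode[of "- c" \<beta> v] assms c v by auto
  show ?thesis
  proof
    fix t
    show "(u has_real_derivative (- c) * u t + v t) (at t)" "u (t + \<beta>) = u t"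
      "(- c) * u (t + \<beta>) + v (t + \<beta>) = (- c) * u t + v t" using u v by simp_all
    have "((\<lambda>t. (- c) * u t + v t) has_real_derivative (- c) * ((- c) * u t + v t) + (c * v t + - \<phi> t / m)) (at t)"
      by (rule derivative_eq_intros u v refl | simp)+
    also have "(- c) * ((- c) * u t + v t) + (c * v t + - \<phi> t / m) = c\<^sup>2 * u t - \<phi> t / m"
      by (simp add: algebra_simps power2_eq_square)
    also have "\<dots> = (a\<^sup>2 * u t - \<phi> t) / m" by (simp add: c diff_divide_distrib)
    finally show "((\<lambda>t. (- c) * u t + v t) has_real_derivative (a\<^sup>2 * u t - \<phi> t) / m) (at t)" .
  qed
qed

lemma periodic_bcontfun:
  fixes f :: "real \<Rightarrow> real"
  assumes "\<beta> > 0" "continuous_on UNIV f" and per: "\<And>t. f (t + \<beta>) = f t"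
  shows "f \<in> bcontfun"
proof -
  interpret periodic_fun_simple f \<beta> by standard (rule per)
  have "range f \<subseteq> f ` {0..\<beta>}"
  proof safe
    fix x
    have "of_int \<lfloor>x / \<beta>\<rfloor> * \<beta> \<le> x" using assms(1) by (simp flip: pos_le_divide_eq)
    moreover have "x \<le> (of_int \<lfloor>x / \<beta>\<rfloor> + 1) * \<beta>"
      using assms(1) by (simp flip: pos_divide_le_eq)
    moreover have "f x = f (x - of_int \<lfloor>x / \<beta>\<rfloor> * \<beta>)" by (simp add: minus_of_int)
    ultimately show "f x \<in> f ` {0..\<beta>}" by (intro image_eqI) (auto simp: algebra_simps)
  qed
  moreover have "compact (f ` {0..\<beta>})"
    by (intro compact_continuous_image continuous_on_subset[OF assms(2)]) auto
  ultimately have "bounded (range f)" by (meson bounded_subset compact_imp_bounded)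
  then show ?thesis using assms by (simp add: bcontfun_def)
qed

lemma periodic_is_loop:
  fixes f :: "real \<Rightarrow> real"
  assumes "\<beta> > 0" "continuous_on UNIV f" "\<And>t. f (t + \<beta>) = f t"
  obtains u where "u \<in> loops \<beta>" "apply_bcontfun u = f"
  using periodic_bcontfun[OF assms] assms
  by (intro that[of "Bcontfun f"]) (simp_all add: Bcontfun_inverse loops_def)

lemma loop_continuous: "continuous_on S (apply_bcontfun (u :: loop))"
  by (rule continuous_on_subset[of UNIV]) auto

lemma loop_bound: "\<bar>apply_bcontfun (u :: loop) t\<bar> \<le> norm u"
  using norm_bounded[of u t] by simp

text \<open>Leads from Lebesgue integrals over the half-open circle to gauge integrals over the
  closed interval, where the fundamental theorem of calculus applies; the added end point is a null
  set.\<close>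

lemma circle_integral_continuous:
  fixes f :: "real \<Rightarrow> real"
  assumes "continuous_on {0..\<beta>} f"
  shows "set_integrable lborel (circle \<beta>) f" "circle_integral \<beta> f = integral {0..\<beta>} f"
proof -
  have "set_integrable lborel {0..\<beta>} f" by (rule borel_integrable_atLeastAtMost'[OF assms])
  then show 1: "set_integrable lborel (circle \<beta>) f"
    by (rule set_integrable_subset) (auto simp: circle_def)
  have "circle_integral \<beta> f = integral (circle \<beta>) f" by (rule set_borel_integral_eq_integral(2)[OF 1])
  also have "\<dots> = integral {0..\<beta>} f"
  proof (rule integral_spike_set)
    show "negligible {x \<in> circle \<beta> - {0..\<beta>}. f x \<noteq> 0}"
      by (rule negligible_subset[of "{}"]) (auto simp: circle_def)
    show "negligible {x \<in> {0..\<beta>} - circle \<beta>. f x \<noteq> 0}"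
      by (rule negligible_subset[of "{\<beta>}"]) (auto simp: circle_def)
  qed
  finally show "circle_integral \<beta> f = integral {0..\<beta>} f" .
qed

lemma integral_weighted_le:
  fixes \<eta> w :: "real \<Rightarrow> real"
  assumes "continuous_on {0..\<beta>} \<eta>" "continuous_on {0..\<beta>} w"
    and "\<And>t. t \<in> {0..\<beta>} \<Longrightarrow> \<eta> t \<ge> 0" "integral {0..\<beta>} \<eta> = 1"
    and "\<And>t. t \<in> {0..\<beta>} \<Longrightarrow> \<eta> t \<noteq> 0 \<Longrightarrow> w t \<le> B"
  shows "integral {0..\<beta>} (\<lambda>t. \<eta> t * w t) \<le> B"
proof -
  have "integral {0..\<beta>} (\<lambda>t. \<eta> t * w t) \<le> integral {0..\<beta>} (\<lambda>t. \<eta> t * B)"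
  proof (rule integral_le)
    fix t assume "t \<in> {0..\<beta>}"
    then show "\<eta> t * w t \<le> \<eta> t * B"
      using assms(3,5)[of t] by (cases "\<eta> t = 0") (auto intro: mult_left_mono)
  qed (auto intro!: integrable_continuous_real continuous_intros assms)
  also have "\<dots> = B" using assms(4) by simp
  finally show ?thesis .
qed

text \<open>A truncated cosine is continuous and periodic by construction. A periodic bump centred
  at 0 or \<beta> would put half of its mass near the opposite end of the interval, far from
  \<open>t\<close> in the distance of the line; hence the centre is first moved inside, and the
  radius \<open>e\<close> is kept below its distance to both ends.\<close>

lemma periodic_bump:
  fixes \<beta> t \<epsilon> :: real
  assumes "\<beta> > 0" "t \<in> {0..\<beta>}" "\<epsilon> > 0"
  obtains \<eta> :: "real \<Rightarrow> real" where "continuous_on UNIV \<eta>" "\<And>\<tau>. \<eta> (\<tau> + \<beta>) = \<eta> \<tau>" "\<And>\<tau>. \<eta> \<tau> \<ge> 0"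
    "integral {0..\<beta>} \<eta> = 1" "\<And>\<tau>. \<tau> \<in> {0..\<beta>} \<Longrightarrow> \<eta> \<tau> \<noteq> 0 \<Longrightarrow> \<bar>\<tau> - t\<bar> < \<epsilon>"
proof -
  \<comment> \<open>With d the minimum of \<open>\<epsilon> / 4\<close> and
    \<open>\<beta> / 2\<close>, this clamps \<open>t\<close> to the interval from d to \<beta> - d,
    a shift of at most \<open>\<epsilon> / 4\<close>.\<close>
  define t' where "t' = max (min (\<epsilon> / 4) (\<beta> / 2)) (min t (\<beta> - min (\<epsilon> / 4) (\<beta> / 2)))"
  have t': "0 < t'" "t' < \<beta>" "\<bar>t' - t\<bar> < \<epsilon> / 2"
    using assms unfolding t'_def by (auto simp: max_def min_def)
  define e where "e = min (\<epsilon> / 2) (min t' (\<beta> - t'))"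
  have e: "e > 0" "e \<le> t'" "e \<le> \<beta> - t'" "e \<le> \<epsilon> / 2" "2 * e \<le> \<beta>"
    using t' assms unfolding e_def by (auto simp: min_def)
  define h where "h \<tau> = max 0 (cos (2 * pi * (\<tau> - t') / \<beta>) - cos (2 * pi * e / \<beta>))" for \<tau>
  have hc: "continuous_on S h" for S unfolding h_def by (intro continuous_intros) (use assms in auto)
  have hp: "h (\<tau> + \<beta>) = h \<tau>" for \<tau>
  proof -
    have "2 * pi * (\<tau> + \<beta> - t') / \<beta> = 2 * pi * (\<tau> - t') / \<beta> + 2 * pi"
      using assms by (simp add: field_simps)
    then show ?thesis unfolding h_def by (simp only: cos_periodic)
  qed
  have h0: "h \<tau> \<ge> 0" for \<tau> by (simp add: h_def)
  have eb: "2 * pi * e / \<beta> > 0" "2 * pi * e / \<beta> \<le> pi" using e assms by (simp_all add: field_simps)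
  have supp: "\<bar>\<tau> - t\<bar> < \<epsilon>" if \<tau>: "\<tau> \<in> {0..\<beta>}" "h \<tau> \<noteq> 0" for \<tau>
  proof (rule ccontr)
    assume "\<not> \<bar>\<tau> - t\<bar> < \<epsilon>"
    then have d: "e \<le> \<bar>\<tau> - t'\<bar>" using t' e by linarith
    define x where "x = 2 * pi * \<bar>\<tau> - t'\<bar> / \<beta>"
    have x: "2 * pi * e / \<beta> \<le> x" unfolding x_def using d assms
      by (intro divide_right_mono mult_left_mono) auto
    have "\<bar>\<tau> - t'\<bar> \<le> \<beta> - e" using \<tau> t' e by auto
    then have "x \<le> 2 * pi * (\<beta> - e) / \<beta>" unfolding x_def using assms
      by (intro divide_right_mono mult_left_mono) auto
    also have "\<dots> = 2 * pi - 2 * pi * e / \<beta>" using assms by (simp add: field_simps)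
    finally have x2: "2 * pi * e / \<beta> \<le> 2 * pi - x" by simp
    have "cos x \<le> cos (2 * pi * e / \<beta>)"
    proof (cases "x \<le> pi")
      case True
      then show ?thesis using x eb by (intro cos_monotone_0_pi_le) auto
    next
      case False
      then have "cos (2 * pi - x) \<le> cos (2 * pi * e / \<beta>)"
        using x2 eb by (intro cos_monotone_0_pi_le) auto
      then show ?thesis by simp
    qed
    moreover have "cos x = cos (2 * pi * (\<tau> - t') / \<beta>)"
    proof -
      have "x = \<bar>2 * pi * (\<tau> - t') / \<beta>\<bar>" unfolding x_def using assms by (simp add: abs_mult)
      then show ?thesis by (simp only: cos_abs_real)
    qed
    ultimately show False using \<tau>(2) by (simp add: h_def)
  qed
  have "cos (2 * pi * e / \<beta>) < cos 0" using eb by (intro cos_monotone_0_pi) auto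
  then have "h t' > 0" by (simp add: h_def)
  have "integral {0..\<beta>} h \<noteq> 0"
    using integral_eq_0_iff[of 0 \<beta> h] hc h0 assms \<open>h t' > 0\<close> t' by force
  moreover have "integral {0..\<beta>} h \<ge> 0" by (intro integral_nonneg integrable_continuous_real hc h0)
  ultimately have I: "integral {0..\<beta>} h > 0" by simp
  show ?thesis
  proof (rule that[of "\<lambda>\<tau>. h \<tau> / integral {0..\<beta>} h"])
    show "continuous_on UNIV (\<lambda>\<tau>. h \<tau> / integral {0..\<beta>} h)" using I by (intro continuous_intros hc) auto
    show "integral {0..\<beta>} (\<lambda>\<tau>. h \<tau> / integral {0..\<beta>} h) = 1" using I by simp
    show "\<And>\<tau>. 0 \<le> h \<tau> / integral {0..\<beta>} h" using I h0 by simp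
  qed (use hp supp I in auto)
qed

text \<open>The Cauchy-Schwarz inequality, obtained by integrating the square of
  \<open>u' t - k\<close> between the two points, with \<open>k\<close> the mean slope
  there.\<close>

lemma squared_increment_le_energy:
  fixes u u' :: "real \<Rightarrow> real"
  assumes u: "\<And>t. (u has_real_derivative u' t) (at t)" and c: "continuous_on UNIV u'"
    and xy: "x \<in> {0..\<beta>}" "y \<in> {0..\<beta>}"
  shows "(u x - u y)\<^sup>2 \<le> \<bar>x - y\<bar> * integral {0..\<beta>} (\<lambda>t. (u' t)\<^sup>2)"
proof -
  have main: "(u x - u y)\<^sup>2 \<le> (x - y) * integral {0..\<beta>} (\<lambda>t. (u' t)\<^sup>2)"
    if xy: "x \<in> {0..\<beta>}" "y \<in> {0..\<beta>}" "y < x" for x y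
  proof -
    define k where "k = (u x - u y) / (x - y)"
    have int: "(u' has_integral u x - u y) {y..x}"
      using xy u by (intro fundamental_theorem_of_calculus)
        (auto simp: has_real_derivative_iff_has_vector_derivative[symmetric] intro: has_field_derivative_at_within)
    have i2: "(\<lambda>t. (u' t)\<^sup>2) integrable_on S" if "S = {y..x} \<or> S = {0..\<beta>}" for S
      using that by (auto intro!: integrable_continuous_real continuous_intros continuous_on_subset[OF c])
    have "((\<lambda>t. (u' t)\<^sup>2 - 2 * k * u' t + k\<^sup>2) has_integral
        integral {y..x} (\<lambda>t. (u' t)\<^sup>2) - 2 * k * (u x - u y) + (x - y) * k\<^sup>2) {y..x}"
      using has_integral_const_real[of "k\<^sup>2" y x] xy
      by (intro has_integral_add has_integral_diff has_integral_mult_right int integrable_integral i2) auto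
    then have "0 \<le> integral {y..x} (\<lambda>t. (u' t)\<^sup>2) - 2 * k * (u x - u y) + (x - y) * k\<^sup>2"
    proof (rule has_integral_nonneg)
      fix t
      have "(u' t)\<^sup>2 - 2 * k * u' t + k\<^sup>2 = (u' t - k)\<^sup>2" by (simp add: power2_eq_square algebra_simps)
      then show "0 \<le> (u' t)\<^sup>2 - 2 * k * u' t + k\<^sup>2" by simp
    qed
    also have "- 2 * k * (u x - u y) + (x - y) * k\<^sup>2 = - (u x - u y)\<^sup>2 / (x - y)"
    proof -
      have "- 2 * (D / d) * D + d * (D / d)\<^sup>2 = - D\<^sup>2 / d" if "d \<noteq> 0" for D d :: real
        using that by (simp add: power2_eq_square field_simps)
      from this[of "x - y" "u x - u y"] show ?thesis using xy by (simp add: k_def)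
    qed
    then have "integral {y..x} (\<lambda>t. (u' t)\<^sup>2) - 2 * k * (u x - u y) + (x - y) * k\<^sup>2
        = integral {y..x} (\<lambda>t. (u' t)\<^sup>2) - (u x - u y)\<^sup>2 / (x - y)" by simp
    finally have "(u x - u y)\<^sup>2 \<le> (x - y) * integral {y..x} (\<lambda>t. (u' t)\<^sup>2)"
      using xy by (simp add: field_simps)
    also have "\<dots> \<le> (x - y) * integral {0..\<beta>} (\<lambda>t. (u' t)\<^sup>2)"
      using xy by (intro mult_left_mono integral_subset_le i2) auto
    finally show ?thesis .
  qed
  show ?thesis
  proof (cases x y rule: linorder_cases)
    case less then show ?thesis using main[of y x] xy by (simp add: power2_commute)
  next
    case greater then show ?thesis using main[of x y] xy by simp
  qed simp
qed

section \<open>Increments of the Gaussian loop measure\<close>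

abbreviation pairing :: "real \<Rightarrow> (real \<Rightarrow> real) \<Rightarrow> (real \<Rightarrow> real) \<Rightarrow> real" where
  "pairing \<beta> \<phi> \<psi> \<equiv> integral {0..\<beta>} (\<lambda>t. \<phi> t * \<psi> t)"

lemma L2_inner_continuous:
  assumes "continuous_on {0..\<beta>} \<phi>" "continuous_on {0..\<beta>} \<psi>"
  shows "L2_inner \<beta> \<phi> \<psi> = pairing \<beta> \<phi> \<psi>"
  unfolding L2_inner_def by (intro circle_integral_continuous continuous_intros assms)

lemma continuous_circle_L2:
  assumes "continuous_on UNIV \<phi>"
  shows "\<phi> \<in> circle_L2 \<beta>"
  unfolding circle_L2_def using assms
  by (auto intro!: circle_integral_continuous continuous_intros borel_measurable_continuous_onI
      intro: continuous_on_subset)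

text \<open>The energy inequality results from testing the equation against its solution: the
  derivative of \<open>u0 t * u' t\<close> integrates to 0 over a period, so there is no boundary
  term, and the contribution of \<open>a\<^sup>2\<close> is nonnegative and is dropped.\<close>

lemma A_op_solution:
  fixes \<phi> :: "real \<Rightarrow> real"
  assumes "m > 0" "a \<noteq> 0" "\<beta> > 0"
    and \<phi>: "continuous_on UNIV \<phi>" and per: "\<And>t. \<phi> (t + \<beta>) = \<phi> t"
  obtains u u' where "A_op \<beta> m a u \<phi>" "\<And>t. (apply_bcontfun u has_real_derivative u' t) (at t)"
    "continuous_on UNIV u'"
    "m * integral {0..\<beta>} (\<lambda>t. (u' t)\<^sup>2) \<le> pairing \<beta> \<phi> u"
proof -
  obtain u0 u' where u0: "\<And>t. (u0 has_real_derivative u' t) (at t)"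
    "\<And>t. u0 (t + \<beta>) = u0 t" and u'p: "\<And>t. u' (t + \<beta>) = u' t"
    and u'0: "\<And>t. (u' has_real_derivative (a\<^sup>2 * u0 t - \<phi> t) / m) (at t)"
    using periodic_elliptic_equation[of m a \<beta> \<phi>] assms by metis
  have u0c: "continuous_on S u0" for S
    using u0(1) by (meson DERIV_isCont continuous_at_imp_continuous_on)
  obtain u where u: "u \<in> loops \<beta>" "apply_bcontfun u = u0"
    by (rule periodic_is_loop[OF assms(3) u0c u0(2)])
  have u'c: "continuous_on S u'" for S
    using u'0 by (meson DERIV_isCont continuous_at_imp_continuous_on)
  have \<phi>c: "continuous_on S \<phi>" for S using \<phi> by (rule continuous_on_subset) auto
  define g where "g t = (a\<^sup>2 * u0 t - \<phi> t) / m" for t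
  have gc: "continuous_on S g" for S
    unfolding g_def using assms by (intro continuous_intros u0c \<phi>c) auto
  have "deriv u0 t = deriv u0 0 + (LINT s:{0..t}|lborel. g s)" if "t \<in> {0..\<beta>}" for t
  proof -
    have "(g has_integral u' t - u' 0) {0..t}"
      using that u'0 unfolding g_def by (intro fundamental_theorem_of_calculus)
        (auto simp: has_real_derivative_iff_has_vector_derivative[symmetric] intro: has_field_derivative_at_within)
    moreover have "(LINT s:{0..t}|lborel. g s) = integral {0..t} g"
      by (intro set_borel_integral_eq_integral(2) borel_integrable_atLeastAtMost' gc)
    moreover have "deriv u0 s = u' s" for s using u0(1) by (rule DERIV_imp_deriv)
    ultimately show ?thesis by (simp add: integral_unique)
  qed
  moreover have "u0 differentiable (at t)" for t
    using u0(1) real_differentiable_def by blast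
  moreover have "g \<in> circle_L2 \<beta>" by (rule continuous_circle_L2[OF gc])
  ultimately have "laplacian \<beta> u g"
    unfolding laplacian_def u(2) using u(1) by blast
  moreover have "\<phi> = (\<lambda>t. - m * g t + a\<^sup>2 * u t)"
    using assms by (auto simp: g_def u field_simps)
  ultimately have A: "A_op \<beta> m a u \<phi>" unfolding A_op_def by blast
  have "((\<lambda>t. u' t * u' t + u0 t * g t) has_integral u0 \<beta> * u' \<beta> - u0 0 * u' 0) {0..\<beta>}"
  proof (rule fundamental_theorem_of_calculus)
    fix t
    have "((\<lambda>t. u0 t * u' t) has_real_derivative u' t * u' t + u0 t * g t) (at t)"
      by (rule derivative_eq_intros u0 u'0 refl | simp add: g_def)+
    then show "((\<lambda>t. u0 t * u' t) has_vector_derivative u' t * u' t + u0 t * g t) (at t within {0..\<beta>})"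
      by (simp add: has_real_derivative_iff_has_vector_derivative[symmetric] has_field_derivative_at_within)
  qed (use assms in simp)
  then have "((\<lambda>t. u' t * u' t + u0 t * g t) has_integral 0) {0..\<beta>}"
    using u0(2)[of 0] u'p[of 0] by simp
  then have "((\<lambda>t. m * (u' t * u' t + u0 t * g t)) has_integral m * 0) {0..\<beta>}"
    by (rule has_integral_mult_right)
  moreover have "m * (u' t * u' t + u0 t * g t) = m * (u' t)\<^sup>2 + a\<^sup>2 * (u0 t)\<^sup>2 - \<phi> t * u0 t" for t
    using assms by (simp add: g_def field_simps power2_eq_square)
  ultimately have "integral {0..\<beta>} (\<lambda>t. m * (u' t)\<^sup>2 + a\<^sup>2 * (u0 t)\<^sup>2 - \<phi> t * u0 t) = 0"
    by (simp add: integral_unique)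
  also have "integral {0..\<beta>} (\<lambda>t. m * (u' t)\<^sup>2 + a\<^sup>2 * (u0 t)\<^sup>2 - \<phi> t * u0 t)
      = integral {0..\<beta>} (\<lambda>t. m * (u' t)\<^sup>2) + integral {0..\<beta>} (\<lambda>t. a\<^sup>2 * (u0 t)\<^sup>2)
        - pairing \<beta> \<phi> u0"
    by (subst integral_diff integral_add,
        (intro integrable_continuous_real continuous_intros u0c \<phi>c u'c)+)+ simp
  finally have "m * integral {0..\<beta>} (\<lambda>t. (u' t)\<^sup>2) + integral {0..\<beta>} (\<lambda>t. a\<^sup>2 * (u0 t)\<^sup>2)
      = pairing \<beta> \<phi> u" by (simp add: u)
  moreover have "integral {0..\<beta>} (\<lambda>t. a\<^sup>2 * (u0 t)\<^sup>2) \<ge> 0"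
    by (intro integral_nonneg integrable_continuous_real continuous_intros u0c) auto
  ultimately show ?thesis using A u0(1) u'c by (intro that[of u u']) (auto simp: u)
qed

section \<open>Moments of centered Gaussian laws on the line\<close>

abbreviation std_normal :: "real measure" where
  "std_normal \<equiv> density lborel (\<lambda>x. ennreal (std_normal_density x))"

text \<open>Writes every centered Gaussian law, the point mass at 0 included as
  \<open>\<sigma> = 0\<close>, as a scaling of one standard normal variable. Comparing two standard
  deviations thus becomes a pointwise comparison of integrands.\<close>

lemma centered_gaussianE:
  assumes "centered_gaussian M"
  obtains \<sigma> where "\<sigma> \<ge> 0" "M = distr std_normal borel (\<lambda>z. \<sigma> * z)"
proof -
  interpret prob_space std_normal by (rule prob_space_normal_density) simp
  from assms consider "M = return borel 0"
    | \<sigma> where "\<sigma> > 0" "M = density lborel (\<lambda>x. ennreal (normal_density 0 \<sigma> x))"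
    unfolding centered_gaussian_def by blast
  then show ?thesis
  proof cases
    case 1
    have "distr std_normal borel (\<lambda>z. 0 * z) = return borel (0::real)"
      using distr_const[of "0::real" borel] by simp
    then show ?thesis using 1 by (intro that[of 0]) auto
  next
    case 2
    have "distributed std_normal lborel (\<lambda>x. x) std_normal_density"
      unfolding distributed_def by (auto simp: distr_id2)
    from normal_density_affine[OF this, of \<sigma> 0] 2
    have "distr std_normal lborel (\<lambda>z. \<sigma> * z) = density lborel (normal_density 0 \<sigma>)"
      by (simp add: distributed_def)
    moreover have "distr std_normal lborel (\<lambda>z. \<sigma> * z) = distr std_normal borel (\<lambda>z. \<sigma> * z)"
      by (rule distr_cong) auto
    ultimately show ?thesis using 2 by (intro that[of \<sigma>]) auto
  qed
qed

lemma std_normal_second_moment: "(\<integral>\<^sup>+z. ennreal (z\<^sup>2) \<partial>std_normal) = 1"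
proof -
  have "(\<integral>\<^sup>+z. ennreal (z\<^sup>2) \<partial>std_normal) = (\<integral>\<^sup>+z. ennreal (std_normal_density z * z\<^sup>2) \<partial>lborel)"
    by (simp add: nn_integral_density ennreal_mult)
  also have "\<dots> = 1"
    using std_normal_moment_even[of 1]
    by (subst nn_integral_eq_integral) (auto simp: has_bochner_integral_iff)
  finally show ?thesis .
qed

lemma std_normal_exp: "(\<integral>\<^sup>+z. ennreal (exp (c * z)) \<partial>std_normal) = ennreal (exp (c\<^sup>2 / 2))"
proof -
  have eq: "std_normal_density z * exp (c * z) = exp (c\<^sup>2 / 2) * normal_density c 1 z" for z
  proof -
    have "exp (- z\<^sup>2 / 2) * exp (c * z) = exp (c\<^sup>2 / 2) * exp (- (z - c)\<^sup>2 / 2)"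
      unfolding exp_add[symmetric] by (simp add: power2_eq_square field_simps)
    then show ?thesis by (simp add: normal_density_def)
  qed
  interpret prob_space "density lborel (\<lambda>z. ennreal (normal_density c 1 z))"
    by (rule prob_space_normal_density) simp
  have "(\<integral>\<^sup>+z. ennreal (exp (c * z)) \<partial>std_normal)
      = (\<integral>\<^sup>+z. ennreal (std_normal_density z * exp (c * z)) \<partial>lborel)"
    by (simp add: nn_integral_density ennreal_mult)
  also have "\<dots> = ennreal (exp (c\<^sup>2 / 2)) * (\<integral>\<^sup>+z. ennreal (normal_density c 1 z) \<partial>lborel)"
    unfolding eq by (simp add: ennreal_mult nn_integral_cmult)
  also have "(\<integral>\<^sup>+z. ennreal (normal_density c 1 z) \<partial>lborel) = 1"
    using emeasure_space_1 by (simp add: emeasure_density)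
  finally show ?thesis by simp
qed

lemma power_le_fact_exp:
  fixes x :: real
  assumes "x \<ge> 0"
  shows "x ^ n \<le> fact n * exp x"
proof -
  have "(\<Sum>i\<in>{n}. inverse (fact i) *\<^sub>R x ^ i) \<le> (\<Sum>i. inverse (fact i) *\<^sub>R x ^ i)"
    by (intro sum_le_suminf summable_exp_generic) (use assms in auto)
  then show ?thesis by (simp add: exp_def field_simps)
qed

definition normal_abs_moment :: "nat \<Rightarrow> real \<Rightarrow> ennreal" where
  "normal_abs_moment N c = (\<integral>\<^sup>+z. ennreal (\<bar>z\<bar> ^ N * exp (c * \<bar>z\<bar>)) \<partial>std_normal)"

lemma normal_abs_moment_finite: "normal_abs_moment N c < \<infinity>"
proof -
  have "normal_abs_moment N c \<le> (\<integral>\<^sup>+z. ennreal (fact N) * (ennreal (exp ((c + 1) * z)) + ennreal (exp ((- (c + 1)) * z))) \<partial>std_normal)"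
    unfolding normal_abs_moment_def
  proof (rule nn_integral_mono)
    fix z :: real
    have "\<bar>z\<bar> ^ N * exp (c * \<bar>z\<bar>) \<le> (fact N * exp \<bar>z\<bar>) * exp (c * \<bar>z\<bar>)"
      by (intro mult_right_mono power_le_fact_exp) auto
    also have "\<dots> = fact N * exp ((c + 1) * \<bar>z\<bar>)" by (simp add: exp_add[symmetric] algebra_simps)
    also have "\<dots> \<le> fact N * (exp ((c + 1) * z) + exp ((- (c + 1)) * z))"
    proof (rule mult_left_mono)
      have "\<bar>z\<bar> = z \<or> \<bar>z\<bar> = - z" by linarith
      then have "exp ((c + 1) * \<bar>z\<bar>) = exp ((c + 1) * z) \<or> exp ((c + 1) * \<bar>z\<bar>) = exp ((- (c + 1)) * z)"
        by (metis minus_mult_commute)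
      then show "exp ((c + 1) * \<bar>z\<bar>) \<le> exp ((c + 1) * z) + exp ((- (c + 1)) * z)"
        using exp_ge_zero[of "(c + 1) * z"] exp_ge_zero[of "(- (c + 1)) * z"] by linarith
    qed simp
    finally show "ennreal (\<bar>z\<bar> ^ N * exp (c * \<bar>z\<bar>))
        \<le> ennreal (fact N) * (ennreal (exp ((c + 1) * z)) + ennreal (exp ((- (c + 1)) * z)))"
      by (simp add: ennreal_mult[symmetric] ennreal_plus[symmetric] ennreal_leI del: ennreal_plus)
  qed
  also have "\<dots> = ennreal (fact N) * (ennreal (exp ((c + 1)\<^sup>2 / 2)) + ennreal (exp ((- (c + 1))\<^sup>2 / 2)))"
    by (subst nn_integral_cmult, measurable, subst nn_integral_add, measurable) (simp only: std_normal_exp)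
  also have "\<dots> < \<infinity>" by (simp add: ennreal_mult_less_top)
  finally show ?thesis .
qed

lemma scaled_normal_second_moment:
  "(\<integral>\<^sup>+x. ennreal (x\<^sup>2) \<partial>distr std_normal borel (\<lambda>z. \<sigma> * z)) = ennreal (\<sigma>\<^sup>2)"
proof -
  have "(\<integral>\<^sup>+x. ennreal (x\<^sup>2) \<partial>distr std_normal borel (\<lambda>z. \<sigma> * z)) = (\<integral>\<^sup>+z. ennreal (\<sigma>\<^sup>2) * ennreal (z\<^sup>2) \<partial>std_normal)"
    by (simp add: nn_integral_distr power_mult_distrib ennreal_mult)
  also have "\<dots> = ennreal (\<sigma>\<^sup>2)" by (simp add: nn_integral_cmult std_normal_second_moment)
  finally show ?thesis .
qed

text \<open>In terms of the standard normal variable the integrand increases with the standard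
  deviation, so an upper bound \<open>v\<close> for the latter suffices. The power of
  \<open>b * v\<close> is kept outside the Gaussian integral because it will carry the decay in the
  dyadic level, with \<open>b\<close> as the rescaling.\<close>

lemma centered_gaussian_abs_moment:
  assumes "centered_gaussian M" and v: "(\<integral>\<^sup>+x. ennreal (x\<^sup>2) \<partial>M) \<le> ennreal (v\<^sup>2)"
    and "v \<ge> 0" "b \<ge> 0" "c \<ge> 0"
  shows "(\<integral>\<^sup>+x. ennreal ((b * \<bar>x\<bar>) ^ N * exp (c * (b * \<bar>x\<bar>))) \<partial>M)
    \<le> ennreal ((b * v) ^ N) * normal_abs_moment N (c * (b * v))"
proof -
  obtain \<sigma> where \<sigma>: "\<sigma> \<ge> 0" "M = distr std_normal borel (\<lambda>z. \<sigma> * z)"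
    using assms(1) by (rule centered_gaussianE)
  have "\<sigma>\<^sup>2 \<le> v\<^sup>2" using v by (simp add: \<sigma>(2) scaled_normal_second_moment)
  then have sv: "\<sigma> \<le> v" using \<open>v \<ge> 0\<close> by (rule power2_le_imp_le)
  have "(\<integral>\<^sup>+x. ennreal ((b * \<bar>x\<bar>) ^ N * exp (c * (b * \<bar>x\<bar>))) \<partial>M)
      = (\<integral>\<^sup>+z. ennreal ((b * \<bar>\<sigma> * z\<bar>) ^ N * exp (c * (b * \<bar>\<sigma> * z\<bar>))) \<partial>std_normal)"
    unfolding \<sigma>(2) by (subst nn_integral_distr) auto
  also have "\<dots> \<le> (\<integral>\<^sup>+z. ennreal ((b * v) ^ N) * ennreal (\<bar>z\<bar> ^ N * exp (c * (b * v) * \<bar>z\<bar>)) \<partial>std_normal)"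
  proof (rule nn_integral_mono)
    fix z :: real
    have "b * \<bar>\<sigma> * z\<bar> \<le> (b * v) * \<bar>z\<bar>"
      using \<sigma> sv assms by (simp add: abs_mult mult_left_mono mult_right_mono mult.assoc)
    then have "(b * \<bar>\<sigma> * z\<bar>) ^ N \<le> ((b * v) * \<bar>z\<bar>) ^ N"
      and "exp (c * (b * \<bar>\<sigma> * z\<bar>)) \<le> exp (c * ((b * v) * \<bar>z\<bar>))"
      using assms by (auto intro!: power_mono simp: mult_left_mono simp del: abs_mult)
    then have "(b * \<bar>\<sigma> * z\<bar>) ^ N * exp (c * (b * \<bar>\<sigma> * z\<bar>)) \<le> ((b * v) * \<bar>z\<bar>) ^ N * exp (c * ((b * v) * \<bar>z\<bar>))"
      by (rule mult_mono) (use assms in auto)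
    then show "ennreal ((b * \<bar>\<sigma> * z\<bar>) ^ N * exp (c * (b * \<bar>\<sigma> * z\<bar>)))
        \<le> ennreal ((b * v) ^ N) * ennreal (\<bar>z\<bar> ^ N * exp (c * (b * v) * \<bar>z\<bar>))"
      using assms by (simp add: ennreal_mult[symmetric] power_mult_distrib mult_ac)
  qed
  also have "\<dots> = ennreal ((b * v) ^ N) * normal_abs_moment N (c * (b * v))"
    unfolding normal_abs_moment_def by (rule nn_integral_cmult) auto
  finally show ?thesis .
qed

lemma centered_gaussian_integrable_square:
  assumes "centered_gaussian M"
  shows "integrable M (\<lambda>x. x\<^sup>2)"
proof -
  obtain \<sigma> where \<sigma>: "\<sigma> \<ge> 0" "M = distr std_normal borel (\<lambda>z. \<sigma> * z)"
    using assms(1) by (rule centered_gaussianE)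
  show ?thesis unfolding \<sigma>(2) by (rule integrableI_nonneg) (simp_all add: scaled_normal_second_moment)
qed

lemma bounded_linear_eval: "bounded_linear (\<lambda>u::loop. apply_bcontfun u t)"
  by (rule bounded_linear_intro[where K = 1]) (auto simp: plus_bcontfun.rep_eq loop_bound)

section \<open>The variance of increments, from pairings with bumps to point values\<close>

definition is_bump :: "real \<Rightarrow> real \<Rightarrow> real \<Rightarrow> (real \<Rightarrow> real) \<Rightarrow> bool" where
  "is_bump \<beta> t \<epsilon> \<eta> \<longleftrightarrow> continuous_on UNIV \<eta> \<and> (\<forall>\<tau>. \<eta> (\<tau> + \<beta>) = \<eta> \<tau>) \<and> (\<forall>\<tau>. \<eta> \<tau> \<ge> 0) \<and>
     integral {0..\<beta>} \<eta> = 1 \<and> (\<forall>\<tau>\<in>{0..\<beta>}. \<eta> \<tau> \<noteq> 0 \<longrightarrow> \<bar>\<tau> - t\<bar> < \<epsilon>)"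

lemma is_bumpD:
  assumes "is_bump \<beta> t \<epsilon> \<eta>"
  shows "continuous_on UNIV \<eta>" "\<And>\<tau>. \<eta> (\<tau> + \<beta>) = \<eta> \<tau>" "\<And>\<tau>. \<eta> \<tau> \<ge> 0" "integral {0..\<beta>} \<eta> = 1"
    "\<And>\<tau>. \<tau> \<in> {0..\<beta>} \<Longrightarrow> \<eta> \<tau> \<noteq> 0 \<Longrightarrow> \<bar>\<tau> - t\<bar> < \<epsilon>"
  using assms unfolding is_bump_def by blast+

context
  fixes \<beta> m a :: real and \<gamma> :: "loop measure"
  assumes \<beta>: "\<beta> > 0" and m: "m > 0" and a: "a \<noteq> 0"
    and \<gamma>: "gaussian_loop_measure \<beta> m a \<gamma>"
begin

lemma space_gaussian: "space \<gamma> = loops \<beta>"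
proof -
  have "sets \<gamma> = sets (restrict_space borel (loops \<beta>))" using \<gamma> by (simp add: gaussian_loop_measure_def)
  then have "space \<gamma> = space (restrict_space borel (loops \<beta>))" by (rule sets_eq_imp_space_eq)
  then show ?thesis by (simp add: space_restrict_space)
qed

lemma gaussian_measurable:
  "f \<in> borel_measurable borel \<Longrightarrow> f \<in> measurable \<gamma> borel"
  using \<gamma> measurable_cong_sets[of \<gamma> "restrict_space borel (loops \<beta>)" borel borel]
  by (auto simp: gaussian_loop_measure_def intro: measurable_restrict_space1)

lemma eval_measurable_gaussian: "(\<lambda>u. apply_bcontfun u t) \<in> borel_measurable \<gamma>"
  by (intro gaussian_measurable borel_measurable_continuous_onI linear_continuous_on bounded_linear_eval)

lemma bounded_linear_pairing:
  assumes "continuous_on UNIV \<phi>"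
  shows "bounded_linear (\<lambda>u::loop. pairing \<beta> \<phi> u)"
proof (rule bounded_linear_intro[where K = "integral {0..\<beta>} (\<lambda>t. \<bar>\<phi> t\<bar>)"])
  have c: "continuous_on S \<phi>" for S using assms by (rule continuous_on_subset) auto
  fix u u' :: loop and r :: real
  show "integral {0..\<beta>} (\<lambda>t. \<phi> t * (u + u') t)
      = pairing \<beta> \<phi> u + pairing \<beta> \<phi> u'"
    unfolding plus_bcontfun.rep_eq distrib_left
    by (intro integral_add integrable_continuous_real continuous_intros c loop_continuous)
  show "integral {0..\<beta>} (\<lambda>t. \<phi> t * (r *\<^sub>R u) t) = r *\<^sub>R pairing \<beta> \<phi> u"
    by (simp add: mult.left_commute)
  have "norm (pairing \<beta> \<phi> u) \<le> integral {0..\<beta>} (\<lambda>t. \<bar>\<phi> t\<bar> * norm u)"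
    by (intro integral_norm_bound_integral integrable_continuous_real continuous_intros c loop_continuous)
      (auto simp: abs_mult intro!: mult_left_mono loop_bound)
  then show "norm (pairing \<beta> \<phi> u) \<le> norm u * integral {0..\<beta>} (\<lambda>t. \<bar>\<phi> t\<bar>)"
    by (simp add: mult.commute)
qed

text \<open>The covariance clause is about a Bochner integral, whose value is 0 by default for
  functions that are not integrable. Square integrability of Gaussian laws turns it into a genuine
  second moment.\<close>

lemma gaussian_pairing_variance:
  assumes \<phi>: "continuous_on UNIV \<phi>" and A: "A_op \<beta> m a u \<phi>"
  shows "(\<integral>\<^sup>+\<upsilon>. ennreal ((pairing \<beta> \<phi> \<upsilon>)\<^sup>2) \<partial>\<gamma>)
    = ennreal (pairing \<beta> \<phi> u)"
proof -
  define f where "f = (\<lambda>\<upsilon>::loop. pairing \<beta> \<phi> \<upsilon>)"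
  have lin: "bounded_linear f" unfolding f_def by (rule bounded_linear_pairing[OF \<phi>])
  have f: "f \<in> borel_measurable \<gamma>"
    by (intro gaussian_measurable borel_measurable_continuous_onI linear_continuous_on lin)
  have "centered_gaussian (distr \<gamma> borel f)" using \<gamma> lin by (simp add: gaussian_loop_measure_def)
  then have "integrable \<gamma> (\<lambda>\<upsilon>. (f \<upsilon>)\<^sup>2)"
    using centered_gaussian_integrable_square integrable_distr_eq[OF f, of "\<lambda>x. x\<^sup>2"] by fastforce
  then have "(\<integral>\<^sup>+\<upsilon>. ennreal ((f \<upsilon>)\<^sup>2) \<partial>\<gamma>) = ennreal (\<integral>\<upsilon>. (f \<upsilon>)\<^sup>2 \<partial>\<gamma>)"
    by (intro nn_integral_eq_integral) auto
  moreover have "(\<integral>\<upsilon>. (f \<upsilon>)\<^sup>2 \<partial>\<gamma>) = pairing \<beta> \<phi> u"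
  proof -
    have eq: "L2_inner \<beta> \<phi> (apply_bcontfun \<upsilon>) = f \<upsilon>" for \<upsilon>
      unfolding f_def by (intro L2_inner_continuous loop_continuous continuous_on_subset[OF \<phi>]) auto
    have "(\<integral>\<upsilon>. L2_inner \<beta> \<phi> (apply_bcontfun \<upsilon>) * L2_inner \<beta> \<phi> (apply_bcontfun \<upsilon>) \<partial>\<gamma>)
        = L2_inner \<beta> \<phi> (apply_bcontfun u)"
      using \<gamma> A continuous_circle_L2[OF \<phi>] unfolding gaussian_loop_measure_def by blast
    then show ?thesis unfolding eq by (simp add: f_def power2_eq_square)
  qed
  ultimately show ?thesis by (simp add: f_def)
qed

text \<open>The variance \<open>E\<close> is bounded through itself. Points of the two supports are
  at most \<open>\<bar>t - s\<bar> + 2 * \<epsilon>\<close> apart, which bounds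
  \<open>E\<^sup>2\<close> by that length times the energy \<open>D\<close>, whereas
  \<open>m * D\<close> is at most \<open>E\<close>. Eliminating \<open>D\<close> and cancelling one
  factor \<open>E\<close> gives the claim.\<close>

lemma bump_difference_variance:
  assumes st: "s \<in> {0..\<beta>}" "t \<in> {0..\<beta>}" and "\<epsilon> > 0"
    and "is_bump \<beta> t \<epsilon> \<eta>" and "is_bump \<beta> s \<epsilon> \<zeta>"
  shows "(\<integral>\<^sup>+\<upsilon>. ennreal ((pairing \<beta> (\<lambda>\<tau>. \<eta> \<tau> - \<zeta> \<tau>) \<upsilon>)\<^sup>2) \<partial>\<gamma>)
    \<le> ennreal ((\<bar>t - s\<bar> + 2 * \<epsilon>) / m)"
proof -
  note \<eta> = is_bumpD[OF assms(4)] and \<zeta> = is_bumpD[OF assms(5)]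
  have \<phi>: "continuous_on UNIV (\<lambda>\<tau>. \<eta> \<tau> - \<zeta> \<tau>)" by (intro continuous_intros \<eta> \<zeta>)
  obtain u u' where A: "A_op \<beta> m a u (\<lambda>\<tau>. \<eta> \<tau> - \<zeta> \<tau>)"
    and u: "\<And>\<tau>. (apply_bcontfun u has_real_derivative u' \<tau>) (at \<tau>)" "continuous_on UNIV u'"
    and en: "m * integral {0..\<beta>} (\<lambda>\<tau>. (u' \<tau>)\<^sup>2) \<le> pairing \<beta> (\<lambda>\<tau>. \<eta> \<tau> - \<zeta> \<tau>) u"
    by (rule A_op_solution[OF m a \<beta> \<phi>]) (use \<eta> \<zeta> in auto)
  define E where "E = pairing \<beta> (\<lambda>\<tau>. \<eta> \<tau> - \<zeta> \<tau>) u"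
  define D where "D = integral {0..\<beta>} (\<lambda>\<tau>. (u' \<tau>)\<^sup>2)"
  have D0: "D \<ge> 0" unfolding D_def
    by (intro integral_nonneg integrable_continuous_real continuous_intros continuous_on_subset[OF u(2)]) auto
  have mD: "m * D \<le> E" using en by (simp add: E_def D_def)
  define B where "B = sqrt ((\<bar>t - s\<bar> + 2 * \<epsilon>) * D)"
  have \<eta>c: "continuous_on S \<eta>" and \<zeta>c: "continuous_on S \<zeta>" for S
    using \<eta>(1) \<zeta>(1) by (auto intro: continuous_on_subset)
  have uB: "u x - u y \<le> B" if "x \<in> {0..\<beta>}" "y \<in> {0..\<beta>}" "\<eta> x \<noteq> 0" "\<zeta> y \<noteq> 0" for x y
  proof -
    have "\<bar>x - y\<bar> \<le> \<bar>t - s\<bar> + 2 * \<epsilon>" using \<eta>(5)[of x] \<zeta>(5)[of y] that by linarith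
    then have "(u x - u y)\<^sup>2 \<le> (\<bar>t - s\<bar> + 2 * \<epsilon>) * D"
      using squared_increment_le_energy[OF u that(1,2)] D0 unfolding D_def[symmetric]
      by (meson mult_right_mono order_trans)
    then show ?thesis unfolding B_def by (rule real_le_rsqrt)
  qed
  \<comment> \<open>The two-point bound \<open>uB\<close> is averaged twice: for fixed
    \<open>y\<close> against \<eta> in the first point, then against \<zeta> in
    \<open>y\<close>.\<close>
  have "integral {0..\<beta>} (\<lambda>\<tau>. \<zeta> \<tau> * (- u \<tau>)) \<le> B - pairing \<beta> \<eta> u"
  proof (rule integral_weighted_le)
    fix y assume y: "y \<in> {0..\<beta>}" "\<zeta> y \<noteq> 0"
    have "pairing \<beta> \<eta> u \<le> u y + B"
      by (rule integral_weighted_le) (use \<eta> uB y in \<open>auto intro!: \<eta>c loop_continuous simp: algebra_simps\<close>)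
    then show "- u y \<le> B - pairing \<beta> \<eta> u" by simp
  qed (use \<zeta> in \<open>auto intro!: \<zeta>c continuous_intros loop_continuous\<close>)
  moreover have "E = pairing \<beta> \<eta> u - pairing \<beta> \<zeta> u"
    unfolding E_def left_diff_distrib
    by (intro integral_diff integrable_continuous_real continuous_intros \<eta>c \<zeta>c loop_continuous)
  ultimately have "E \<le> B" by simp
  moreover have "E \<ge> 0" using mD D0 m by (meson mult_nonneg_nonneg less_imp_le order_trans)
  ultimately have "E\<^sup>2 \<le> B\<^sup>2" by (intro power_mono)
  also have "B\<^sup>2 = (\<bar>t - s\<bar> + 2 * \<epsilon>) * D" unfolding B_def using D0 \<open>\<epsilon> > 0\<close> by simp
  also have "\<dots> \<le> (\<bar>t - s\<bar> + 2 * \<epsilon>) * (E / m)"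
    using mD m \<open>\<epsilon> > 0\<close> by (intro mult_left_mono) (auto simp: field_simps)
  finally have "E * E \<le> ((\<bar>t - s\<bar> + 2 * \<epsilon>) / m) * E" by (simp add: power2_eq_square)
  moreover have "0 \<le> (\<bar>t - s\<bar> + 2 * \<epsilon>) / m" using \<open>\<epsilon> > 0\<close> m by simp
  ultimately have "E \<le> (\<bar>t - s\<bar> + 2 * \<epsilon>) / m"
    using mult_strict_right_mono[of "(\<bar>t - s\<bar> + 2 * \<epsilon>) / m" E E] by (meson not_le order_le_less_trans)
  then show ?thesis
    unfolding gaussian_pairing_variance[OF \<phi> A] E_def[symmetric] by (rule ennreal_leI)
qed

lemma bump_pairing_tendsto:
  fixes u :: loop and \<eta> :: "nat \<Rightarrow> real \<Rightarrow> real"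
  assumes bump: "\<And>n. is_bump \<beta> t (1 / real (Suc n)) (\<eta> n)"
  shows "(\<lambda>n. pairing \<beta> (\<eta> n) u) \<longlonglongrightarrow> u t"
proof (rule LIMSEQ_I)
  note \<eta> = is_bumpD[OF bump]
  fix r :: real assume "r > 0"
  have "isCont (apply_bcontfun u) t"
    using loop_continuous[of UNIV u] by (auto simp: continuous_on_eq_continuous_at simp del: continuous_on_apply_bcontfun)
  then obtain d where d: "d > 0" "\<And>x. \<bar>x - t\<bar> < d \<Longrightarrow> \<bar>u x - u t\<bar> < r / 2"
    using \<open>r > 0\<close> unfolding continuous_at_eps_delta dist_real_def
    by (metis half_gt_zero)
  obtain n0 where n0: "1 / real (Suc n0) < d" using d(1) nat_approx_posE by blast
  show "\<exists>no. \<forall>n\<ge>no. norm (pairing \<beta> (\<eta> n) u - u t) < r"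
  proof (intro exI allI impI)
    fix n assume "n \<ge> n0"
    then have "1 / real (Suc n) \<le> 1 / real (Suc n0)" by (simp add: field_simps)
    then have near: "\<bar>u \<tau> - u t\<bar> < r / 2" if "\<tau> \<in> {0..\<beta>}" "\<eta> n \<tau> \<noteq> 0" for \<tau>
      using d(2) n0 \<eta>(5)[OF that] by simp
    have le: "u \<tau> \<le> u t + r / 2" "- u \<tau> \<le> - u t + r / 2" if "\<tau> \<in> {0..\<beta>}" "\<eta> n \<tau> \<noteq> 0" for \<tau>
      using near[OF that] by linarith+
    have "pairing \<beta> (\<eta> n) u \<le> u t + r / 2"
      by (intro integral_weighted_le continuous_on_subset[OF \<eta>(1)] subset_UNIV \<eta>(3,4) loop_continuous le(1))
    moreover have "integral {0..\<beta>} (\<lambda>\<tau>. \<eta> n \<tau> * (- u \<tau>)) \<le> - u t + r / 2"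
      by (intro integral_weighted_le continuous_on_subset[OF \<eta>(1)] subset_UNIV \<eta>(3,4) loop_continuous continuous_on_minus le(2))
    ultimately show "norm (pairing \<beta> (\<eta> n) u - u t) < r"
      using \<open>r > 0\<close> by (simp add: abs_less_iff)
  qed
qed

text \<open>Pairings with bumps of radius \<open>1 / real (Suc n)\<close> converge to the point
  values for each loop, and Fatou's lemma carries the variance bound to the limit.\<close>

lemma gaussian_increment_variance:
  assumes st: "s \<in> {0..\<beta>}" "t \<in> {0..\<beta>}"
  shows "(\<integral>\<^sup>+u. ennreal ((u t - u s)\<^sup>2) \<partial>\<gamma>) \<le> ennreal (\<bar>t - s\<bar> / m)"
proof -
  have ex: "\<exists>\<eta>. is_bump \<beta> t (1 / real (Suc n)) \<eta>" if "t \<in> {0..\<beta>}" for t n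
  proof -
    have "(1::real) / real (Suc n) > 0" by simp
    from periodic_bump[OF \<beta> that this] show ?thesis unfolding is_bump_def by metis
  qed
  obtain \<eta> where \<eta>: "\<And>n. is_bump \<beta> t (1 / real (Suc n)) (\<eta> n)" using ex[OF st(2)] by metis
  obtain \<zeta> where \<zeta>: "\<And>n. is_bump \<beta> s (1 / real (Suc n)) (\<zeta> n)" using ex[OF st(1)] by metis
  define F where "F n u = integral {0..\<beta>} (\<lambda>\<tau>. (\<eta> n \<tau> - \<zeta> n \<tau>) * apply_bcontfun u \<tau>)" for n u
  have cont: "continuous_on S (\<eta> n)" "continuous_on S (\<zeta> n)" for n S
    by (rule continuous_on_subset[OF is_bumpD(1)[OF \<eta>] subset_UNIV], rule continuous_on_subset[OF is_bumpD(1)[OF \<zeta>] subset_UNIV])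
  have Fm: "F n \<in> borel_measurable \<gamma>" for n
    unfolding F_def
    by (intro gaussian_measurable borel_measurable_continuous_onI linear_continuous_on
        bounded_linear_pairing continuous_intros cont)
  have lim: "(\<lambda>n. F n u) \<longlonglongrightarrow> u t - u s" for u
  proof -
    have "F n u = pairing \<beta> (\<eta> n) u - pairing \<beta> (\<zeta> n) u" for n
      unfolding F_def left_diff_distrib
      by (intro integral_diff integrable_continuous_real continuous_intros cont loop_continuous)
    moreover have "(\<lambda>n. pairing \<beta> (\<eta> n) u) \<longlonglongrightarrow> u t"
      by (rule bump_pairing_tendsto[OF \<eta>])
    moreover have "(\<lambda>n. pairing \<beta> (\<zeta> n) u) \<longlonglongrightarrow> u s"
      by (rule bump_pairing_tendsto[OF \<zeta>])
    ultimately show ?thesis by (simp add: tendsto_diff)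
  qed
  have bound: "(\<integral>\<^sup>+u. ennreal ((F n u)\<^sup>2) \<partial>\<gamma>) \<le> ennreal ((\<bar>t - s\<bar> + 2 * (1 / real (Suc n))) / m)" for n
    unfolding F_def by (rule bump_difference_variance[OF st _ \<eta> \<zeta>]) simp
  have "(\<integral>\<^sup>+u. ennreal ((u t - u s)\<^sup>2) \<partial>\<gamma>) = (\<integral>\<^sup>+u. liminf (\<lambda>n. ennreal ((F n u)\<^sup>2)) \<partial>\<gamma>)"
  proof (rule nn_integral_cong)
    fix u
    have "(\<lambda>n. ennreal ((F n u)\<^sup>2)) \<longlonglongrightarrow> ennreal ((u t - u s)\<^sup>2)"
      by (intro tendsto_ennrealI tendsto_power lim)
    then show "ennreal ((u t - u s)\<^sup>2) = liminf (\<lambda>n. ennreal ((F n u)\<^sup>2))"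
      by (intro lim_imp_Liminf[symmetric]) auto
  qed
  also have "\<dots> \<le> liminf (\<lambda>n. \<integral>\<^sup>+u. ennreal ((F n u)\<^sup>2) \<partial>\<gamma>)"
    by (rule nn_integral_liminf) (use Fm in measurable)
  also have "\<dots> \<le> liminf (\<lambda>n. ennreal ((\<bar>t - s\<bar> + 2 * (1 / real (Suc n))) / m))"
    by (intro Liminf_mono always_eventually allI bound)
  also have "\<dots> = ennreal (\<bar>t - s\<bar> / m)"
  proof (rule lim_imp_Liminf)
    have "(\<lambda>n. (\<bar>t - s\<bar> + 2 * (1 / real (Suc n))) / m) \<longlonglongrightarrow> (\<bar>t - s\<bar> + 2 * 0) / m"
      by (intro tendsto_intros LIMSEQ_Suc[OF lim_1_over_n]) (use m in auto)
    then show "(\<lambda>n. ennreal ((\<bar>t - s\<bar> + 2 * (1 / real (Suc n))) / m)) \<longlonglongrightarrow> ennreal (\<bar>t - s\<bar> / m)"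
      by (intro tendsto_ennrealI) simp
  qed simp
  finally show ?thesis .
qed

end

section \<open>Exponential integrability of the Hoelder norm\<close>

definition ennreal_exp :: "ennreal \<Rightarrow> ennreal" where
  "ennreal_exp x = (if x = \<infinity> then \<infinity> else ennreal (exp (enn2real x)))"

lemma ennreal_exp_ennreal: "x \<ge> 0 \<Longrightarrow> ennreal_exp (ennreal x) = ennreal (exp x)"
  by (simp add: ennreal_exp_def)

lemma ennreal_exp_mono: "x \<le> y \<Longrightarrow> ennreal_exp x \<le> ennreal_exp y"
  by (cases x; cases y) (auto simp: ennreal_exp_def top_unique)

lemma one_le_ennreal_exp: "1 \<le> ennreal_exp x"
  using ennreal_exp_mono[of 0 x] by (simp add: ennreal_exp_def)

lemma ennreal_exp_measurable [measurable]: "ennreal_exp \<in> borel_measurable borel"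
  unfolding ennreal_exp_def[abs_def] by measurable

definition dyadic_increment :: "real \<Rightarrow> nat \<Rightarrow> nat \<Rightarrow> loop \<Rightarrow> real" where
  "dyadic_increment \<beta> n j u = \<bar>u (\<beta> * ((real j + 1) / 2 ^ n)) - u (\<beta> * (real j / 2 ^ n))\<bar>"

abbreviation scaled_increment :: "real \<Rightarrow> real \<Rightarrow> nat \<Rightarrow> nat \<Rightarrow> loop \<Rightarrow> real" where
  "scaled_increment \<beta> \<alpha> n j u \<equiv> 2 powr (\<alpha> * real n) * dyadic_increment \<beta> n j u"

abbreviation increment_term :: "real \<Rightarrow> real \<Rightarrow> nat \<Rightarrow> real \<Rightarrow> nat \<Rightarrow> nat \<Rightarrow> loop \<Rightarrow> ennreal" where
  "increment_term \<beta> \<alpha> N c n j u \<equiv>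
     ennreal (scaled_increment \<beta> \<alpha> n j u ^ N * exp (c * scaled_increment \<beta> \<alpha> n j u))"

text \<open>The summand 1 accounts for the supremum norm beyond the value at 0. In the Hoelder
  quotient, \<open>\<beta> powr \<alpha>\<close> stems from rescaling the circle to the unit
  interval, and the factor 2 from pairs whose shorter arc crosses the base point.\<close>

definition holder_const :: "real \<Rightarrow> real \<Rightarrow> real" where
  "holder_const \<beta> \<alpha> = chaining_const \<alpha> * (1 + 2 / \<beta> powr \<alpha>)"

lemma holder_norm_le_dyadic:
  assumes \<beta>: "\<beta> > 0" and \<alpha>: "\<alpha> > 0" and u: "u \<in> loops \<beta>" and "Y \<ge> 0"
    and Y: "\<And>n j. j < 2 ^ n \<Longrightarrow> scaled_increment \<beta> \<alpha> n j u \<le> Y"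
  shows "holder_norm \<beta> \<alpha> u \<le> ennreal (\<bar>u 0\<bar> + holder_const \<beta> \<alpha> * Y)"
proof -
  define C where "C = chaining_const \<alpha>"
  have C: "C \<ge> 0" unfolding C_def by (rule chaining_const_nonneg[OF \<alpha>])
  have chain: "\<bar>u s - u t\<bar> \<le> C * Y * (\<bar>s - t\<bar> powr \<alpha> / \<beta> powr \<alpha>)"
    if st: "s \<in> {0..\<beta>}" "t \<in> {0..\<beta>}" for s t
  proof -
    have "\<bar>u (\<beta> * (s / \<beta>)) - u (\<beta> * (t / \<beta>))\<bar> \<le> chaining_const \<alpha> * Y * \<bar>s / \<beta> - t / \<beta>\<bar> powr \<alpha>"
    proof (rule dyadic_chaining[OF _ \<alpha>, of "\<lambda>x. u (\<beta> * x)"])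
      show "continuous_on {0..1} (\<lambda>x. apply_bcontfun u (\<beta> * x))"
        by (rule continuous_on_compose2[OF loop_continuous[of UNIV]]) (auto intro: continuous_intros)
      fix n j :: nat assume "j < 2 ^ n"
      have "2 powr (- \<alpha> * real n) * (scaled_increment \<beta> \<alpha> n j u) \<le> 2 powr (- \<alpha> * real n) * Y"
        by (rule mult_left_mono[OF Y[OF \<open>j < 2 ^ n\<close>]]) auto
      then show "\<bar>u (\<beta> * ((real j + 1) / 2 ^ n)) - u (\<beta> * (real j / 2 ^ n))\<bar> \<le> Y * 2 powr (- \<alpha> * real n)"
        by (simp add: dyadic_increment_def mult.assoc[symmetric] powr_add[symmetric] mult.commute)
    qed (use st \<beta> in auto)
    moreover have "\<bar>s / \<beta> - t / \<beta>\<bar> powr \<alpha> = \<bar>s - t\<bar> powr \<alpha> / \<beta> powr \<alpha>"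
      using \<beta> by (simp add: diff_divide_distrib[symmetric] powr_divide)
    ultimately show ?thesis using \<beta> by (simp add: C_def)
  qed
  have sup: "(SUP \<tau>\<in>circle \<beta>. ennreal \<bar>u \<tau>\<bar>) \<le> ennreal (\<bar>u 0\<bar> + C * Y)"
  proof (rule SUP_least)
    fix \<tau> assume "\<tau> \<in> circle \<beta>"
    then have \<tau>: "\<tau> \<in> {0..\<beta>}" by (auto simp: circle_def)
    have "\<bar>\<tau> - 0\<bar> powr \<alpha> / \<beta> powr \<alpha> \<le> 1"
      using \<tau> \<beta> \<alpha> by (simp add: powr_mono2)
    then have "C * Y * (\<bar>\<tau> - 0\<bar> powr \<alpha> / \<beta> powr \<alpha>) \<le> C * Y"
      using C \<open>Y \<ge> 0\<close> by (intro mult_left_le) auto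
    then show "ennreal \<bar>u \<tau>\<bar> \<le> ennreal (\<bar>u 0\<bar> + C * Y)"
      using chain[of \<tau> 0] \<tau> \<beta> by (intro ennreal_leI) auto
  qed
  have per: "u \<beta> = u 0"   proof -
    have "u (0 + \<beta>) = u 0" using u unfolding loops_def by blast
    then show ?thesis by simp
  qed
  have inc: "\<bar>u s - u t\<bar> \<le> 2 * (C * Y / \<beta> powr \<alpha>) * circle_dist \<beta> s t powr \<alpha>"
    if st: "s \<in> circle \<beta>" "t \<in> circle \<beta>" for s t
  proof -
    have main: "\<bar>u s - u t\<bar> \<le> 2 * (C * Y / \<beta> powr \<alpha>) * circle_dist \<beta> s t powr \<alpha>"
      if st: "s \<in> {0..<\<beta>}" "t \<in> {0..<\<beta>}" "s \<le> t" for s t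
    proof (cases "t - s \<le> \<beta> - (t - s)")
      case True
      then have "circle_dist \<beta> s t = t - s" using st by (simp add: circle_dist_def)
      moreover have "\<bar>u s - u t\<bar> \<le> C * Y / \<beta> powr \<alpha> * (t - s) powr \<alpha>"
        using chain[of s t] st by simp
      moreover have "C * Y / \<beta> powr \<alpha> * (t - s) powr \<alpha> \<ge> 0" using C \<open>Y \<ge> 0\<close> by simp
      ultimately show ?thesis by simp
    next
      case False
      \<comment> \<open>The shorter arc runs through 0, which is the same point as \<beta>. Chaining
        works on the interval only, so it is applied on the two sides of the base point, each piece
        being no longer than \<open>d\<close>.\<close>
      define d where "d = \<beta> - (t - s)"
      have d: "circle_dist \<beta> s t = d" "s \<le> d" "\<beta> - t \<le> d"
        using False st by (simp_all add: circle_dist_def d_def)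
      have k: "C * Y / \<beta> powr \<alpha> \<ge> 0" using C \<open>Y \<ge> 0\<close> by simp
      have "\<bar>u s - u 0\<bar> \<le> C * Y / \<beta> powr \<alpha> * s powr \<alpha>" using chain[of s 0] st \<beta> by simp
      also have "\<dots> \<le> C * Y / \<beta> powr \<alpha> * d powr \<alpha>"
        using d st \<alpha> by (intro mult_left_mono[OF _ k] powr_mono2) auto
      finally have 1: "\<bar>u s - u 0\<bar> \<le> C * Y / \<beta> powr \<alpha> * d powr \<alpha>" .
      have "\<bar>u \<beta> - u t\<bar> \<le> C * Y / \<beta> powr \<alpha> * (\<beta> - t) powr \<alpha>" using chain[of \<beta> t] st \<beta> by simp
      also have "\<dots> \<le> C * Y / \<beta> powr \<alpha> * d powr \<alpha>"
        using d st \<alpha> by (intro mult_left_mono[OF _ k] powr_mono2) auto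
      finally show ?thesis using 1 unfolding d(1) per by linarith
    qed
    show ?thesis
    proof (cases "s \<le> t")
      case True then show ?thesis using main st by (simp add: circle_def)
    next
      case False
      then show ?thesis using main[of t s] st by (simp add: circle_def circle_dist_def abs_minus_commute)
    qed
  qed
  have "(SUP (\<tau>, \<tau>')\<in>{(\<tau>, \<tau>'). \<tau> \<in> circle \<beta> \<and> \<tau>' \<in> circle \<beta> \<and> \<tau> \<noteq> \<tau>'}.
      ennreal (\<bar>u \<tau> - u \<tau>'\<bar> / circle_dist \<beta> \<tau> \<tau>' powr \<alpha>)) \<le> ennreal (2 * (C * Y / \<beta> powr \<alpha>))"
  proof (rule SUP_least, clarify)
    fix s t assume st: "s \<in> circle \<beta>" "t \<in> circle \<beta>" "s \<noteq> t"
    then have "circle_dist \<beta> s t > 0" by (auto simp: circle_dist_def circle_def)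
    then show "ennreal (\<bar>u s - u t\<bar> / circle_dist \<beta> s t powr \<alpha>) \<le> ennreal (2 * (C * Y / \<beta> powr \<alpha>))"
      using inc[OF st(1,2)] by (intro ennreal_leI) (simp add: pos_divide_le_eq)
  qed
  then have "holder_norm \<beta> \<alpha> u \<le> ennreal (\<bar>u 0\<bar> + C * Y) + ennreal (2 * (C * Y / \<beta> powr \<alpha>))"
    unfolding holder_norm_def using \<alpha> sup by (auto intro: add_mono)
  also have "\<dots> = ennreal (\<bar>u 0\<bar> + holder_const \<beta> \<alpha> * Y)"
    using C \<open>Y \<ge> 0\<close> by (subst ennreal_plus[symmetric])
      (auto simp: holder_const_def C_def[symmetric] algebra_simps)
  finally show ?thesis .
qed

lemma holder_const_nonneg: "\<alpha> > 0 \<Longrightarrow> 0 \<le> holder_const \<beta> \<alpha>"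
  unfolding holder_const_def by (intro mult_nonneg_nonneg chaining_const_nonneg add_nonneg_nonneg) auto

text \<open>
  There are \<open>2 ^ n\<close> increments at level \<open>n\<close>, with rescaled standard deviation of order
  \<open>2 powr (- (1 / 2 - \<alpha>) * n)\<close>; the \<open>N\<close>-th powers make the sum over all of them converge.
\<close>

definition dyadic_sum :: "real \<Rightarrow> real \<Rightarrow> nat \<Rightarrow> real \<Rightarrow> loop \<Rightarrow> ennreal" where
  "dyadic_sum \<beta> \<alpha> N c u = (\<Sum>n. \<Sum>j<2 ^ n.
     increment_term \<beta> \<alpha> N c n j u)"

text \<open>The exponential of a sum of two nonnegative terms is at most the sum of the exponentials
  of their doubles; this separates the value at 0 from the increments and is the origin of the 2 in
  \<open>c\<close>. For a scaled increment above 1 the factor \<open>y n j ^ N\<close> only helps,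
  and a smaller one contributes at most \<open>exp c\<close>; in both cases its exponential is
  controlled by the dyadic sum.\<close>

lemma exp_holder_norm_le:
  fixes N :: nat
  assumes \<beta>: "\<beta> > 0" and \<alpha>: "\<alpha> > 0" and u: "u \<in> loops \<beta>" and N: "N \<ge> 1"
  defines "c \<equiv> 2 * holder_const \<beta> \<alpha>"
  shows "ennreal_exp (holder_norm \<beta> \<alpha> u) \<le>
    ennreal (exp (2 * \<bar>u 0\<bar>)) + ennreal (exp c) * (ennreal (exp c) + dyadic_sum \<beta> \<alpha> N c u)"
proof (cases "dyadic_sum \<beta> \<alpha> N c u")
  case top
  then show ?thesis by (simp add: ennreal_mult_top)
next
  case (real S)
  define y where "y n j = scaled_increment \<beta> \<alpha> n j u" for n j
  have y0: "y n j \<ge> 0" for n j by (simp add: y_def dyadic_increment_def)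
  have c0: "c \<ge> 0" unfolding c_def using holder_const_nonneg[OF \<alpha>] by simp
  have yS: "y n j ^ N * exp (c * y n j) \<le> S" if "j < 2 ^ n" for n j
  proof -
    have "ennreal (y n j ^ N * exp (c * y n j)) \<le> (\<Sum>j<2 ^ n. ennreal (y n j ^ N * exp (c * y n j)))"
      using that by (intro member_le_sum) auto
    also have "\<dots> \<le> (\<Sum>n. \<Sum>j<2 ^ n. ennreal (y n j ^ N * exp (c * y n j)))"
      using sum_le_suminf[of "\<lambda>n. \<Sum>j<2 ^ n. ennreal (y n j ^ N * exp (c * y n j))" "{n}"] by simp
    also have "\<dots> = ennreal S" using real by (simp add: dyadic_sum_def y_def)
    finally show ?thesis using real by simp
  qed
  have bound: "exp (c * y n j) \<le> exp c + S" if "j < 2 ^ n" for n j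
  proof (cases "y n j \<le> 1")
    case True
    then have "exp (c * y n j) \<le> exp c" using c0 by (simp add: mult_left_le)
    then show ?thesis using real by linarith
  next
    case False
    then have "1 * exp (c * y n j) \<le> y n j ^ N * exp (c * y n j)" by (intro mult_right_mono) auto
    then show ?thesis using yS[OF that] exp_gt_zero[of c] by linarith
  qed
  define I where "I = {(n, j). j < (2::nat) ^ n}"
  have "bdd_above ((\<lambda>(n, j). y n j) ` I)"
  proof -
    have "y n j \<le> max 1 S" if "j < 2 ^ n" for n j
    proof (cases "y n j \<le> 1")
      case False
      then have "y n j ^ 1 \<le> y n j ^ N" using N by (intro power_increasing) auto
      moreover have "y n j ^ N * 1 \<le> y n j ^ N * exp (c * y n j)" using c0 y0 by (intro mult_left_mono) auto
      ultimately show ?thesis using yS[OF that] by simp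
    qed simp
    then show ?thesis unfolding I_def by (intro bdd_aboveI[of _ "max 1 S"]) auto
  qed
  moreover have "(0, 0) \<in> I" by (simp add: I_def)
  \<comment> \<open>A supremum over infinitely many increments need not be attained; an index within
    1 of it is enough and costs one more factor \<open>exp c\<close>.\<close>
  ultimately obtain Y where Y: "Y = Sup ((\<lambda>(n, j). y n j) ` I)" and le: "\<And>n j. j < 2 ^ n \<Longrightarrow> y n j \<le> Y"
    and "\<exists>(n, j)\<in>I. Y - 1 < y n j"
    using less_cSup_iff[of "(\<lambda>(n, j). y n j) ` I" "Sup ((\<lambda>(n, j). y n j) ` I) - 1"]
    by (force simp: I_def intro!: cSup_upper)
  then obtain n j where nj: "j < 2 ^ n" "Y - 1 < y n j" by (auto simp: I_def)
  have Y0: "Y \<ge> 0" using le[of 0 0] y0[of 0 0] by simp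
  define h where "h = holder_const \<beta> \<alpha>"
  have h0: "h \<ge> 0" unfolding h_def by (rule holder_const_nonneg[OF \<alpha>])
  have "holder_norm \<beta> \<alpha> u \<le> ennreal (\<bar>u 0\<bar> + h * Y)"
    unfolding h_def by (rule holder_norm_le_dyadic[OF \<beta> \<alpha> u Y0]) (use le in \<open>simp add: y_def\<close>)
  then have "ennreal_exp (holder_norm \<beta> \<alpha> u) \<le> ennreal (exp (\<bar>u 0\<bar> + h * Y))"
    using ennreal_exp_mono h0 Y0 by (metis ennreal_exp_ennreal add_nonneg_nonneg abs_ge_zero mult_nonneg_nonneg)
  also have "\<dots> \<le> ennreal (exp (2 * \<bar>u 0\<bar>) + exp c * (exp c + S))"
  proof (rule ennreal_leI)
    have "exp (\<bar>u 0\<bar> + h * Y) \<le> exp (2 * max \<bar>u 0\<bar> (h * Y))" by simp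
    also have "\<dots> \<le> exp (2 * \<bar>u 0\<bar>) + exp (2 * (h * Y))"
      unfolding max_def using exp_ge_zero[of "2 * \<bar>u 0\<bar>"] exp_ge_zero[of "2 * (h * Y)"] by (simp add: add_increasing add_increasing2)
    also have "exp (2 * (h * Y)) \<le> exp c * exp (c * y n j)"
    proof -
      have "c * Y \<le> c * (1 + y n j)" using nj c0 by (intro mult_left_mono) auto
      then show ?thesis by (simp add: exp_add[symmetric] c_def h_def algebra_simps)
    qed
    also have "\<dots> \<le> exp c * (exp c + S)" by (intro mult_left_mono bound nj) auto
    finally show "exp (\<bar>u 0\<bar> + h * Y) \<le> exp (2 * \<bar>u 0\<bar>) + exp c * (exp c + S)" by simp
  qed
  also have "ennreal (exp (2 * \<bar>u 0\<bar>) + exp c * (exp c + S))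
      = ennreal (exp (2 * \<bar>u 0\<bar>)) + ennreal (exp c) * (ennreal (exp c) + dyadic_sum \<beta> \<alpha> N c u)"
    using real by (simp add: ennreal_mult[symmetric] ennreal_plus[symmetric] del: ennreal_plus)
  finally show ?thesis .
qed

lemma holder_norm_zero_le: "holder_norm \<beta> 0 u \<le> holder_norm \<beta> \<alpha> u"
  by (simp add: holder_norm_def)

section \<open>Integration of the dyadic sum against the Gaussian loop measure\<close>

context
  fixes \<beta> m a :: real and \<gamma> :: "loop measure"
  assumes \<beta>: "\<beta> > 0" and m: "m > 0" and a: "a \<noteq> 0"
    and \<gamma>: "gaussian_loop_measure \<beta> m a \<gamma>"
begin

lemma dyadic_increment_measurable [measurable]: "dyadic_increment \<beta> n j \<in> borel_measurable \<gamma>"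
  unfolding dyadic_increment_def[abs_def]
  by (intro borel_measurable_abs borel_measurable_diff eval_measurable_gaussian[OF \<beta> m a \<gamma>])

text \<open>An increment over a time \<beta> / 2^n has variance at most \<beta> / (m 2^n). Its
  rescaled standard deviation decays in \<open>n\<close> because \<alpha> is below 1/2; the
  \<open>N\<close>-th power retains this decay, while inside the exponential the bound
  \<open>sqrt (\<beta> / m)\<close> valid at all levels is sufficient.\<close>

lemma dyadic_increment_moment:
  assumes "j < 2 ^ n" "c \<ge> 0" "\<alpha> < 1 / 2"
  shows "(\<integral>\<^sup>+u. increment_term \<beta> \<alpha> N c n j u \<partial>\<gamma>)
    \<le> ennreal ((sqrt (\<beta> / m) * 2 powr (- (1 / 2 - \<alpha>) * real n)) ^ N) * normal_abs_moment N (c * sqrt (\<beta> / m))"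
proof -
  define s where "s = \<beta> * (real j / 2 ^ n)"
  define t where "t = \<beta> * ((real j + 1) / 2 ^ n)"
  define f where "f = (\<lambda>u::loop. u t - u s)"
  have "real j + 1 \<le> 2 ^ n"
    using assms(1) by (metis Suc_leI add.commute of_nat_Suc of_nat_le_numeral_power_cancel_iff)
  then have "(real j + 1) / 2 ^ n \<le> 1" by simp
  moreover have "real j / 2 ^ n \<le> (real j + 1) / 2 ^ n" by (intro divide_right_mono) auto
  ultimately have "real j / 2 ^ n \<le> 1" "(real j + 1) / 2 ^ n \<le> 1" by linarith+
  then have st: "s \<in> {0..\<beta>}" "t \<in> {0..\<beta>}"
    unfolding s_def t_def using \<beta> mult_left_le[of "real j / 2 ^ n" \<beta>] mult_left_le[of "(real j + 1) / 2 ^ n" \<beta>] by auto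
  have lin: "bounded_linear f" unfolding f_def
    by (intro bounded_linear_sub bounded_linear_eval)
  have fm: "f \<in> borel_measurable \<gamma>"
    by (intro gaussian_measurable[OF \<beta> m a \<gamma>] borel_measurable_continuous_onI linear_continuous_on lin)
  have cg: "centered_gaussian (distr \<gamma> borel f)" using \<gamma> lin by (simp add: gaussian_loop_measure_def)
  define v where "v = sqrt (\<beta> / m) * 2 powr (- real n / 2)"
  have "(2 powr (- real n / 2))\<^sup>2 = 1 / (2::real) ^ n"
    by (simp add: power2_eq_square powr_add[symmetric] powr_minus_divide powr_realpow)
  then have v2: "v\<^sup>2 = \<bar>t - s\<bar> / m"
    using \<beta> m by (simp add: v_def power_mult_distrib s_def t_def field_simps)
  have v0: "v \<ge> 0" using \<beta> m by (simp add: v_def)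
  have "(\<integral>\<^sup>+x. ennreal (x\<^sup>2) \<partial>distr \<gamma> borel f) \<le> ennreal (v\<^sup>2)"
    using gaussian_increment_variance[OF \<beta> m a \<gamma> st] fm
    by (subst nn_integral_distr) (simp_all add: f_def v2)
  note * = centered_gaussian_abs_moment[OF cg this v0, of "2 powr (\<alpha> * real n)" c N]
  have b: "2 powr (\<alpha> * real n) * v = sqrt (\<beta> / m) * 2 powr (- (1 / 2 - \<alpha>) * real n)"
    by (simp add: v_def powr_add[symmetric] algebra_simps)
  have "- (1 / 2 - \<alpha>) * real n \<le> 0" using assms by (intro mult_nonpos_nonneg) auto
  then have "2 powr (- (1 / 2 - \<alpha>) * real n) \<le> 2 powr 0" by (intro powr_mono) auto
  then have bR: "2 powr (\<alpha> * real n) * v \<le> sqrt (\<beta> / m)"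
    unfolding b using \<beta> m by (simp add: mult_left_le)
  have "(\<integral>\<^sup>+u. increment_term \<beta> \<alpha> N c n j u \<partial>\<gamma>)
    = (\<integral>\<^sup>+x. ennreal ((2 powr (\<alpha> * real n) * \<bar>x\<bar>) ^ N * exp (c * (2 powr (\<alpha> * real n) * \<bar>x\<bar>))) \<partial>distr \<gamma> borel f)"
    using fm by (subst nn_integral_distr) (simp_all add: f_def dyadic_increment_def s_def t_def)
  also have "\<dots> \<le> ennreal ((2 powr (\<alpha> * real n) * v) ^ N) * normal_abs_moment N (c * (2 powr (\<alpha> * real n) * v))"
    using * assms(2) by simp
  also have "\<dots> \<le> ennreal ((2 powr (\<alpha> * real n) * v) ^ N) * normal_abs_moment N (c * sqrt (\<beta> / m))"
    unfolding normal_abs_moment_def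
    by (intro mult_left_mono nn_integral_mono ennreal_leI)
      (auto intro!: mult_left_mono mult_right_mono bR assms(2))
  finally show ?thesis unfolding b .
qed

text \<open>The condition on \<open>N\<close> gives each of the \<open>2 ^ n\<close> increments a
  factor \<open>(1 / 4) ^ n\<close>, so that level \<open>n\<close> contributes a multiple of
  \<open>(1 / 2) ^ n\<close>.\<close>

lemma dyadic_sum_integral_finite:
  assumes "c \<ge> 0" "\<alpha> < 1 / 2" and N: "real N * (1 / 2 - \<alpha>) \<ge> 2"
  shows "(\<integral>\<^sup>+u. dyadic_sum \<beta> \<alpha> N c u \<partial>\<gamma>) < \<infinity>"
proof -
  define K where "K = ennreal (sqrt (\<beta> / m) ^ N) * normal_abs_moment N (c * sqrt (\<beta> / m))"
  have K: "K < \<infinity>" using normal_abs_moment_finite by (simp add: K_def ennreal_mult_less_top)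
  define g where "g n j u = increment_term \<beta> \<alpha> N c n j u" for n j u
  have [measurable]: "g n j \<in> borel_measurable \<gamma>" for n j unfolding g_def by measurable
  have "(\<integral>\<^sup>+u. dyadic_sum \<beta> \<alpha> N c u \<partial>\<gamma>) = (\<Sum>n. \<integral>\<^sup>+u. (\<Sum>j<2 ^ n. g n j u) \<partial>\<gamma>)"
    unfolding dyadic_sum_def g_def[symmetric] by (rule nn_integral_suminf) measurable
  also have "\<dots> = (\<Sum>n. \<Sum>j<2 ^ n. \<integral>\<^sup>+u. g n j u \<partial>\<gamma>)"
    by (subst nn_integral_sum) auto
  also have "\<dots> \<le> (\<Sum>n. K * ennreal ((1 / 2) ^ n))"
  proof (rule suminf_le)
    fix n
    have "(\<Sum>j<2 ^ n. \<integral>\<^sup>+u. g n j u \<partial>\<gamma>) \<le> (\<Sum>j<(2::nat) ^ n. K * ennreal ((1 / 4) ^ n))"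
    proof (rule sum_mono)
      fix j assume "j \<in> {..<(2::nat) ^ n}"
      then have "(\<integral>\<^sup>+u. g n j u \<partial>\<gamma>) \<le> ennreal ((sqrt (\<beta> / m) * 2 powr (- (1 / 2 - \<alpha>) * real n)) ^ N) * normal_abs_moment N (c * sqrt (\<beta> / m))"
        unfolding g_def by (intro dyadic_increment_moment assms) auto
      also have "\<dots> = K * ennreal ((2 powr (- (1 / 2 - \<alpha>) * real n)) ^ N)"
        unfolding K_def power_mult_distrib using \<beta> m by (simp add: ennreal_mult mult_ac)
      also have "\<dots> \<le> K * ennreal ((1 / 4) ^ n)"
      proof (intro mult_left_mono ennreal_leI)
        have "(2 powr (- (1 / 2 - \<alpha>) * real n)) ^ N = 2 powr (- (real N * (1 / 2 - \<alpha>)) * real n)"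
          by (subst powr_realpow[symmetric]) (simp_all add: powr_powr algebra_simps)
        also have "\<dots> \<le> 2 powr (- 2 * real n)" using N by (intro powr_mono mult_right_mono) auto
        also have "\<dots> = (2 powr (- 2)) ^ n" by (subst powr_realpow[symmetric]) (simp_all add: powr_powr)
        also have "2 powr (- 2) = (1 / 4 :: real)" by (simp add: powr_minus_divide)
        finally show "(2 powr (- (1 / 2 - \<alpha>) * real n)) ^ N \<le> (1 / 4) ^ n" .
      qed simp
      finally show "(\<integral>\<^sup>+u. g n j u \<partial>\<gamma>) \<le> K * ennreal ((1 / 4) ^ n)" .
    qed
    also have "\<dots> = K * (of_nat (2 ^ n) * ennreal ((1 / 4) ^ n))" by (simp add: mult_ac)
    also have "of_nat (2 ^ n) * ennreal ((1 / 4) ^ n) = ennreal (2 ^ n * (1 / 4) ^ n)"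
      by (subst ennreal_of_nat_eq_real_of_nat) (simp add: ennreal_mult[symmetric])
    also have "2 ^ n * (1 / 4) ^ n = (1 / 2 :: real) ^ n" by (simp add: power_mult_distrib[symmetric])
    finally show "(\<Sum>j<2 ^ n. \<integral>\<^sup>+u. g n j u \<partial>\<gamma>) \<le> K * ennreal ((1 / 2) ^ n)" .
  qed auto
  also have "\<dots> = K * ennreal (\<Sum>n. (1 / 2) ^ n)"
    by (simp add: suminf_ennreal2 summable_geometric)
  also have "\<dots> < \<infinity>" using K by (simp add: ennreal_mult_less_top)
  finally show ?thesis .
qed

lemma holder_norm_exponentially_integrable:
  assumes "0 \<le> \<alpha>" "\<alpha> < 1 / 2"
  shows "(\<integral>\<^sup>+u. ennreal_exp (holder_norm \<beta> \<alpha> u) \<partial>\<gamma>) < \<infinity>"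
proof -
  have pos: "(\<integral>\<^sup>+u. ennreal_exp (holder_norm \<beta> \<alpha> u) \<partial>\<gamma>) < \<infinity>" if \<alpha>: "0 < \<alpha>" "\<alpha> < 1 / 2" for \<alpha>
  proof -
    obtain N :: nat where "2 / (1 / 2 - \<alpha>) < real N" using reals_Archimedean2 by blast
    moreover have "0 < 2 / (1 / 2 - \<alpha>)" using \<alpha> by simp
    ultimately have "0 < real N" by linarith
    then have N: "real N * (1 / 2 - \<alpha>) \<ge> 2" "N \<ge> 1"
      using \<alpha> \<open>2 / (1 / 2 - \<alpha>) < real N\<close> by (simp_all add: pos_divide_less_eq)
    define c where "c = 2 * holder_const \<beta> \<alpha>"
    have c0: "c \<ge> 0" using holder_const_nonneg[OF \<alpha>(1)] by (simp add: c_def)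
    have [measurable]: "(\<lambda>u. apply_bcontfun u 0) \<in> borel_measurable \<gamma>"
      by (rule eval_measurable_gaussian[OF \<beta> m a \<gamma>])
    have [measurable]: "dyadic_sum \<beta> \<alpha> N c \<in> borel_measurable \<gamma>"
      unfolding dyadic_sum_def[abs_def] by measurable
    have "(\<integral>\<^sup>+u. ennreal_exp (holder_norm \<beta> \<alpha> u) \<partial>\<gamma>)
        \<le> (\<integral>\<^sup>+u. ennreal (exp (2 * \<bar>apply_bcontfun u 0\<bar>)) + ennreal (exp c) * (ennreal (exp c) + dyadic_sum \<beta> \<alpha> N c u) \<partial>\<gamma>)"
      by (intro nn_integral_mono exp_holder_norm_le[OF \<beta> \<alpha>(1) _ N(2), folded c_def])
        (simp add: space_gaussian[OF \<beta> m a \<gamma>])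
    also have "\<dots> = (\<integral>\<^sup>+u. ennreal (exp (2 * \<bar>apply_bcontfun u 0\<bar>)) \<partial>\<gamma>)
        + ennreal (exp c) * (ennreal (exp c) * emeasure \<gamma> (space \<gamma>) + (\<integral>\<^sup>+u. dyadic_sum \<beta> \<alpha> N c u \<partial>\<gamma>))"
      by (simp add: nn_integral_add nn_integral_cmult)
    also have "\<dots> < \<infinity>"
    proof -
      have cg: "centered_gaussian (distr \<gamma> borel (\<lambda>u. apply_bcontfun u 0))"
        using \<gamma> bounded_linear_eval by (simp add: gaussian_loop_measure_def)
      then obtain \<sigma> where \<sigma>: "\<sigma> \<ge> 0" "distr \<gamma> borel (\<lambda>u. apply_bcontfun u 0) = distr std_normal borel (\<lambda>z. \<sigma> * z)"
        by (rule centered_gaussianE)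
      have "(\<integral>\<^sup>+u. ennreal (exp (2 * \<bar>apply_bcontfun u 0\<bar>)) \<partial>\<gamma>) = (\<integral>\<^sup>+x. ennreal (exp (2 * \<bar>x\<bar>)) \<partial>distr \<gamma> borel (\<lambda>u. apply_bcontfun u 0))"
        by (subst nn_integral_distr) auto
      also have "\<dots> = normal_abs_moment 0 (2 * \<sigma>)"
        unfolding \<sigma>(2) normal_abs_moment_def using \<sigma>(1)
        by (subst nn_integral_distr) (auto simp: abs_mult mult.assoc)
      finally have "(\<integral>\<^sup>+u. ennreal (exp (2 * \<bar>apply_bcontfun u 0\<bar>)) \<partial>\<gamma>) < \<infinity>" using normal_abs_moment_finite by simp
      moreover have "emeasure \<gamma> (space \<gamma>) = 1"
        using \<gamma> by (simp add: gaussian_loop_measure_def prob_space.emeasure_space_1)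
      ultimately show ?thesis
        using dyadic_sum_integral_finite[OF c0 \<alpha>(2) N(1)] by (simp add: ennreal_mult_less_top)
    qed
    finally show ?thesis .
  qed
  show ?thesis
  proof (cases "\<alpha> = 0")
    \<comment> \<open>Chaining needs a positive exponent; the supremum norm is dominated by the
      Hoelder norm of any admissible exponent, for instance 1/4.\<close>
    case True
    have "(\<integral>\<^sup>+u. ennreal_exp (holder_norm \<beta> 0 u) \<partial>\<gamma>) \<le> (\<integral>\<^sup>+u. ennreal_exp (holder_norm \<beta> (1 / 4) u) \<partial>\<gamma>)"
      by (intro nn_integral_mono ennreal_exp_mono holder_norm_zero_le)
    then show ?thesis using pos[of "1 / 4"] True by (simp add: order_le_less_trans)
  qed (use pos assms in auto)
qed

end

section \<open>Measurability\<close>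

text \<open>At each level the rounded time takes countably many values, and for a fixed time
  measurability is the hypothesis. Continuity of the loops makes the evaluation at the true time a
  pointwise limit.\<close>

lemma eval_joint_measurable:
  fixes f :: "'a \<Rightarrow> loop"
  assumes f: "\<And>t. (\<lambda>x. apply_bcontfun (f x) t) \<in> borel_measurable M"
  shows "(\<lambda>p. apply_bcontfun (f (fst p)) (snd p)) \<in> borel_measurable (M \<Otimes>\<^sub>M lborel)"
proof (rule borel_measurable_LIMSEQ_real)
  fix p :: "'a \<times> real"
  show "(\<lambda>n. apply_bcontfun (f (fst p)) (dyadic_floor n (snd p))) \<longlonglongrightarrow> apply_bcontfun (f (fst p)) (snd p)"
    by (intro continuous_on_tendsto_compose[OF loop_continuous[of UNIV] dyadic_floor_tendsto]) auto
next
  fix n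
  show "(\<lambda>p. apply_bcontfun (f (fst p)) (dyadic_floor n (snd p))) \<in> borel_measurable (M \<Otimes>\<^sub>M lborel)"
    unfolding dyadic_floor_def
  proof (rule measurable_compose_countable[where g = "\<lambda>p. \<lfloor>2 ^ n * snd p\<rfloor>"])
    show "(\<lambda>p. apply_bcontfun (f (fst p)) (real_of_int i / 2 ^ n)) \<in> borel_measurable (M \<Otimes>\<^sub>M lborel)" for i
      by (rule measurable_compose[OF measurable_fst f])
  qed measurable
qed

lemma circle_integral_measurable:
  assumes "(\<lambda>p. F (fst p) (snd p)) \<in> borel_measurable (M \<Otimes>\<^sub>M lborel)"
  shows "(\<lambda>x. circle_integral \<beta> (F x)) \<in> borel_measurable M"
proof -
  have "(\<lambda>p. indicator (circle \<beta>) (snd p) *\<^sub>R F (fst p) (snd p)) \<in> borel_measurable (M \<Otimes>\<^sub>M lborel)"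
    using assms unfolding circle_def by measurable
  then show ?thesis
    unfolding set_lebesgue_integral_def
    by (intro lborel.borel_measurable_lebesgue_integral) (simp add: case_prod_beta')
qed

text \<open>The index set may be uncountable. A supremum of continuous functions is lower
  semicontinuous, so its strict superlevel sets are open.\<close>

lemma SUP_continuous_measurable:
  fixes f :: "'i \<Rightarrow> 'a::topological_space \<Rightarrow> real"
  assumes "\<And>i. i \<in> I \<Longrightarrow> continuous_on UNIV (f i)"
  shows "(\<lambda>x. SUP i\<in>I. ennreal (f i x)) \<in> borel_measurable borel"
proof (rule borel_measurableI_greater)
  fix y :: ennreal
  have "open {x. y < ennreal (f i x)}" if "i \<in> I" for i
    by (intro open_Collect_less continuous_on_const continuous_on_ennreal assms that)
  moreover have "{x. y < (SUP i\<in>I. ennreal (f i x))} = (\<Union>i\<in>I. {x. y < ennreal (f i x)})"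
    by (auto simp: less_SUP_iff)
  ultimately have "open {x. y < (SUP i\<in>I. ennreal (f i x))}" by auto
  then show "{x \<in> space borel. y < (SUP i\<in>I. ennreal (f i x))} \<in> sets borel" by simp
qed

lemma continuous_eval: "continuous_on S (\<lambda>u::loop. apply_bcontfun u t)"
  by (rule linear_continuous_on[OF bounded_linear_eval])

lemma holder_norm_measurable [measurable]: "holder_norm \<beta> \<alpha> \<in> borel_measurable borel"
proof -
  have "(\<lambda>u::loop. SUP t\<in>circle \<beta>. ennreal \<bar>u t\<bar>) \<in> borel_measurable borel"
    by (intro SUP_continuous_measurable continuous_intros continuous_eval)
  moreover have "(\<lambda>u::loop. SUP p\<in>{(t, t'). t \<in> circle \<beta> \<and> t' \<in> circle \<beta> \<and> t \<noteq> t'}.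
      ennreal (\<bar>u (fst p) - u (snd p)\<bar> / circle_dist \<beta> (fst p) (snd p) powr \<alpha>)) \<in> borel_measurable borel"
    by (intro SUP_continuous_measurable continuous_intros continuous_eval) (auto simp: circle_dist_def circle_def)
  ultimately show ?thesis
    unfolding holder_norm_def[abs_def] case_prod_beta' by measurable
qed

section \<open>Separability of the space of loops\<close>

lemma loop_reduce:
  assumes "\<beta> > 0" "u \<in> loops \<beta>"
  shows "u t = u (t - of_int \<lfloor>t / \<beta>\<rfloor> * \<beta>)"
proof -
  interpret periodic_fun_simple "apply_bcontfun u" \<beta>
    by standard (use assms in \<open>auto simp: loops_def\<close>)
  show ?thesis by (rule minus_of_int[symmetric])
qed

lemma reduced_in_circle:
  fixes \<beta> t :: real
  assumes "\<beta> > 0"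
  shows "t - of_int \<lfloor>t / \<beta>\<rfloor> * \<beta> \<in> {0..<\<beta>}"
proof -
  have "real_of_int \<lfloor>t / \<beta>\<rfloor> * \<beta> \<le> t"
    by (rule iffD1[OF pos_le_divide_eq[OF assms] of_int_floor_le])
  moreover have "t < (real_of_int \<lfloor>t / \<beta>\<rfloor> + 1) * \<beta>"
    by (rule iffD1[OF pos_divide_less_eq[OF assms] real_of_int_floor_add_one_gt])
  ultimately show ?thesis by (simp add: algebra_simps)
qed

text \<open>
  A loop is determined up to an error by rational approximations of its values at \<open>n\<close> equidistant
  points, once \<open>n\<close> resolves its modulus of continuity. Picking one loop for each such code
  spares the construction of an interpolating loop.
\<close>

lemma loops_countable_net:
  assumes \<beta>: "\<beta> > 0" and e: "e > 0"
  obtains D where "countable D" "\<And>u. u \<in> loops \<beta> \<Longrightarrow> \<exists>d\<in>D. dist u d < e"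
proof -
  define P where "P c u \<longleftrightarrow> u \<in> loops \<beta> \<and>
      (\<forall>j<fst c. \<bar>u (real j * (\<beta> / real (fst c))) - of_rat (snd c ! j)\<bar> < e / 5) \<and>
      (\<forall>x\<in>{0..\<beta>}. \<forall>y\<in>{0..\<beta>}. \<bar>x - y\<bar> \<le> \<beta> / real (fst c) \<longrightarrow> \<bar>u x - u y\<bar> < e / 5) \<and> fst c > 0"
    for c :: "nat \<times> rat list" and u :: loop
  define D where "D = (\<lambda>c. SOME u. P c u) ` {c. \<exists>u. P c u}"
  show ?thesis
  proof
    show "countable D" unfolding D_def by auto
    fix u assume u: "u \<in> loops \<beta>"
    have "uniformly_continuous_on {0..\<beta>} (apply_bcontfun u)"
      by (intro compact_uniformly_continuous loop_continuous) auto
    then obtain r where r: "r > 0" "\<And>x y. x \<in> {0..\<beta>} \<Longrightarrow> y \<in> {0..\<beta>} \<Longrightarrow> \<bar>x - y\<bar> < r \<Longrightarrow> \<bar>u x - u y\<bar> < e / 5"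
      using e unfolding uniformly_continuous_on_def dist_real_def
      by (metis divide_pos_pos zero_less_numeral)
    obtain n :: nat where n: "\<beta> / r < real n" using reals_Archimedean2 by blast
    moreover have "0 < \<beta> / r" using \<beta> r by simp
    ultimately have "0 < real n" by linarith
    then have n0: "n > 0" by simp
    have nr: "\<beta> / real n < r" using n r n0 by (simp add: field_simps)
    have "\<exists>q. \<bar>x - of_rat q\<bar> < e / 5" for x :: real
    proof -
      obtain q where "x - e / 5 < of_rat q" "of_rat q < x + e / 5"
        using of_rat_dense[of "x - e / 5" "x + e / 5"] e by auto
      then show ?thesis by (intro exI[of _ q]) linarith
    qed
    then obtain q where q: "\<And>x :: real. \<bar>x - of_rat (q x)\<bar> < e / 5" by metis
    define c where "c = (n, map (\<lambda>j. q (u (real j * (\<beta> / real n)))) [0..<n])"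
    have "P c u" unfolding P_def c_def using u q r(2) nr n0 by auto
    define d where "d = (SOME u. P c u)"
    have "P c d" unfolding d_def by (rule someI[of _ u]) fact
    \<comment> \<open>Four errors of size \<open>e / 5\<close>: the oscillation of each loop up to
      the grid point, and the distance of each value there from the common rational. The fifth share
      is left over because passing to the supremum keeps only a weak inequality.\<close>
    have "dist (u \<tau>) (d \<tau>) \<le> 4 * (e / 5)" for \<tau>
    proof -
      define t where "t = \<tau> - of_int \<lfloor>\<tau> / \<beta>\<rfloor> * \<beta>"
      have t: "t \<in> {0..<\<beta>}" unfolding t_def by (rule reduced_in_circle[OF \<beta>])
      define j where "j = nat \<lfloor>t / (\<beta> / real n)\<rfloor>"
      have "t / (\<beta> / real n) \<ge> 0" using t \<beta> by simp
      then have j: "real j \<le> t / (\<beta> / real n)" "t / (\<beta> / real n) < real j + 1"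
        unfolding j_def by linarith+
      have "t / (\<beta> / real n) < real n" using t \<beta> n0 by (simp add: field_simps)
      then have jn: "j < n" using j by linarith
      have j1: "real j * (\<beta> / real n) \<le> t" using j(1) \<beta> n0 by (simp add: field_simps)
      have j2: "t < (real j + 1) * (\<beta> / real n)" using j(2) \<beta> n0 by (simp add: field_simps)
      have near: "\<bar>t - real j * (\<beta> / real n)\<bar> \<le> \<beta> / real n"       proof -
        have "(real j + 1) * (\<beta> / real n) = real j * (\<beta> / real n) + \<beta> / real n"
          by (simp only: distrib_right mult_1)
        then show ?thesis using j1 j2 by linarith
      qed
      have tj: "t \<in> {0..\<beta>}" "real j * (\<beta> / real n) \<in> {0..\<beta>}" using t j1 \<beta> by auto
      have a: "\<bar>u t - u (real j * (\<beta> / real n))\<bar> < e / 5" "\<bar>u (real j * (\<beta> / real n)) - of_rat (snd c ! j)\<bar> < e / 5"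
        using \<open>P c u\<close> tj near jn unfolding P_def by (auto simp: c_def)
      have b: "\<bar>d t - d (real j * (\<beta> / real n))\<bar> < e / 5" "\<bar>d (real j * (\<beta> / real n)) - of_rat (snd c ! j)\<bar> < e / 5"
        using \<open>P c d\<close> tj near jn unfolding P_def by (auto simp: c_def)
      have "u \<tau> = u t" unfolding t_def by (rule loop_reduce[OF \<beta> u])
      moreover have "d \<tau> = d t" unfolding t_def by (rule loop_reduce[OF \<beta>]) (use \<open>P c d\<close> in \<open>simp add: P_def\<close>)
      ultimately show ?thesis using a b unfolding dist_real_def by linarith
    qed
    then have "dist u d \<le> 4 * (e / 5)" by (rule dist_bound)
    also have "\<dots> < e" using e by simp
    finally have "dist u d < e" .
    moreover have "d \<in> D" unfolding D_def d_def using \<open>P c u\<close> by blast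
    ultimately show "\<exists>d\<in>D. dist u d < e" by blast
  qed
qed

lemma loops_separable:
  assumes \<beta>: "\<beta> > 0"
  obtains d :: "nat \<Rightarrow> loop" where "\<And>u e. u \<in> loops \<beta> \<Longrightarrow> e > 0 \<Longrightarrow> \<exists>i. dist u (d i) < e"
proof -
  have "\<exists>D. countable D \<and> (\<forall>u\<in>loops \<beta>. \<exists>d\<in>D. dist u d < 1 / real (Suc n))" for n
    by (rule loops_countable_net[OF \<beta>, of "1 / real (Suc n)"]) auto
  then obtain D where D: "\<And>n. countable (D n)" "\<And>n u. u \<in> loops \<beta> \<Longrightarrow> \<exists>d\<in>D n. dist u d < 1 / real (Suc n)"
    by metis
  define E where "E = insert 0 (\<Union>n. D n)"
  have E: "countable E" "E \<noteq> {}" unfolding E_def using D(1) by auto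
  show ?thesis
  proof (rule that[of "from_nat_into E"])
    fix u and e :: real assume u: "u \<in> loops \<beta>" and "e > 0"
    then obtain n where n: "1 / real (Suc n) < e" using nat_approx_posE by blast
    obtain x where x: "x \<in> D n" "dist u x < 1 / real (Suc n)" using D(2)[OF u] by blast
    then have "x \<in> range (from_nat_into E)" using E by (auto simp: range_from_nat_into E_def)
    then show "\<exists>i. dist u (from_nat_into E i) < e" using x n by (metis imageE order_less_trans)
  qed
qed

text \<open>
  The bounded continuous functions on the line are not separable, so the Borel sets of the product
  topology are not generated by the coordinates; they are so on \<open>configs \<beta>\<close> only, because loops
  form a separable space.
\<close>

lemma measurable_config_borel:
  fixes f :: "'a \<Rightarrow> 'd::finite config"
  assumes \<beta>: "\<beta> > 0" and f: "\<And>k. (\<lambda>x. f x k) \<in> measurable M (restrict_space borel (loops \<beta>))"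
  shows "f \<in> measurable M (config_borel \<beta>)"
  unfolding config_borel_def
proof (rule measurable_restrict_space2)
  have fl: "f x k \<in> loops \<beta>" if "x \<in> space M" for x k
    using measurable_space[OF f that] by (simp add: space_restrict_space)
  then show "f \<in> space M \<rightarrow> configs \<beta>" by (auto simp: configs_def)
  have fb: "(\<lambda>x. f x k) \<in> measurable M borel" for k
    using measurable_compose[OF f measurable_restrict_space1[OF measurable_ident]] by simp
  obtain d :: "nat \<Rightarrow> loop" where d: "\<And>u e. u \<in> loops \<beta> \<Longrightarrow> e > 0 \<Longrightarrow> \<exists>i. dist u (d i) < e"
    using loops_separable[OF \<beta>] by blast
  \<comment> \<open>A list prescribes finitely many coordinates up to a ball around one of the loops
    \<open>d i\<close>. There are countably many lists, and the boxes restrict to a base of the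
    topology of \<open>configs \<beta>\<close>.\<close>
  define box where "box l = {\<omega> :: 'd config. \<forall>(k, i, n)\<in>set l. dist (\<omega> k) (d i) < 1 / real (Suc n)}"
    for l :: "((int ^ 'd) \<times> nat \<times> nat) list"
  have box: "f -` box l \<inter> space M \<in> sets M" for l
  proof -
    have "f -` box l \<inter> space M = {x \<in> space M. \<forall>p\<in>set l. dist (f x (fst p)) (d (fst (snd p))) < 1 / real (Suc (snd (snd p)))}"
      by (auto simp: box_def)
    also have "\<dots> \<in> sets M"
    proof (intro sets.sets_Collect_finite_All)
      fix p :: "(int ^ 'd) \<times> nat \<times> nat"
      have "(\<lambda>x. dist (f x (fst p)) (d (fst (snd p)))) \<in> borel_measurable M"
        by (rule measurable_compose[OF fb]) (intro borel_measurable_continuous_onI continuous_intros)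
      then show "{x \<in> space M. dist (f x (fst p)) (d (fst (snd p))) < 1 / real (Suc (snd (snd p)))} \<in> sets M"
        by measurable
    qed simp
    finally show ?thesis .
  qed
  show "f \<in> measurable M borel"
  proof (rule borel_measurableI)
    fix S :: "'d config set" assume "open S"
    have ex: "\<exists>l. \<omega> \<in> box l \<and> box l \<inter> configs \<beta> \<subseteq> S" if \<omega>: "\<omega> \<in> S" "\<omega> \<in> configs \<beta>" for \<omega>
    proof -
      have "openin (product_topology (\<lambda>i. euclidean) UNIV) S"
        using \<open>open S\<close> by (simp add: open_fun_def)
      from product_topology_open_contains_basis[OF this \<omega>(1)]
      obtain X where X: "\<omega> \<in> Pi\<^sub>E UNIV X" "\<And>i. open (X i)" "finite {i. X i \<noteq> UNIV}" "Pi\<^sub>E UNIV X \<subseteq> S"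
        by auto
      have "\<exists>i n. dist (\<omega> k) (d i) < 1 / real (Suc n) \<and> ball (d i) (1 / real (Suc n)) \<subseteq> X k" for k
      proof -
        have "\<omega> k \<in> X k" using X(1) by (auto simp: PiE_iff)
        then obtain r where r: "r > 0" "ball (\<omega> k) r \<subseteq> X k" using X(2) open_contains_ball by blast
        obtain n where n: "1 / real (Suc n) < r / 2" using r(1) nat_approx_posE[of "r / 2"] by auto
        obtain i where i: "dist (\<omega> k) (d i) < 1 / real (Suc n)"
          using d[of "\<omega> k" "1 / real (Suc n)"] \<omega>(2) by (auto simp: configs_def)
        have "ball (d i) (1 / real (Suc n)) \<subseteq> ball (\<omega> k) r"
        proof
          fix x assume "x \<in> ball (d i) (1 / real (Suc n))"
          then show "x \<in> ball (\<omega> k) r" using n i dist_triangle[of "\<omega> k" x "d i"] by simp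
        qed
        then show ?thesis using i r(2) by blast
      qed
      then obtain i n where i: "\<And>k. dist (\<omega> k) (d (i k)) < 1 / real (Suc (n k))"
        "\<And>k. ball (d (i k)) (1 / real (Suc (n k))) \<subseteq> X k" by metis
      obtain ks where ks: "set ks = {i. X i \<noteq> UNIV}" using X(3) finite_list by blast
      define l where "l = map (\<lambda>k. (k, i k, n k)) ks"
      have "\<omega> \<in> box l" using i(1) by (auto simp: box_def l_def)
      moreover have "box l \<subseteq> S"
      proof
        fix \<omega>' assume "\<omega>' \<in> box l"
        have "\<omega>' k \<in> X k" for k
        proof (cases "X k = UNIV")
          case False
          then have "(k, i k, n k) \<in> set l" using ks by (auto simp: l_def)
          then have "dist (\<omega>' k) (d (i k)) < 1 / real (Suc (n k))"
            using \<open>\<omega>' \<in> box l\<close> unfolding box_def by blast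
          then show ?thesis using i(2)[of k] by (auto simp: dist_commute)
        qed simp
        then show "\<omega>' \<in> S" using X(4) by (auto simp: PiE_iff)
      qed
      ultimately show ?thesis by blast
    qed
    have "f -` S \<inter> space M = (\<Union>l\<in>{l. box l \<inter> configs \<beta> \<subseteq> S}. f -` box l \<inter> space M)"
    proof (intro equalityI subsetI)
      fix x assume x: "x \<in> f -` S \<inter> space M"
      then have "f x \<in> configs \<beta>" using fl by (auto simp: configs_def)
      with ex[of "f x"] x show "x \<in> (\<Union>l\<in>{l. box l \<inter> configs \<beta> \<subseteq> S}. f -` box l \<inter> space M)" by blast
    next
      fix x assume "x \<in> (\<Union>l\<in>{l. box l \<inter> configs \<beta> \<subseteq> S}. f -` box l \<inter> space M)"
      moreover have "f x \<in> configs \<beta>" if "x \<in> space M" using fl[OF that] by (auto simp: configs_def)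
      ultimately show "x \<in> f -` S \<inter> space M" by blast
    qed
    also have "\<dots> \<in> sets M" by (intro sets.countable_UN'' box countableI_type)
    finally show "f -` S \<inter> space M \<in> sets M" .
  qed
qed

section \<open>Energies\<close>

definition self_energy :: "real \<Rightarrow> (real \<Rightarrow> real) \<Rightarrow> loop \<Rightarrow> real" where
  "self_energy \<beta> V u = circle_integral \<beta> (\<lambda>t. V (u t))"

definition pair_energy :: "real \<Rightarrow> real \<Rightarrow> loop \<Rightarrow> loop \<Rightarrow> real" where
  "pair_energy \<beta> J u u' = circle_integral \<beta> (\<lambda>t. W J (u t) (u' t))"

definition L2_sq :: "real \<Rightarrow> loop \<Rightarrow> real" where
  "L2_sq \<beta> u = L2_inner \<beta> u u"

text \<open>The terms of the energy in which the loop \<eta> at \<open>k\<close> takes part, in the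
  environment \<open>y\<close>. As no site is adjacent to itself, the value of \<open>y\<close> at
  \<open>k\<close> does not enter.\<close>

definition site_energy ::
  "real \<Rightarrow> (real \<Rightarrow> real) \<Rightarrow> real \<Rightarrow> int ^ 'd \<Rightarrow> 'd::finite config \<Rightarrow> loop \<Rightarrow> real" where
  "site_energy \<beta> V J k y \<eta> = self_energy \<beta> V \<eta> + (\<Sum>l | adjacent k l. pair_energy \<beta> J \<eta> (y l))"

section \<open>Geometry of the lattice\<close>

lemma lat_norm_zero [simp]: "lat_norm 0 = 0"
  by (simp add: lat_norm_def zero_vec_def[symmetric])

lemma lat_norm_minus: "lat_norm (- k) = lat_norm k"
proof -
  have "(\<chi> i. real_of_int ((- k) $ i)) = - (\<chi> i. real_of_int (k $ i))" by (simp add: vec_eq_iff)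
  then show ?thesis by (simp add: lat_norm_def)
qed

lemma lat_norm_triangle: "lat_norm (k + l) \<le> lat_norm k + lat_norm l"
proof -
  have "(\<chi> i. real_of_int ((k + l) $ i)) = (\<chi> i. real_of_int (k $ i)) + (\<chi> i. real_of_int (l $ i))"
    by (simp add: vec_eq_iff)
  then show ?thesis by (simp add: lat_norm_def norm_triangle_ineq)
qed

lemma lat_norm_nonneg: "0 \<le> lat_norm k"
  by (simp add: lat_norm_def)

lemma component_le_lat_norm: "\<bar>real_of_int (k $ i)\<bar> \<le> lat_norm k"
  using component_le_norm_cart[of "\<chi> i. real_of_int (k $ i)" i] by (simp add: lat_norm_def)

lemma adjacent_sym: "adjacent k l \<longleftrightarrow> adjacent l k"
  using lat_norm_minus[of "k - l"] by (simp add: adjacent_def)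

lemma adjacent_irrefl [simp]: "\<not> adjacent k k"
  by (simp add: adjacent_def)

lemma lat_norm_adjacent: "adjacent k l \<Longrightarrow> lat_norm l \<le> lat_norm k + 1"
  using lat_norm_triangle[of k "l - k"] lat_norm_minus[of "k - l"] by (simp add: adjacent_def)

lemma finite_unit_vectors: "finite {x :: int ^ 'd::finite. lat_norm x = 1}"
proof (rule finite_subset)
  show "{x :: int ^ 'd. lat_norm x = 1} \<subseteq> (\<lambda>f. \<chi> i. f i) ` (\<Pi>\<^sub>E i\<in>UNIV. {-1..1})"
  proof
    fix x :: "int ^ 'd" assume "x \<in> {x. lat_norm x = 1}"
    then have "\<bar>real_of_int (x $ i)\<bar> \<le> 1" for i using component_le_lat_norm[of x i] by simp
    then have "x $ i \<in> {-1..1}" for i by (metis abs_le_iff atLeastAtMost_iff minus_le_iff of_int_1 of_int_abs of_int_le_iff)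
    then show "x \<in> (\<lambda>f. \<chi> i. f i) ` (\<Pi>\<^sub>E i\<in>UNIV. {-1..1})"
      by (intro image_eqI[of _ _ "\<lambda>i. x $ i"]) (auto simp: PiE_iff)
  qed
  show "finite ((\<lambda>f. \<chi> i. f i) ` (\<Pi>\<^sub>E i\<in>(UNIV :: 'd set). {-1..1 :: int}) :: (int ^ 'd) set)"
    by (intro finite_imageI finite_PiE) auto
qed

text \<open>The coordination number, 2 d in dimension d. The dimension is encoded in a type, hence
  the type argument.\<close>

definition degree :: "'d::finite itself \<Rightarrow> nat" where
  "degree _ = card {x :: int ^ 'd. lat_norm x = 1}"

lemma neighbours_image: "{l. adjacent k l} = (\<lambda>x. k - x) ` {x. lat_norm x = 1}"
  by (auto simp: adjacent_def intro!: image_eqI[of _ _ "k - _"])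

lemma finite_neighbours [simp]: "finite {l. adjacent k (l :: int ^ 'd::finite)}"
  unfolding neighbours_image by (intro finite_imageI finite_unit_vectors)

lemma card_neighbours: "card {l. adjacent k (l :: int ^ 'd::finite)} = degree TYPE('d)"
  unfolding neighbours_image degree_def by (rule card_image) (auto simp: inj_on_def)

section \<open>Pair energies, squared norms and the splitting of the local energy\<close>

lemma pair_energy_sym: "pair_energy \<beta> J x y = pair_energy \<beta> J y x"
  by (simp add: pair_energy_def W_def power2_commute)

lemma W_continuous: "continuous_on S (\<lambda>t. W J (apply_bcontfun (x :: loop) t) (apply_bcontfun (y :: loop) t))"
  unfolding W_def by (intro continuous_intros loop_continuous)

lemma L2_sq_integral: "L2_sq \<beta> u = integral {0..\<beta>} (\<lambda>t. (u t)\<^sup>2)"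
  unfolding L2_sq_def by (subst L2_inner_continuous) (auto simp: power2_eq_square)

lemma L2_sq_nonneg: "0 \<le> L2_sq \<beta> u"
  unfolding L2_sq_integral
  by (intro integral_nonneg integrable_continuous_real continuous_intros loop_continuous) auto

lemma pair_energy_integral: "pair_energy \<beta> J x y = integral {0..\<beta>} (\<lambda>t. W J (x t) (y t))"
  unfolding pair_energy_def by (rule circle_integral_continuous(2)[OF W_continuous])

lemma pair_energy_nonneg: "J \<ge> 0 \<Longrightarrow> 0 \<le> pair_energy \<beta> J x y"
  unfolding pair_energy_integral
  by (intro integral_nonneg integrable_continuous_real W_continuous) (auto simp: W_def)

text \<open>The difference of the two integrands is J times the square of \<open>x t + y t\<close>.
  The coefficient \<open>2 * J\<close> arises here and is what a large \<kappa> later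
  outweighs.\<close>

lemma pair_energy_le:
  assumes "J \<ge> 0"
  shows "pair_energy \<beta> J x y \<le> 2 * J * L2_sq \<beta> x + 2 * J * L2_sq \<beta> y"
proof -
  have "pair_energy \<beta> J x y \<le> integral {0..\<beta>} (\<lambda>t. 2 * J * (x t)\<^sup>2 + 2 * J * (y t)\<^sup>2)"
    unfolding pair_energy_integral
  proof (intro integral_le integrable_continuous_real W_continuous)
    fix t
    have "0 \<le> J * (x t + y t)\<^sup>2" using assms by simp
    then show "W J (x t) (y t) \<le> 2 * J * (x t)\<^sup>2 + 2 * J * (y t)\<^sup>2"
      by (simp add: W_def power2_eq_square algebra_simps)
  qed (intro continuous_intros loop_continuous)
  also have "\<dots> = 2 * J * L2_sq \<beta> x + 2 * J * L2_sq \<beta> y"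
    unfolding L2_sq_integral
    by (subst integral_add) (auto intro!: integrable_continuous_real continuous_intros loop_continuous)
  finally show ?thesis .
qed

lemma L2_sq_le:
  fixes u :: loop
  assumes "\<beta> > 0" "\<And>t. t \<in> {0..\<beta>} \<Longrightarrow> \<bar>u t\<bar> \<le> R"
  shows "L2_sq \<beta> u \<le> \<beta> * R\<^sup>2"
proof -
  have "L2_sq \<beta> u \<le> integral {0..\<beta>} (\<lambda>t. R\<^sup>2)"
    unfolding L2_sq_integral
  proof (intro integral_le integrable_continuous_real continuous_intros loop_continuous)
    fix t assume "t \<in> {0..\<beta>}"
    then have "\<bar>u t\<bar>\<^sup>2 \<le> R\<^sup>2" using assms(2) by (intro power_mono) auto
    then show "(u t)\<^sup>2 \<le> R\<^sup>2" by simp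
  qed
  then show ?thesis using assms(1) by simp
qed

lemma compose_loop_continuous:
  "continuous_on UNIV V \<Longrightarrow> continuous_on S (\<lambda>t. V (apply_bcontfun (u :: loop) t))"
  by (rule continuous_on_compose2[OF _ loop_continuous]) auto

lemma self_energy_integral:
  "continuous_on UNIV V \<Longrightarrow> self_energy \<beta> V u = integral {0..\<beta>} (\<lambda>t. V (u t))"
  unfolding self_energy_def by (rule circle_integral_continuous(2)) (rule compose_loop_continuous)

lemma local_energy_expand:
  fixes \<xi> \<omega> :: "'d::finite config"
  assumes V: "continuous_on UNIV V" and \<Lambda>: "finite \<Lambda>"
  shows "local_energy \<beta> V J \<Lambda> \<xi> \<omega> = (\<Sum>k\<in>\<Lambda>. self_energy \<beta> V (\<omega> k))
    + (\<Sum>k\<in>\<Lambda>. \<Sum>k'\<in>{k'\<in>\<Lambda>. adjacent k k'}. pair_energy \<beta> J (\<omega> k) (\<omega> k')) / 2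
    + (\<Sum>k\<in>\<Lambda>. \<Sum>k'\<in>{k'\<in>- \<Lambda>. adjacent k k'}. pair_energy \<beta> J (\<omega> k) (\<xi> k'))"
proof -
  have fin: "finite {k'\<in>- \<Lambda>. adjacent k k'}" for k
    by (rule finite_subset[OF _ finite_neighbours[of k]]) auto
  note int = integrable_continuous_real continuous_intros W_continuous compose_loop_continuous[OF V]
  have "local_energy \<beta> V J \<Lambda> \<xi> \<omega> = integral {0..\<beta>} (\<lambda>t.
     (\<Sum>k\<in>\<Lambda>. V (\<omega> k t)) +
     (\<Sum>k\<in>\<Lambda>. \<Sum>k'\<in>{k'\<in>\<Lambda>. adjacent k k'}. W J (\<omega> k t) (\<omega> k' t)) / 2 +
     (\<Sum>k\<in>\<Lambda>. \<Sum>k'\<in>{k'\<in>- \<Lambda>. adjacent k k'}. W J (\<omega> k t) (\<xi> k' t)))"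
    unfolding local_energy_def by (intro circle_integral_continuous(2) int) auto
  also have "\<dots> = integral {0..\<beta>} (\<lambda>t. \<Sum>k\<in>\<Lambda>. V (\<omega> k t)) +
     integral {0..\<beta>} (\<lambda>t. (\<Sum>k\<in>\<Lambda>. \<Sum>k'\<in>{k'\<in>\<Lambda>. adjacent k k'}. W J (\<omega> k t) (\<omega> k' t)) / 2) +
     integral {0..\<beta>} (\<lambda>t. \<Sum>k\<in>\<Lambda>. \<Sum>k'\<in>{k'\<in>- \<Lambda>. adjacent k k'}. W J (\<omega> k t) (\<xi> k' t))"
    by (subst integral_add, (intro int; simp)+)+ simp
  also have "integral {0..\<beta>} (\<lambda>t. \<Sum>k\<in>\<Lambda>. V (\<omega> k t)) = (\<Sum>k\<in>\<Lambda>. self_energy \<beta> V (\<omega> k))"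
    unfolding self_energy_integral[OF V] by (intro integral_sum \<Lambda> int)
  also have "integral {0..\<beta>} (\<lambda>t. (\<Sum>k\<in>\<Lambda>. \<Sum>k'\<in>{k'\<in>\<Lambda>. adjacent k k'}. W J (\<omega> k t) (\<omega> k' t)) / 2)
      = (\<Sum>k\<in>\<Lambda>. \<Sum>k'\<in>{k'\<in>\<Lambda>. adjacent k k'}. pair_energy \<beta> J (\<omega> k) (\<omega> k')) / 2"
    unfolding pair_energy_integral integral_divide using \<Lambda>
    by (subst integral_sum, simp, intro int, subst integral_sum) (auto intro!: int)
  also have "integral {0..\<beta>} (\<lambda>t. \<Sum>k\<in>\<Lambda>. \<Sum>k'\<in>{k'\<in>- \<Lambda>. adjacent k k'}. W J (\<omega> k t) (\<xi> k' t))
      = (\<Sum>k\<in>\<Lambda>. \<Sum>k'\<in>{k'\<in>- \<Lambda>. adjacent k k'}. pair_energy \<beta> J (\<omega> k) (\<xi> k'))"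
    unfolding pair_energy_integral using \<Lambda> fin
    by (subst integral_sum, simp, intro int, subst integral_sum) (auto intro!: int)
  finally show ?thesis .
qed

text \<open>Isolates the dependence on one loop: \<open>R\<close> is chosen before \<eta>, so it
  cancels between numerator and normalisation of the one-site law. In the double sum over ordered
  pairs, each neighbour of \<open>k\<close> occurs once on either side, which compensates the
  division by 2.\<close>

lemma local_energy_split:
  fixes \<xi> \<omega> :: "'d::finite config"
  assumes V: "continuous_on UNIV V" and \<Lambda>: "finite \<Lambda>" and k: "k \<notin> \<Lambda>"
  obtains R where "\<And>\<eta>. local_energy \<beta> V J (insert k \<Lambda>) \<xi> (fun_upd \<omega> k \<eta>)
    = R + site_energy \<beta> V J k (glue \<Lambda> \<xi> \<omega>) \<eta>"
proof -
  define g where "g \<eta> l l' = (if adjacent l l' then pair_energy \<beta> J ((fun_upd \<omega> k \<eta>) l) ((fun_upd \<omega> k \<eta>) l') else 0)" for \<eta> l l'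
  define h where "h l = (\<Sum>l'\<in>{l'\<in>- insert k \<Lambda>. adjacent l l'}. pair_energy \<beta> J (\<omega> l) (\<xi> l'))" for l
  define R where "R = (\<Sum>l\<in>\<Lambda>. self_energy \<beta> V (\<omega> l))
    + (\<Sum>l\<in>\<Lambda>. \<Sum>l'\<in>\<Lambda>. if adjacent l l' then pair_energy \<beta> J (\<omega> l) (\<omega> l') else 0) / 2 + (\<Sum>l\<in>\<Lambda>. h l)"
  have "local_energy \<beta> V J (insert k \<Lambda>) \<xi> (fun_upd \<omega> k \<eta>) = R + site_energy \<beta> V J k (glue \<Lambda> \<xi> \<omega>) \<eta>" for \<eta>
  proof -
    have ne: "l \<noteq> k" if "l \<in> \<Lambda>" for l using that k by auto
    have 1: "(\<Sum>l\<in>insert k \<Lambda>. self_energy \<beta> V ((fun_upd \<omega> k \<eta>) l)) = self_energy \<beta> V \<eta> + (\<Sum>l\<in>\<Lambda>. self_energy \<beta> V (\<omega> l))"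
      using \<Lambda> k ne by (simp add: sum.insert cong: sum.cong)
    have "(\<Sum>l\<in>insert k \<Lambda>. \<Sum>l'\<in>{l'\<in>insert k \<Lambda>. adjacent l l'}. pair_energy \<beta> J ((fun_upd \<omega> k \<eta>) l) ((fun_upd \<omega> k \<eta>) l'))
        = (\<Sum>l\<in>insert k \<Lambda>. \<Sum>l'\<in>insert k \<Lambda>. g \<eta> l l')"
      unfolding g_def using \<Lambda> by (intro sum.cong refl sum.inter_filter) auto
    also have "\<dots> = (\<Sum>l'\<in>\<Lambda>. g \<eta> k l') + (\<Sum>l\<in>\<Lambda>. g \<eta> l k) + (\<Sum>l\<in>\<Lambda>. \<Sum>l'\<in>\<Lambda>. g \<eta> l l')"
    proof -
      have "g \<eta> k k = 0" by (simp add: g_def)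
      then show ?thesis using \<Lambda> k by (simp add: sum.distrib)
    qed
    also have "(\<Sum>l\<in>\<Lambda>. g \<eta> l k) = (\<Sum>l'\<in>\<Lambda>. g \<eta> k l')"
      by (intro sum.cong refl) (auto simp: g_def adjacent_sym pair_energy_sym)
    also have "(\<Sum>l\<in>\<Lambda>. \<Sum>l'\<in>\<Lambda>. g \<eta> l l') = (\<Sum>l\<in>\<Lambda>. \<Sum>l'\<in>\<Lambda>. if adjacent l l' then pair_energy \<beta> J (\<omega> l) (\<omega> l') else 0)"
      by (intro sum.cong refl) (auto simp: g_def dest: ne)
    also have "(\<Sum>l'\<in>\<Lambda>. g \<eta> k l') = (\<Sum>l\<in>{l\<in>\<Lambda>. adjacent k l}. pair_energy \<beta> J \<eta> (\<omega> l))"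
      using \<Lambda> by (subst sum.inter_filter) (auto simp: g_def dest: ne intro!: sum.cong)
    finally have 2: "(\<Sum>l\<in>insert k \<Lambda>. \<Sum>l'\<in>{l'\<in>insert k \<Lambda>. adjacent l l'}. pair_energy \<beta> J ((fun_upd \<omega> k \<eta>) l) ((fun_upd \<omega> k \<eta>) l')) / 2
      = (\<Sum>l\<in>{l\<in>\<Lambda>. adjacent k l}. pair_energy \<beta> J \<eta> (\<omega> l))
        + (\<Sum>l\<in>\<Lambda>. \<Sum>l'\<in>\<Lambda>. if adjacent l l' then pair_energy \<beta> J (\<omega> l) (\<omega> l') else 0) / 2"
      by simp
    have out: "{l'\<in>- insert k \<Lambda>. adjacent k l'} = {l'. adjacent k l' \<and> l' \<notin> \<Lambda>}" by auto
    have 3: "(\<Sum>l\<in>insert k \<Lambda>. \<Sum>l'\<in>{l'\<in>- insert k \<Lambda>. adjacent l l'}. pair_energy \<beta> J ((fun_upd \<omega> k \<eta>) l) (\<xi> l'))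
        = (\<Sum>l | adjacent k l \<and> l \<notin> \<Lambda>. pair_energy \<beta> J \<eta> (\<xi> l)) + (\<Sum>l\<in>\<Lambda>. h l)"
    proof -
      have "(\<Sum>l\<in>\<Lambda>. \<Sum>l'\<in>{l'\<in>- insert k \<Lambda>. adjacent l l'}. pair_energy \<beta> J ((fun_upd \<omega> k \<eta>) l) (\<xi> l')) = (\<Sum>l\<in>\<Lambda>. h l)"
        unfolding h_def by (intro sum.cong refl) (auto dest: ne)
      then show ?thesis using \<Lambda> k by (subst sum.insert) (simp_all only: out fun_upd_same not_False_eq_True)
    qed
    have "(\<Sum>l | adjacent k l. pair_energy \<beta> J \<eta> (glue \<Lambda> \<xi> \<omega> l))
        = (\<Sum>l\<in>{l\<in>\<Lambda>. adjacent k l} \<union> {l. adjacent k l \<and> l \<notin> \<Lambda>}. pair_energy \<beta> J \<eta> (glue \<Lambda> \<xi> \<omega> l))"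
      by (intro sum.cong) auto
    also have "\<dots> = (\<Sum>l\<in>{l\<in>\<Lambda>. adjacent k l}. pair_energy \<beta> J \<eta> (glue \<Lambda> \<xi> \<omega> l))
        + (\<Sum>l | adjacent k l \<and> l \<notin> \<Lambda>. pair_energy \<beta> J \<eta> (glue \<Lambda> \<xi> \<omega> l))"
      by (rule sum.union_disjoint) (auto intro: finite_subset[OF _ finite_neighbours[of k]])
    also have "\<dots> = (\<Sum>l\<in>{l\<in>\<Lambda>. adjacent k l}. pair_energy \<beta> J \<eta> (\<omega> l))
        + (\<Sum>l | adjacent k l \<and> l \<notin> \<Lambda>. pair_energy \<beta> J \<eta> (\<xi> l))"
      by (intro arg_cong2[where f = "(+)"] sum.cong) (auto simp: glue_def)
    finally have 4: "site_energy \<beta> V J k (glue \<Lambda> \<xi> \<omega>) \<eta> = self_energy \<beta> V \<eta>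
        + (\<Sum>l\<in>{l\<in>\<Lambda>. adjacent k l}. pair_energy \<beta> J \<eta> (\<omega> l))
        + (\<Sum>l | adjacent k l \<and> l \<notin> \<Lambda>. pair_energy \<beta> J \<eta> (\<xi> l))" by (simp add: site_energy_def)
    have "finite (insert k \<Lambda>)" using \<Lambda> by simp
    note e = local_energy_expand[OF V this, of \<beta> J \<xi> "fun_upd \<omega> k \<eta>"]
    show ?thesis unfolding e 1 2 3 4 R_def by linarith
  qed
  then show ?thesis by (rule that)
qed

lemma superquadratic:
  assumes "polynomial_growth V" "\<kappa> \<ge> 0"
  obtains c where "c \<ge> 0" "\<And>q. \<kappa> * q\<^sup>2 - V q \<le> c"
proof -
  obtain P K C where P: "P > 2" and K: "K > 0" and C: "C > 0"
    and "\<forall>q. \<forall>l\<in>{0, 1, 2 :: nat}. inverse K * \<bar>q\<bar> powr (P - real l) - C \<le> sgn q ^ l * (deriv ^^ l) V q \<and>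
     sgn q ^ l * (deriv ^^ l) V q \<le> K * \<bar>q\<bar> powr (P - real l) + C"
    using assms(1) unfolding polynomial_growth_def by blast
  then have V: "inverse K * \<bar>q\<bar> powr P - C \<le> V q" for q by (metis diff_zero funpow_0 insertI1 lambda_one of_nat_0 power_0)
  \<comment> \<open>The radius beyond which the growth
    \<open>inverse K * \<bar>q\<bar> powr P\<close> exceeds \<open>\<kappa> * q\<^sup>2\<close>;
    here \<open>P > 2\<close> is essential.\<close>
  define R where "R = (\<kappa> * K) powr (1 / (P - 2))"
  have R0: "R \<ge> 0" by (simp add: R_def)
  have bound: "\<kappa> * q\<^sup>2 \<le> inverse K * \<bar>q\<bar> powr P + \<kappa> * R\<^sup>2" for q
  proof (cases "\<bar>q\<bar> \<le> R")
    case True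
    then have "q\<^sup>2 \<le> R\<^sup>2" using R0 abs_le_square_iff[of q R] by simp
    then have "\<kappa> * q\<^sup>2 \<le> \<kappa> * R\<^sup>2" using assms(2) by (intro mult_left_mono)
    moreover have "0 \<le> inverse K * \<bar>q\<bar> powr P" using K by simp
    ultimately show ?thesis by linarith
  next
    case False
    then have q: "\<bar>q\<bar> > 0" "R \<le> \<bar>q\<bar>" using R0 by auto
    have "\<kappa> * K = R powr (P - 2)" unfolding R_def using P assms(2) K by (simp add: powr_powr)
    also have "\<dots> \<le> \<bar>q\<bar> powr (P - 2)" using q R0 P by (intro powr_mono2) auto
    finally have "\<kappa> * K * q\<^sup>2 \<le> \<bar>q\<bar> powr (P - 2) * q\<^sup>2" by (rule mult_right_mono) simp
    also have "\<bar>q\<bar> powr (P - 2) * q\<^sup>2 = \<bar>q\<bar> powr P"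
      using powr_add[of "\<bar>q\<bar>" "P - 2" 2] q by (simp add: powr_numeral)
    finally have "\<kappa> * q\<^sup>2 \<le> inverse K * \<bar>q\<bar> powr P"
      using K by (simp add: field_simps)
    moreover have "0 \<le> \<kappa> * R\<^sup>2" using assms(2) by simp
    ultimately show ?thesis by linarith
  qed
  show ?thesis
  proof (rule that[of "C + \<kappa> * R\<^sup>2"])
    show "0 \<le> C + \<kappa> * R\<^sup>2" using C assms(2) by simp
    show "\<kappa> * q\<^sup>2 - V q \<le> C + \<kappa> * R\<^sup>2" for q using bound[of q] V[of q] by linarith
  qed
qed

lemma C2_continuous: "C2 V \<Longrightarrow> continuous_on UNIV V"
  unfolding C2_def by (simp add: continuous_on_eq_continuous_at differentiable_imp_continuous_within)

section \<open>One-site estimates\<close>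

lemma self_energy_measurable:
  assumes "continuous_on UNIV V" "\<And>t. (\<lambda>x. apply_bcontfun (f x) t) \<in> borel_measurable M"
  shows "(\<lambda>x. self_energy \<beta> V (f x)) \<in> borel_measurable M"
  unfolding self_energy_def
  by (intro circle_integral_measurable measurable_compose[OF eval_joint_measurable]
      borel_measurable_continuous_onI assms)

lemma pair_energy_measurable:
  assumes "\<And>t. (\<lambda>x. apply_bcontfun (f x) t) \<in> borel_measurable M"
    and "\<And>t. (\<lambda>x. apply_bcontfun (g x) t) \<in> borel_measurable M"
  shows "(\<lambda>x. pair_energy \<beta> J (f x) (g x)) \<in> borel_measurable M"
  unfolding pair_energy_def W_def
  by (intro circle_integral_measurable borel_measurable_times borel_measurable_const
      borel_measurable_power borel_measurable_diff eval_joint_measurable assms)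

lemma L2_sq_measurable:
  assumes "\<And>t. (\<lambda>x. apply_bcontfun (f x) t) \<in> borel_measurable M"
  shows "(\<lambda>x. L2_sq \<beta> (f x)) \<in> borel_measurable M"
  unfolding L2_sq_def L2_inner_def
  by (intro circle_integral_measurable borel_measurable_times eval_joint_measurable assms)

locale lattice_system =
  fixes \<beta> m a J :: real and V :: "real \<Rightarrow> real" and \<gamma> :: "loop measure"
  assumes \<beta>: "\<beta> > 0" and m: "m > 0" and a: "a \<noteq> 0" and J: "J > 0"
    and V: "continuous_on UNIV V" "polynomial_growth V"
    and \<gamma>: "gaussian_loop_measure \<beta> m a \<gamma>"
begin

abbreviation weight :: "(int ^ 'd) set \<Rightarrow> 'd::finite config \<Rightarrow> 'd config \<Rightarrow> ennreal" where
  "weight \<Lambda> \<xi> \<omega> \<equiv> ennreal (exp (- local_energy \<beta> V J \<Lambda> \<xi> \<omega>))"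

abbreviation Z :: "(int ^ 'd) set \<Rightarrow> 'd::finite config \<Rightarrow> ennreal" where
  "Z \<equiv> partition_function \<beta> V J \<gamma>"

abbreviation site_partition :: "int ^ 'd \<Rightarrow> 'd::finite config \<Rightarrow> ennreal" where
  "site_partition k y \<equiv> \<integral>\<^sup>+\<eta>. ennreal (exp (- site_energy \<beta> V J k y \<eta>)) \<partial>\<gamma>"

abbreviation neighbour_L2 :: "int ^ 'd \<Rightarrow> 'd::finite config \<Rightarrow> real" where
  "neighbour_L2 k y \<equiv> \<Sum>l | adjacent k l. L2_sq \<beta> (y l)"

sublocale prob_space \<gamma>
  using \<gamma> by (simp add: gaussian_loop_measure_def)

lemmas \<gamma>_measurable = gaussian_measurable[OF \<beta> m a \<gamma>]
lemmas eval_\<gamma> = eval_measurable_gaussian[OF \<beta> m a \<gamma>]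

lemma sets_\<gamma>: "sets \<gamma> = sets (restrict_space borel (loops \<beta>))"
  using \<gamma> by (simp add: gaussian_loop_measure_def)

lemma holder_norm_\<gamma> [measurable]: "holder_norm \<beta> \<alpha> \<in> borel_measurable \<gamma>"
  by (rule \<gamma>_measurable[OF holder_norm_measurable])

lemma L2_sq_\<gamma> [measurable]: "L2_sq \<beta> \<in> borel_measurable \<gamma>"
  using L2_sq_measurable[OF eval_\<gamma>] .

lemma site_energy_\<gamma> [measurable]: "site_energy \<beta> V J k y \<in> borel_measurable \<gamma>"
  unfolding site_energy_def[abs_def]
  by (intro borel_measurable_add borel_measurable_sum self_energy_measurable pair_energy_measurable
      eval_\<gamma> V borel_measurable_const)

text \<open>Balls of integer radius exhaust the space, so one of them carries at least half of the
  mass; on it the one-site energies are bounded apart from the neighbours' share.\<close>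

lemma bounded_loops_likely: obtains R :: real where "R > 0" "emeasure \<gamma> {u\<in>space \<gamma>. norm u \<le> R} \<ge> ennreal (1 / 2)"
proof -
  have [measurable]: "norm \<in> borel_measurable \<gamma>" by (rule \<gamma>_measurable) simp
  define A where "A n = {u\<in>space \<gamma>. norm u \<le> real n}" for n
  have "(\<lambda>n. measure \<gamma> (A n)) \<longlonglongrightarrow> measure \<gamma> (\<Union>n. A n)"
    by (rule finite_Lim_measure_incseq) (auto simp: A_def incseq_def)
  moreover have "(\<Union>n. A n) = space \<gamma>" by (auto simp: A_def real_arch_simple)
  ultimately have "(\<lambda>n. measure \<gamma> (A n)) \<longlonglongrightarrow> 1" by (simp add: prob_space)
  then have "\<forall>\<^sub>F n in sequentially. 1 / 2 < measure \<gamma> (A n)" by (rule order_tendstoD) simp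
  then have "\<forall>\<^sub>F n in sequentially. 0 < n \<and> 1 / 2 < measure \<gamma> (A n)"
    by (intro eventually_conj eventually_gt_at_top)
  from eventually_happens'[OF sequentially_bot this]
  obtain n where n: "n > 0" "1 / 2 < measure \<gamma> (A n)" by blast
  have "ennreal (1 / 2) \<le> emeasure \<gamma> (A n)"
    unfolding emeasure_eq_measure using n by (intro ennreal_leI) simp
  then show ?thesis using n by (intro that[of "real n"]) (simp_all add: A_def)
qed

lemma L2_sq_minus_self_energy_le:
  assumes c: "\<And>q. \<kappa> * q\<^sup>2 - V q \<le> c"
  shows "\<kappa> * L2_sq \<beta> u - self_energy \<beta> V u \<le> c * \<beta>"
proof -
  have "\<kappa> * L2_sq \<beta> u - self_energy \<beta> V u = integral {0..\<beta>} (\<lambda>t. \<kappa> * (u t)\<^sup>2 - V (u t))"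
    unfolding L2_sq_integral self_energy_integral[OF V(1)]
    by (subst integral_diff)
      (auto intro!: integrable_continuous_real continuous_intros loop_continuous compose_loop_continuous[OF V(1)])
  also have "\<dots> \<le> integral {0..\<beta>} (\<lambda>t. c)"
    by (intro integral_le integrable_continuous_real continuous_intros loop_continuous compose_loop_continuous[OF V(1)] c)
  finally show ?thesis using \<beta> by (simp add: mult.commute)
qed

text \<open>Only loops of norm at most \<open>R\<close> are kept. There the self-energy and the
  squared norm of the loop itself are bounded, and each neighbour costs at most \<open>2 * J\<close>
  times its squared norm. The 1 added to \<open>b\<close> pays for the mass 1/2 of these loops, as
  \<open>exp (- 1)\<close> is at most 1/2.\<close>

lemma site_partition_lower_bound:
  obtains b where "b \<ge> 0" "\<And>(k :: int ^ 'd::finite) y.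
    ennreal (exp (- b - 2 * J * neighbour_L2 k y))
      \<le> site_partition k y"
proof -
  obtain R :: real where R: "R > 0" "emeasure \<gamma> {u\<in>space \<gamma>. norm u \<le> R} \<ge> ennreal (1 / 2)"
    by (rule bounded_loops_likely)
  have "compact (V ` {-R..R})" by (intro compact_continuous_image continuous_on_subset[OF V(1)]) auto
  then obtain v where v: "\<And>q. q \<in> {-R..R} \<Longrightarrow> \<bar>V q\<bar> \<le> v"
    using compact_imp_bounded bounded_iff by (metis image_eqI real_norm_def)
  have v0: "v \<ge> 0" using v[of 0] R by auto
  define D where "D = degree TYPE('d)"
  define b where "b = \<beta> * v + real D * (2 * J * (\<beta> * R\<^sup>2))"
  have b0: "b \<ge> 0" unfolding b_def using \<beta> v0 J by simp
  show ?thesis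
  proof (rule that[of "b + 1"])
    show "b + 1 \<ge> 0" using b0 by simp
    fix k :: "int ^ 'd" and y
    define s where "s = 2 * J * neighbour_L2 k y"
    have "site_energy \<beta> V J k y \<eta> \<le> b + s" if \<eta>: "norm \<eta> \<le> R" for \<eta>
    proof -
      have bd: "\<bar>\<eta> t\<bar> \<le> R" for t using loop_bound[of \<eta> t] \<eta> by linarith
      have "self_energy \<beta> V \<eta> \<le> integral {0..\<beta>} (\<lambda>t. v)"
        unfolding self_energy_integral[OF V(1)]
      proof (intro integral_le integrable_continuous_real continuous_intros compose_loop_continuous[OF V(1)])
        fix t
        show "V (\<eta> t) \<le> v" using v[of "\<eta> t"] bd[of t] by (simp add: abs_le_iff)
      qed
      then have 1: "self_energy \<beta> V \<eta> \<le> \<beta> * v" using \<beta> by simp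
      have "(\<Sum>l | adjacent k l. pair_energy \<beta> J \<eta> (y l))
          \<le> (\<Sum>l | adjacent k l. 2 * J * (\<beta> * R\<^sup>2) + 2 * J * L2_sq \<beta> (y l))"
      proof (rule sum_mono)
        fix l
        have "pair_energy \<beta> J \<eta> (y l) \<le> 2 * J * L2_sq \<beta> \<eta> + 2 * J * L2_sq \<beta> (y l)"
          using J by (intro pair_energy_le) simp
        also have "2 * J * L2_sq \<beta> \<eta> \<le> 2 * J * (\<beta> * R\<^sup>2)"
          using J bd by (intro mult_left_mono L2_sq_le \<beta>) auto
        finally show "pair_energy \<beta> J \<eta> (y l) \<le> 2 * J * (\<beta> * R\<^sup>2) + 2 * J * L2_sq \<beta> (y l)" by simp
      qed
      also have "\<dots> = real D * (2 * J * (\<beta> * R\<^sup>2)) + s"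
        by (simp add: sum.distrib card_neighbours D_def s_def sum_distrib_left)
      finally show ?thesis using 1 unfolding site_energy_def b_def by linarith
    qed
    then have le: "ennreal (exp (- b - s)) * indicator {u\<in>space \<gamma>. norm u \<le> R} \<eta> \<le> ennreal (exp (- site_energy \<beta> V J k y \<eta>))" for \<eta>
      by (auto simp: indicator_def intro!: ennreal_leI) (smt (verit))
    have [measurable]: "norm \<in> borel_measurable \<gamma>" by (rule \<gamma>_measurable) simp
    have "exp (- (b + 1) - s) \<le> exp (- b - s) * (1 / 2)"
    proof -
      have "exp (- (b + 1) - s) = exp (- b - s) * exp (- 1)" by (simp add: exp_add[symmetric])
      moreover have "exp (- 1) \<le> (1 / 2 :: real)"
        using exp_ge_add_one_self[of 1] by (simp add: exp_minus field_simps)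
      ultimately show ?thesis by simp
    qed
    then have "ennreal (exp (- (b + 1) - s)) \<le> ennreal (exp (- b - s)) * ennreal (1 / 2)"
      by (subst ennreal_mult[symmetric]) (auto intro: ennreal_leI)
    also have "\<dots> \<le> ennreal (exp (- b - s)) * emeasure \<gamma> {u\<in>space \<gamma>. norm u \<le> R}"
      by (intro mult_left_mono R) auto
    also have "\<dots> = (\<integral>\<^sup>+\<eta>. ennreal (exp (- b - s)) * indicator {u\<in>space \<gamma>. norm u \<le> R} \<eta> \<partial>\<gamma>)"
      by (rule nn_integral_cmult_indicator[symmetric]) measurable
    also have "\<dots> \<le> site_partition k y"
      by (intro nn_integral_mono le)
    finally show "ennreal (exp (- (b + 1) - 2 * J * neighbour_L2 k y))
      \<le> site_partition k y" by (simp add: s_def)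
  qed
qed

text \<open>The first factor is the one that reappears on the neighbours in the recursion; the
  second rides along so that the final bound reaches the Hoelder norm.\<close>

definition exp_weight :: "real \<Rightarrow> real \<Rightarrow> loop \<Rightarrow> ennreal" where
  "exp_weight \<alpha> \<kappa> \<eta> = ennreal (exp (\<kappa> * L2_sq \<beta> \<eta>)) * ennreal_exp (holder_norm \<beta> \<alpha> \<eta>)"

lemma exp_weight_\<gamma> [measurable]: "exp_weight \<alpha> \<kappa> \<in> borel_measurable \<gamma>"
  unfolding exp_weight_def[abs_def] by measurable

abbreviation site_moment :: "real \<Rightarrow> real \<Rightarrow> int ^ 'd \<Rightarrow> 'd::finite config \<Rightarrow> ennreal" where
  "site_moment \<alpha> \<kappa> k y \<equiv> \<integral>\<^sup>+\<eta>. exp_weight \<alpha> \<kappa> \<eta> * ennreal (exp (- site_energy \<beta> V J k y \<eta>)) \<partial>\<gamma>"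

lemma site_estimate:
  assumes "0 \<le> \<alpha>" "\<alpha> < 1 / 2" "\<kappa> \<ge> 0"
  obtains C where "C \<ge> 0" "\<And>(k :: int ^ 'd::finite) y.
    site_moment \<alpha> \<kappa> k y \<le> ennreal (exp (C + 2 * J * neighbour_L2 k y)) * site_partition k y"
proof -
  obtain c where c: "c \<ge> 0" "\<And>q. \<kappa> * q\<^sup>2 - V q \<le> c"
    by (rule superquadratic[OF V(2) assms(3)]) blast
  obtain b where b: "b \<ge> 0" "\<And>(k :: int ^ 'd) y.
    ennreal (exp (- b - 2 * J * neighbour_L2 k y))
      \<le> site_partition k y"
    by (rule site_partition_lower_bound) blast
  have "(\<integral>\<^sup>+\<eta>. ennreal_exp (holder_norm \<beta> \<alpha> \<eta>) \<partial>\<gamma>) < \<infinity>"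
    by (rule holder_norm_exponentially_integrable[OF \<beta> m a \<gamma> assms(1,2)])
  then obtain I where I: "I \<ge> 0" "(\<integral>\<^sup>+\<eta>. ennreal_exp (holder_norm \<beta> \<alpha> \<eta>) \<partial>\<gamma>) = ennreal I"
    by (cases "\<integral>\<^sup>+\<eta>. ennreal_exp (holder_norm \<beta> \<alpha> \<eta>) \<partial>\<gamma>") auto
  show ?thesis
  proof (rule that[of "c * \<beta> + I + b"])
    show "c * \<beta> + I + b \<ge> 0" using c \<beta> I b by simp
    fix k :: "int ^ 'd" and y
    define s where "s = 2 * J * neighbour_L2 k y"
    have Z: "ennreal (exp (- b - s)) \<le> site_partition k y" unfolding s_def by (rule b)
    have "site_moment \<alpha> \<kappa> k y
        \<le> (\<integral>\<^sup>+\<eta>. ennreal (exp (c * \<beta>)) * ennreal_exp (holder_norm \<beta> \<alpha> \<eta>) \<partial>\<gamma>)"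
    proof (rule nn_integral_mono)
      fix \<eta>
      have "\<kappa> * L2_sq \<beta> \<eta> - self_energy \<beta> V \<eta> \<le> c * \<beta>" by (rule L2_sq_minus_self_energy_le[OF c(2)])
      moreover have "(\<Sum>l | adjacent k l. pair_energy \<beta> J \<eta> (y l)) \<ge> 0"
        using J by (intro sum_nonneg pair_energy_nonneg) auto
      ultimately have "exp (\<kappa> * L2_sq \<beta> \<eta>) * exp (- site_energy \<beta> V J k y \<eta>) \<le> exp (c * \<beta>)"
        by (simp add: exp_add[symmetric] site_energy_def)
      then have "ennreal (exp (\<kappa> * L2_sq \<beta> \<eta>)) * ennreal (exp (- site_energy \<beta> V J k y \<eta>)) \<le> ennreal (exp (c * \<beta>))"
        by (subst ennreal_mult[symmetric]) (auto intro: ennreal_leI)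
      from mult_right_mono[OF this, of "ennreal_exp (holder_norm \<beta> \<alpha> \<eta>)"]
      show "exp_weight \<alpha> \<kappa> \<eta> * ennreal (exp (- site_energy \<beta> V J k y \<eta>))
          \<le> ennreal (exp (c * \<beta>)) * ennreal_exp (holder_norm \<beta> \<alpha> \<eta>)"
        by (simp add: exp_weight_def mult_ac)
    qed
    also have "\<dots> = ennreal (exp (c * \<beta>)) * ennreal I" by (simp add: nn_integral_cmult I)
    \<comment> \<open>Moves the constant \<open>I\<close> into the exponent: \<open>I\<close> itself
      is a safe substitute for its logarithm and also covers \<open>I = 0\<close>.\<close>
    also have "\<dots> \<le> ennreal (exp (c * \<beta> + I + b + s)) * ennreal (exp (- b - s))"
    proof -
      have "I \<le> exp I" using exp_ge_add_one_self[of I] by linarith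
      then have "exp (c * \<beta>) * I \<le> exp (c * \<beta>) * exp I" by (intro mult_left_mono) auto
      also have "\<dots> = exp (c * \<beta> + I + b + s) * exp (- b - s)" by (simp add: exp_add[symmetric])
      finally show ?thesis using I by (simp add: ennreal_mult[symmetric] ennreal_leI)
    qed
    also have "\<dots> \<le> ennreal (exp (c * \<beta> + I + b + s)) * site_partition k y" by (intro mult_left_mono Z) auto
    finally show "site_moment \<alpha> \<kappa> k y
      \<le> ennreal (exp (c * \<beta> + I + b + 2 * J * neighbour_L2 k y))
       * site_partition k y"
      unfolding s_def .
  qed
qed

abbreviation loop_product :: "'i set \<Rightarrow> ('i \<Rightarrow> loop) measure" where
  "loop_product \<Lambda> \<equiv> (\<Pi>\<^sub>M k\<in>\<Lambda>. \<gamma>)"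

lemma eval_product: "k \<in> \<Lambda> \<Longrightarrow> (\<lambda>\<omega>. apply_bcontfun (\<omega> k) t) \<in> borel_measurable (loop_product \<Lambda>)"
  by (rule measurable_compose[where f = "\<lambda>\<omega>. \<omega> k" and N = \<gamma>, OF measurable_component_singleton eval_\<gamma>])

lemma local_energy_measurable:
  fixes \<xi> :: "'d::finite config"
  assumes "finite \<Lambda>"
  shows "(\<lambda>\<omega>. local_energy \<beta> V J \<Lambda> \<xi> \<omega>) \<in> borel_measurable (loop_product \<Lambda>)"
  unfolding local_energy_expand[OF V(1) assms]
  by (intro borel_measurable_add borel_measurable_divide borel_measurable_sum self_energy_measurable
      pair_energy_measurable V borel_measurable_const eval_product) auto

lemma glue_L2_sq_measurable:
  "(\<lambda>\<omega>. L2_sq \<beta> (glue \<Lambda> \<xi> \<omega> l)) \<in> borel_measurable (loop_product \<Lambda>)"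
  unfolding glue_def by (cases "l \<in> \<Lambda>") (auto intro!: L2_sq_measurable eval_product)

text \<open>The loop at \<open>k\<close> is integrated first, with all others frozen; this is the
  conditioning on the other sites in unnormalised form. The factor with \<open>neighbour_L2\<close>
  involves only sites other than \<open>k\<close>, so it may be moved back under the inner integral
  together with the weight.\<close>

lemma product_estimate:
  fixes \<xi> :: "'d::finite config" and k :: "int ^ 'd"
  assumes C: "\<And>(k :: int ^ 'd) y.
    site_moment \<alpha> \<kappa> k y \<le> ennreal (exp (C + 2 * J * neighbour_L2 k y)) * site_partition k y"
    and \<Lambda>: "finite \<Lambda>" and k: "k \<in> \<Lambda>"
  shows "(\<integral>\<^sup>+\<omega>. exp_weight \<alpha> \<kappa> (\<omega> k) * weight \<Lambda> \<xi> \<omega> \<partial>loop_product \<Lambda>)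
    \<le> (\<integral>\<^sup>+\<omega>. ennreal (exp (C + 2 * J * neighbour_L2 k (glue \<Lambda> \<xi> \<omega>)))
        * weight \<Lambda> \<xi> \<omega> \<partial>loop_product \<Lambda>)"
proof -
  interpret P: product_prob_space "\<lambda>_ :: int ^ 'd. \<gamma>" UNIV by unfold_locales
  define \<Lambda>' where "\<Lambda>' = \<Lambda> - {k}"
  have \<Lambda>': "\<Lambda> = insert k \<Lambda>'" "finite \<Lambda>'" "k \<notin> \<Lambda>'" using \<Lambda> k by (auto simp: \<Lambda>'_def)
  have [measurable]: "(\<lambda>\<omega>. local_energy \<beta> V J \<Lambda> \<xi> \<omega>) \<in> borel_measurable (loop_product \<Lambda>)"
    by (rule local_energy_measurable[OF \<Lambda>])
  have [measurable]: "(\<lambda>\<omega>. L2_sq \<beta> (glue \<Lambda> \<xi> \<omega> l)) \<in> borel_measurable (loop_product \<Lambda>)" for l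
    by (rule glue_L2_sq_measurable)
  have [measurable]: "(\<lambda>\<omega>. exp_weight \<alpha> \<kappa> (\<omega> k)) \<in> borel_measurable (loop_product \<Lambda>)"
    by (rule measurable_compose[OF measurable_component_singleton[OF k] exp_weight_\<gamma>])
  have step: "(\<integral>\<^sup>+\<eta>. exp_weight \<alpha> \<kappa> ((fun_upd \<omega> k \<eta>) k) * weight \<Lambda> \<xi> (fun_upd \<omega> k \<eta>) \<partial>\<gamma>)
      \<le> (\<integral>\<^sup>+\<eta>. ennreal (exp (C + 2 * J * neighbour_L2 k (glue \<Lambda> \<xi> (fun_upd \<omega> k \<eta>))))
        * weight \<Lambda> \<xi> (fun_upd \<omega> k \<eta>) \<partial>\<gamma>)" for \<omega>
  proof -
    obtain R where R: "\<And>\<eta>. local_energy \<beta> V J (insert k \<Lambda>') \<xi> (fun_upd \<omega> k \<eta>)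
        = R + site_energy \<beta> V J k (glue \<Lambda>' \<xi> \<omega>) \<eta>"
      by (rule local_energy_split[OF V(1) \<Lambda>'(2,3)]) blast
    have w: "weight \<Lambda> \<xi> (fun_upd \<omega> k \<eta>)
        = ennreal (exp (- R)) * ennreal (exp (- site_energy \<beta> V J k (glue \<Lambda>' \<xi> \<omega>) \<eta>))" for \<eta>
      unfolding \<Lambda>'(1) R by (simp add: ennreal_mult[symmetric] exp_add[symmetric])
    have g: "neighbour_L2 k (glue \<Lambda> \<xi> (fun_upd \<omega> k \<eta>)) = neighbour_L2 k (glue \<Lambda>' \<xi> \<omega>)" for \<eta>
      by (intro sum.cong refl) (auto simp: glue_def \<Lambda>'(1))
    have "(\<integral>\<^sup>+\<eta>. exp_weight \<alpha> \<kappa> ((fun_upd \<omega> k \<eta>) k) * weight \<Lambda> \<xi> (fun_upd \<omega> k \<eta>) \<partial>\<gamma>)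
        = ennreal (exp (- R)) * (\<integral>\<^sup>+\<eta>. exp_weight \<alpha> \<kappa> \<eta> * ennreal (exp (- site_energy \<beta> V J k (glue \<Lambda>' \<xi> \<omega>) \<eta>)) \<partial>\<gamma>)"
      unfolding w by (subst nn_integral_cmult[symmetric]) (auto simp: mult_ac)
    also have "\<dots> \<le> ennreal (exp (- R)) * (ennreal (exp (C + 2 * J * neighbour_L2 k (glue \<Lambda>' \<xi> \<omega>)))
       * (\<integral>\<^sup>+\<eta>. ennreal (exp (- site_energy \<beta> V J k (glue \<Lambda>' \<xi> \<omega>) \<eta>)) \<partial>\<gamma>))"
      by (intro mult_left_mono C) auto
    also have "\<dots> = (\<integral>\<^sup>+\<eta>. ennreal (exp (C + 2 * J * neighbour_L2 k (glue \<Lambda> \<xi> (fun_upd \<omega> k \<eta>))))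
        * weight \<Lambda> \<xi> (fun_upd \<omega> k \<eta>) \<partial>\<gamma>)"
      unfolding w g by (subst nn_integral_cmult, measurable, subst nn_integral_cmult) (auto simp: mult_ac)
    finally show ?thesis .
  qed
  have ins: "(\<integral>\<^sup>+\<omega>. f \<omega> \<partial>loop_product \<Lambda>) = (\<integral>\<^sup>+\<omega>. \<integral>\<^sup>+\<eta>. f (fun_upd \<omega> k \<eta>) \<partial>\<gamma> \<partial>loop_product \<Lambda>')"
    if "f \<in> borel_measurable (loop_product \<Lambda>)" for f
    using that unfolding \<Lambda>'(1) by (rule P.product_nn_integral_insert[OF \<Lambda>'(2,3)])
  show ?thesis
    by (subst (1 2) ins) (measurable, intro nn_integral_mono step)
qed

end

section \<open>Moment bounds\<close>

text \<open>Convexity of the exponential, with the missing mass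
  \<open>1 - real (card S) * \<theta>\<close> placed at the point 0. All values are compared with
  the tangent at the weighted mean \<open>s\<close>; the weights add up to 1, so the tangent values
  recombine to exactly \<open>exp s\<close>.\<close>

lemma exp_sum_le:
  fixes x :: "'i \<Rightarrow> real"
  assumes "finite S" "\<theta> \<ge> 0" "real (card S) * \<theta> \<le> 1"
  shows "exp (\<Sum>l\<in>S. \<theta> * x l) \<le> 1 - real (card S) * \<theta> + (\<Sum>l\<in>S. \<theta> * exp (x l))"
proof -
  define s where "s = (\<Sum>l\<in>S. \<theta> * x l)"
  have tangent: "exp s * (1 + (y - s)) \<le> exp y" for y
  proof -
    have "exp s * (1 + (y - s)) \<le> exp s * exp (y - s)" by (intro mult_left_mono exp_ge_add_one_self) auto
    then show ?thesis by (simp add: exp_add[symmetric])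
  qed
  have "exp s = (1 - real (card S) * \<theta>) * (exp s * (1 + (0 - s))) + (\<Sum>l\<in>S. \<theta> * (exp s * (1 + (x l - s))))"
  proof -
    have "(\<Sum>l\<in>S. \<theta> * (exp s * (1 + (x l - s)))) = (\<Sum>l\<in>S. exp s * (\<theta> * x l) + exp s * \<theta> * (1 - s))"
      by (intro sum.cong refl) (simp add: algebra_simps)
    also have "\<dots> = exp s * s + real (card S) * (exp s * \<theta> * (1 - s))"
    proof -
      have "(\<Sum>l\<in>S. r * (\<theta> * x l)) = r * s" for r
        unfolding s_def by (rule sum_distrib_left[symmetric])
      then show ?thesis by (simp add: sum.distrib)
    qed
    finally show ?thesis by (simp add: algebra_simps)
  qed
  also have "\<dots> \<le> (1 - real (card S) * \<theta>) * exp 0 + (\<Sum>l\<in>S. \<theta> * exp (x l))"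
    using assms by (intro add_mono mult_left_mono sum_mono tangent) auto
  finally show ?thesis by (simp add: s_def)
qed

lemma powr_le_exp:
  fixes y :: real
  assumes "y \<ge> 0" "Q \<ge> 0"
  shows "y powr Q \<le> (1 + fact (nat \<lceil>Q\<rceil>)) * exp y"
proof (cases "y \<le> 1")
  case True
  then have "y powr Q \<le> 1" using assms powr_mono2[of Q y 1] by simp
  also have "\<dots> \<le> exp y" using assms by simp
  also have "\<dots> \<le> (1 + fact (nat \<lceil>Q\<rceil>)) * exp y" by simp
  finally show ?thesis .
next
  case False
  then have "y powr Q \<le> y powr real (nat \<lceil>Q\<rceil>)" using assms by (intro powr_mono real_nat_ceiling_ge) auto
  also have "\<dots> = y ^ nat \<lceil>Q\<rceil>" using False by (simp add: powr_realpow)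
  also have "\<dots> \<le> fact (nat \<lceil>Q\<rceil>) * exp y" using assms by (intro power_le_fact_exp)
  also have "\<dots> \<le> (1 + fact (nat \<lceil>Q\<rceil>)) * exp y" by simp
  finally show ?thesis .
qed

lemma ennreal_powr_mono: "Q \<ge> 0 \<Longrightarrow> x \<le> y \<Longrightarrow> ennreal_powr x Q \<le> ennreal_powr y Q"
  by (cases x; cases y) (auto simp: ennreal_powr_def top_unique intro!: ennreal_leI powr_mono2)

lemma ennreal_powr_measurable [measurable]: "(\<lambda>x. ennreal_powr x Q) \<in> borel_measurable borel"
  unfolding ennreal_powr_def by measurable

definition moment_const :: "real \<Rightarrow> real" where
  "moment_const Q = 2 powr Q * (1 + fact (nat \<lceil>Q\<rceil>))"

text \<open>A truncation at \<open>2 * n\<close>. Above that level the argument is at most twice its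
  excess over \<open>n\<close>, whence the factor \<open>2 powr Q\<close> in
  \<open>moment_const\<close>, and the exponential dominates the power of the excess. The factor
  \<open>exp (- n)\<close> obtained in this way cancels an exponential moment of size
  \<open>exp n\<close>, so that the resulting moment bound is polynomial in
  \<open>n\<close>.\<close>

lemma ennreal_powr_le_exp:
  assumes "n \<ge> 0" "Q \<ge> 0"
  shows "ennreal_powr x Q \<le> ennreal ((2 * n) powr Q) + ennreal (moment_const Q * exp (- n)) * ennreal_exp x"
proof (cases x)
  case (real r)
  have "r powr Q \<le> (2 * n) powr Q + moment_const Q * exp (- n) * exp r"
  proof (cases "r \<le> 2 * n")
    case True
    then have "r powr Q \<le> (2 * n) powr Q" using real assms by (intro powr_mono2) auto
    moreover have "0 \<le> moment_const Q * exp (- n) * exp r" by (simp add: moment_const_def)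
    ultimately show ?thesis by linarith
  next
    case False
    then have "r powr Q \<le> (2 * (r - n)) powr Q" using real assms by (intro powr_mono2) auto
    also have "\<dots> = 2 powr Q * (r - n) powr Q" using powr_mult[of 2 "r - n" Q] False assms by simp
    also have "\<dots> \<le> 2 powr Q * ((1 + fact (nat \<lceil>Q\<rceil>)) * exp (r - n))"
      using False assms by (intro mult_left_mono powr_le_exp) auto
    also have "\<dots> = moment_const Q * exp (- n) * exp r"
      by (simp add: moment_const_def exp_diff exp_minus field_simps)
    finally show ?thesis by (simp add: add_increasing)
  qed
  then have "ennreal (r powr Q) \<le> ennreal ((2 * n) powr Q + moment_const Q * exp (- n) * exp r)"
    by (rule ennreal_leI)
  also have "\<dots> = ennreal ((2 * n) powr Q) + ennreal (moment_const Q * exp (- n)) * ennreal_exp x"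
    using real by (simp add: ennreal_plus ennreal_mult ennreal_exp_ennreal moment_const_def)
  finally show ?thesis using real by (simp add: ennreal_powr_def)
next
  case top
  have "moment_const Q > 0" unfolding moment_const_def by (intro mult_pos_pos add_pos_pos) auto
  then show ?thesis using top by (simp add: ennreal_exp_def ennreal_mult_top)
qed

section \<open>Summability of exponential weights on the lattice\<close>

lemma integer_exp_sum_le:
  assumes "c > 0"
  shows "(\<Sum>j\<in>{- int N..int N}. exp (- c * \<bar>real_of_int j\<bar>)) \<le> 2 * (\<Sum>n. exp (- c) ^ n)"
proof -
  have sm: "summable (\<lambda>n. exp (- c) ^ n)" using assms by (intro summable_geometric) simp
  have e: "exp (- (c * real n)) = exp (- c) ^ n" for n
    by (simp add: exp_of_nat_mult[symmetric] mult.commute)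
  have half: "(\<Sum>j\<in>f ` {..N}. exp (- c * \<bar>real_of_int j\<bar>)) \<le> (\<Sum>n. exp (- c) ^ n)"
    if "inj f" "\<And>n. \<bar>f n\<bar> = int n" for f
  proof -
    have "(\<Sum>j\<in>f ` {..N}. exp (- c * \<bar>real_of_int j\<bar>)) = (\<Sum>n\<in>{..N}. exp (- c * \<bar>real_of_int (f n)\<bar>))"
      using that(1) by (subst sum.reindex) (auto intro: inj_on_subset)
    also have "\<dots> = (\<Sum>n\<in>{..N}. exp (- c) ^ n)"
      unfolding of_int_abs[symmetric] that(2) by (simp add: e)
    also have "\<dots> \<le> (\<Sum>n. exp (- c) ^ n)" by (intro sum_le_suminf sm) auto
    finally show ?thesis .
  qed
  have "{- int N..int N} = int ` {..N} \<union> (\<lambda>n. - int n) ` {..N}"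
  proof (intro equalityI subsetI)
    fix j assume "j \<in> {- int N..int N}"
    then have "j = int (nat \<bar>j\<bar>) \<or> j = - int (nat \<bar>j\<bar>)" "nat \<bar>j\<bar> \<in> {..N}" by auto
    then show "j \<in> int ` {..N} \<union> (\<lambda>n. - int n) ` {..N}" by blast
  qed auto
  then have "(\<Sum>j\<in>{- int N..int N}. exp (- c * \<bar>real_of_int j\<bar>))
      \<le> (\<Sum>j\<in>int ` {..N}. exp (- c * \<bar>real_of_int j\<bar>)) + (\<Sum>j\<in>(\<lambda>n. - int n) ` {..N}. exp (- c * \<bar>real_of_int j\<bar>))"
    by (simp add: sum_Un sum_nonneg)
  also have "\<dots> \<le> (\<Sum>n. exp (- c) ^ n) + (\<Sum>n. exp (- c) ^ n)"
    by (intro add_mono half) (auto simp: inj_def)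
  finally show ?thesis by simp
qed

text \<open>Each coordinate is at most the norm, so the norm is at least the average of the absolute
  coordinates. The weight is then bounded by a product over the coordinates, and summing over a cube
  around the finite set gives a product of one-dimensional geometric sums.\<close>

lemma lattice_exp_sum_bounded:
  assumes "c > 0"
  obtains T where "T \<ge> 0" "\<And>\<Lambda> :: (int ^ 'd::finite) set. finite \<Lambda> \<Longrightarrow> (\<Sum>k\<in>\<Lambda>. exp (- c * lat_norm k)) \<le> T"
proof -
  define c' where "c' = c / real CARD('d)"
  have c': "c' > 0" using assms by (simp add: c'_def)
  define T where "T = (2 * (\<Sum>n. exp (- c') ^ n)) ^ CARD('d)"
  have "2 * (\<Sum>n. exp (- c') ^ n) \<ge> 0"
    using c' by (intro mult_nonneg_nonneg suminf_nonneg summable_geometric) auto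
  then have T0: "T \<ge> 0" unfolding T_def by simp
  have "(\<Sum>k\<in>\<Lambda>. exp (- c * lat_norm k)) \<le> T" if \<Lambda>: "finite \<Lambda>" for \<Lambda> :: "(int ^ 'd) set"
  proof -
    have "finite ((\<lambda>(k, i). nat \<bar>k $ i\<bar>) ` (\<Lambda> \<times> UNIV))" using \<Lambda> by auto
    then obtain N where "\<forall>x\<in>(\<lambda>(k, i). nat \<bar>k $ i\<bar>) ` (\<Lambda> \<times> UNIV). x \<le> N"
      using finite_nat_set_iff_bounded_le by blast
    then have N: "nat \<bar>k $ i\<bar> \<le> N" if "k \<in> \<Lambda>" for k i using that by force
    define B where "B = Pi\<^sub>E (UNIV :: 'd set) (\<lambda>_. {- int N..int N})"
    have fB: "finite B" unfolding B_def by (intro finite_PiE) auto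
    have "(\<Sum>k\<in>\<Lambda>. exp (- c * lat_norm k)) \<le> (\<Sum>k\<in>\<Lambda>. \<Prod>i\<in>UNIV. exp (- c' * \<bar>real_of_int (k $ i)\<bar>))"
    proof (rule sum_mono)
      fix k :: "int ^ 'd"
      have "(\<Sum>i\<in>UNIV. \<bar>real_of_int (k $ i)\<bar>) \<le> (\<Sum>i\<in>(UNIV :: 'd set). lat_norm k)"
        by (intro sum_mono component_le_lat_norm)
      then have "c' * (\<Sum>i\<in>UNIV. \<bar>real_of_int (k $ i)\<bar>) \<le> c' * (real CARD('d) * lat_norm k)"
        using c' by (intro mult_left_mono) auto
      then have "exp (- c * lat_norm k) \<le> exp (\<Sum>i\<in>UNIV. - c' * \<bar>real_of_int (k $ i)\<bar>)"
        by (simp add: c'_def sum_distrib_left sum_divide_distrib sum_negf)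
      then show "exp (- c * lat_norm k) \<le> (\<Prod>i\<in>UNIV. exp (- c' * \<bar>real_of_int (k $ i)\<bar>))"
        by (simp add: exp_sum)
    qed
    also have "\<dots> = (\<Sum>f\<in>(\<lambda>k. ($) k) ` \<Lambda>. \<Prod>i\<in>UNIV. exp (- c' * \<bar>real_of_int (f i)\<bar>))"
      by (subst sum.reindex) (auto simp: inj_on_def vec_eq_iff)
    also have "\<dots> \<le> (\<Sum>f\<in>B. \<Prod>i\<in>UNIV. exp (- c' * \<bar>real_of_int (f i)\<bar>))"
    proof (rule sum_mono2[OF fB])
      show "(\<lambda>k. ($) k) ` \<Lambda> \<subseteq> B"
      proof
        fix f assume "f \<in> (\<lambda>k. ($) k) ` \<Lambda>"
        then obtain k where k: "k \<in> \<Lambda>" "f = ($) k" by blast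
        have "k $ i \<in> {- int N..int N}" for i using N[OF k(1), of i] by auto
        then show "f \<in> B" using k by (auto simp: B_def PiE_iff)
      qed
    qed (intro prod_nonneg, auto)
    also have "\<dots> = (\<Prod>i\<in>(UNIV :: 'd set). \<Sum>j\<in>{- int N..int N}. exp (- c' * \<bar>real_of_int j\<bar>))"
      unfolding B_def by (rule prod_sum_PiE[symmetric]) auto
    also have "\<dots> \<le> T"
      unfolding T_def prod_constant by (intro power_mono integer_exp_sum_le[OF c'] sum_nonneg) auto
    finally show ?thesis .
  qed
  with T0 show ?thesis by (rule that)
qed

section \<open>Gibbs measures in finite volumes and the contraction\<close>

context lattice_system
begin

text \<open>The local specification before \<xi> is glued in. It lives on families indexed by
  \<Lambda>, where Fubini's theorem for product measures applies directly.\<close>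

definition gibbs :: "(int ^ 'd) set \<Rightarrow> 'd::finite config \<Rightarrow> 'd config measure" where
  "gibbs \<Lambda> \<xi> = density (loop_product \<Lambda>)
     (\<lambda>\<omega>. weight \<Lambda> \<xi> \<omega> / Z \<Lambda> \<xi>)"

abbreviation weight_moment :: "real \<Rightarrow> real \<Rightarrow> (int ^ 'd) set \<Rightarrow> 'd::finite config \<Rightarrow> int ^ 'd \<Rightarrow> ennreal" where
  "weight_moment \<alpha> \<kappa> \<Lambda> \<xi> k \<equiv> \<integral>\<^sup>+\<omega>. exp_weight \<alpha> \<kappa> (\<omega> k) \<partial>gibbs \<Lambda> \<xi>"

abbreviation exp_moment :: "real \<Rightarrow> (int ^ 'd) set \<Rightarrow> 'd::finite config \<Rightarrow> int ^ 'd \<Rightarrow> ennreal" where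
  "exp_moment \<alpha> \<Lambda> \<xi> k \<equiv> \<integral>\<^sup>+\<omega>. ennreal_exp (holder_norm \<beta> \<alpha> (\<omega> k)) \<partial>gibbs \<Lambda> \<xi>"

abbreviation moment :: "real \<Rightarrow> real \<Rightarrow> (int ^ 'd) set \<Rightarrow> 'd::finite config \<Rightarrow> int ^ 'd \<Rightarrow> ennreal" where
  "moment \<alpha> Q \<Lambda> \<xi> k \<equiv> \<integral>\<^sup>+\<omega>. ennreal_powr (holder_norm \<beta> \<alpha> (\<omega> k)) Q \<partial>local_spec \<beta> V J \<gamma> \<Lambda> \<xi>"

text \<open>Drops all pair energies as nonnegative and bounds the self-energies from below site by
  site. The cost is proportional to the volume, so this can provide finiteness but no uniform
  bound.\<close>

lemma local_energy_ge:
  fixes \<xi> \<omega> :: "'d::finite config"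
  assumes c: "\<And>q. \<kappa> * q\<^sup>2 - V q \<le> c" and "\<kappa> \<ge> 0" "finite \<Lambda>" "k \<in> \<Lambda>"
  shows "\<kappa> * L2_sq \<beta> (\<omega> k) - local_energy \<beta> V J \<Lambda> \<xi> \<omega> \<le> real (card \<Lambda>) * (c * \<beta>)"
proof -
  have "0 \<le> (\<Sum>k\<in>\<Lambda>. \<Sum>k'\<in>{k'\<in>\<Lambda>. adjacent k k'}. pair_energy \<beta> J (\<omega> k) (\<omega> k')) / 2"
    "0 \<le> (\<Sum>k\<in>\<Lambda>. \<Sum>k'\<in>{k'\<in>- \<Lambda>. adjacent k k'}. pair_energy \<beta> J (\<omega> k) (\<xi> k'))"
    using J by (auto intro!: sum_nonneg divide_nonneg_pos pair_energy_nonneg)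
  then have "(\<Sum>l\<in>\<Lambda>. self_energy \<beta> V (\<omega> l)) \<le> local_energy \<beta> V J \<Lambda> \<xi> \<omega>"
    unfolding local_energy_expand[OF V(1) assms(3)] by linarith
  moreover have "\<kappa> * L2_sq \<beta> (\<omega> k) \<le> (\<Sum>l\<in>\<Lambda>. \<kappa> * L2_sq \<beta> (\<omega> l))"
    using assms by (intro member_le_sum) (auto simp: L2_sq_nonneg)
  moreover have "(\<Sum>l\<in>\<Lambda>. \<kappa> * L2_sq \<beta> (\<omega> l) - self_energy \<beta> V (\<omega> l)) \<le> (\<Sum>l\<in>\<Lambda>. c * \<beta>)"
    by (intro sum_mono L2_sq_minus_self_energy_le c)
  ultimately show ?thesis by (simp add: sum_subtractf)
qed

lemma product_prob: "prob_space (loop_product \<Lambda>)"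
  by (intro prob_space_PiM) unfold_locales

lemma nn_integral_component:
  assumes "k \<in> \<Lambda>" "f \<in> borel_measurable \<gamma>"
  shows "(\<integral>\<^sup>+\<omega>. f (\<omega> k) \<partial>loop_product \<Lambda>) = (\<integral>\<^sup>+\<eta>. f \<eta> \<partial>\<gamma>)"
proof -
  interpret P: product_prob_space "\<lambda>_. \<gamma>" \<Lambda> by unfold_locales
  have "distr (loop_product \<Lambda>) \<gamma> (\<lambda>\<omega>. \<omega> k) = \<gamma>" by (rule P.PiM_component[OF assms(1)])
  then have "(\<integral>\<^sup>+\<eta>. f \<eta> \<partial>\<gamma>) = (\<integral>\<^sup>+\<eta>. f \<eta> \<partial>distr (loop_product \<Lambda>) \<gamma> (\<lambda>\<omega>. \<omega> k))" by simp
  also have "\<dots> = (\<integral>\<^sup>+\<omega>. f (\<omega> k) \<partial>loop_product \<Lambda>)"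
    by (rule nn_integral_distr) (auto intro: measurable_component_singleton assms)
  finally show ?thesis by simp
qed

lemma weight_measurable:
  "finite \<Lambda> \<Longrightarrow> (\<lambda>\<omega>. weight \<Lambda> \<xi> \<omega>) \<in> borel_measurable (loop_product \<Lambda>)"
  using local_energy_measurable by measurable

text \<open>The a priori finiteness on which the contraction rests; the bound itself depends on
  \<Lambda>.\<close>

lemma weighted_integral_finite:
  fixes \<xi> :: "'d::finite config"
  assumes "0 \<le> \<alpha>" "\<alpha> < 1 / 2" "\<kappa> \<ge> 0" "finite \<Lambda>" "k \<in> \<Lambda>"
  shows "(\<integral>\<^sup>+\<omega>. exp_weight \<alpha> \<kappa> (\<omega> k) * weight \<Lambda> \<xi> \<omega> \<partial>loop_product \<Lambda>) < \<infinity>"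
proof -
  obtain c where c: "\<And>q. \<kappa> * q\<^sup>2 - V q \<le> c"
    by (rule superquadratic[OF V(2) assms(3)]) blast
  define K where "K = real (card \<Lambda>) * (c * \<beta>)"
  have "(\<integral>\<^sup>+\<omega>. exp_weight \<alpha> \<kappa> (\<omega> k) * weight \<Lambda> \<xi> \<omega> \<partial>loop_product \<Lambda>)
      \<le> (\<integral>\<^sup>+\<omega>. ennreal (exp K) * ennreal_exp (holder_norm \<beta> \<alpha> (\<omega> k)) \<partial>loop_product \<Lambda>)"
  proof (rule nn_integral_mono)
    fix \<omega> :: "'d config"
    have "exp (\<kappa> * L2_sq \<beta> (\<omega> k)) * exp (- local_energy \<beta> V J \<Lambda> \<xi> \<omega>) \<le> exp K"
      using local_energy_ge[OF c assms(3,4,5), of \<omega> \<xi>] by (simp add: exp_add[symmetric] K_def)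
    then have "ennreal (exp (\<kappa> * L2_sq \<beta> (\<omega> k))) * weight \<Lambda> \<xi> \<omega> \<le> ennreal (exp K)"
      by (subst ennreal_mult[symmetric]) (auto intro: ennreal_leI)
    from mult_right_mono[OF this, of "ennreal_exp (holder_norm \<beta> \<alpha> (\<omega> k))"]
    show "exp_weight \<alpha> \<kappa> (\<omega> k) * weight \<Lambda> \<xi> \<omega>
        \<le> ennreal (exp K) * ennreal_exp (holder_norm \<beta> \<alpha> (\<omega> k))"
      by (simp add: exp_weight_def mult_ac)
  qed
  also have "\<dots> = (\<integral>\<^sup>+\<eta>. ennreal (exp K) * ennreal_exp (holder_norm \<beta> \<alpha> \<eta>) \<partial>\<gamma>)"
    by (rule nn_integral_component[OF assms(5)]) measurable
  also have "\<dots> = ennreal (exp K) * (\<integral>\<^sup>+\<eta>. ennreal_exp (holder_norm \<beta> \<alpha> \<eta>) \<partial>\<gamma>)"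
    by (rule nn_integral_cmult) measurable
  also have "\<dots> < \<infinity>"
    using holder_norm_exponentially_integrable[OF \<beta> m a \<gamma> assms(1,2)] by (simp add: ennreal_mult_less_top)
  finally show ?thesis .
qed

lemma partition_function_bounds:
  fixes \<xi> :: "'d::finite config"
  assumes \<Lambda>: "finite \<Lambda>" "\<Lambda> \<noteq> {}"
  shows "Z \<Lambda> \<xi> \<noteq> 0" "Z \<Lambda> \<xi> < \<infinity>"
proof -
  interpret P: prob_space "loop_product \<Lambda>" by (rule product_prob)
  show "Z \<Lambda> \<xi> \<noteq> 0"
  proof
    assume "Z \<Lambda> \<xi> = 0"
    then have "AE \<omega> in loop_product \<Lambda>. weight \<Lambda> \<xi> \<omega> = 0"
      unfolding partition_function_def using nn_integral_0_iff_AE[OF weight_measurable[OF \<Lambda>(1)]] by blast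
    then have "AE \<omega> in loop_product \<Lambda>. False" by eventually_elim simp
    then show False by simp
  qed
  obtain k where k: "k \<in> \<Lambda>" using \<Lambda>(2) by blast
  have "Z \<Lambda> \<xi>
      \<le> (\<integral>\<^sup>+\<omega>. exp_weight 0 0 (\<omega> k) * weight \<Lambda> \<xi> \<omega> \<partial>loop_product \<Lambda>)"
    unfolding partition_function_def
  proof (rule nn_integral_mono)
    fix \<omega> :: "'d config"
    have "1 \<le> exp_weight 0 0 (\<omega> k)" by (simp add: exp_weight_def one_le_ennreal_exp)
    from mult_right_mono[OF this, of "weight \<Lambda> \<xi> \<omega>"]
    show "weight \<Lambda> \<xi> \<omega> \<le> exp_weight 0 0 (\<omega> k) * weight \<Lambda> \<xi> \<omega>"
      by simp
  qed
  also have "\<dots> < \<infinity>" by (rule weighted_integral_finite) (use \<Lambda> k in auto)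
  finally show "Z \<Lambda> \<xi> < \<infinity>" .
qed

lemma gibbs_nn_integral:
  assumes "finite \<Lambda>" "f \<in> borel_measurable (loop_product \<Lambda>)"
  shows "(\<integral>\<^sup>+\<omega>. f \<omega> \<partial>gibbs \<Lambda> \<xi>) =
    (\<integral>\<^sup>+\<omega>. f \<omega> * weight \<Lambda> \<xi> \<omega> \<partial>loop_product \<Lambda>) / Z \<Lambda> \<xi>"
proof -
  note [measurable] = weight_measurable[OF assms(1)] assms(2)
  have "(\<integral>\<^sup>+\<omega>. f \<omega> \<partial>gibbs \<Lambda> \<xi>) = (\<integral>\<^sup>+\<omega>. f \<omega> * weight \<Lambda> \<xi> \<omega> / Z \<Lambda> \<xi> \<partial>loop_product \<Lambda>)"
    unfolding gibbs_def by (subst nn_integral_density) (auto simp: divide_ennreal_def mult_ac)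
  also have "\<dots> = (\<integral>\<^sup>+\<omega>. f \<omega> * weight \<Lambda> \<xi> \<omega> \<partial>loop_product \<Lambda>) / Z \<Lambda> \<xi>"
    by (rule nn_integral_divide) measurable
  finally show ?thesis .
qed

lemma gibbs_prob:
  fixes \<xi> :: "'d::finite config"
  assumes "finite \<Lambda>" "\<Lambda> \<noteq> {}"
  shows "prob_space (gibbs \<Lambda> \<xi>)"
proof
  have "emeasure (gibbs \<Lambda> \<xi>) (space (gibbs \<Lambda> \<xi>)) = (\<integral>\<^sup>+\<omega>. 1 \<partial>gibbs \<Lambda> \<xi>)" by simp
  also have "\<dots> = Z \<Lambda> \<xi> / Z \<Lambda> \<xi>"
    by (subst gibbs_nn_integral[OF assms(1)]) (simp_all add: partition_function_def)
  also have "\<dots> = 1" using partition_function_bounds[OF assms, of \<xi>] by (intro ennreal_divide_self) auto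
  finally show "emeasure (gibbs \<Lambda> \<xi>) (space (gibbs \<Lambda> \<xi>)) = 1" .
qed

lemma sets_gibbs: "measurable (gibbs \<Lambda> \<xi>) = measurable (loop_product \<Lambda>)"
  unfolding gibbs_def by (intro ext measurable_cong_sets) auto

lemma component_gibbs: "k \<in> \<Lambda> \<Longrightarrow> (\<lambda>\<omega>. \<omega> k) \<in> measurable (gibbs \<Lambda> \<xi>) \<gamma>"
  unfolding sets_gibbs by (rule measurable_component_singleton)

text \<open>The weight is at least 1, so its mean has a nonnegative logarithm. That this is a real
  number is what later allows a fraction of the maximum to be subtracted from both sides.\<close>

lemma log_moment_exists:
  fixes \<xi> :: "'d::finite config"
  assumes "0 \<le> \<alpha>" "\<alpha> < 1 / 2" "\<kappa> \<ge> 0" "finite \<Lambda>" "k \<in> \<Lambda>"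
  obtains n where "n \<ge> 0" "weight_moment \<alpha> \<kappa> \<Lambda> \<xi> k = ennreal (exp n)"
proof -
  have ne: "\<Lambda> \<noteq> {}" using assms(5) by blast
  interpret G: prob_space "gibbs \<Lambda> \<xi>" by (rule gibbs_prob[OF assms(4) ne])
  define N where "N = weight_moment \<alpha> \<kappa> \<Lambda> \<xi> k"
  have "N = (\<integral>\<^sup>+\<omega>. exp_weight \<alpha> \<kappa> (\<omega> k) * weight \<Lambda> \<xi> \<omega> \<partial>loop_product \<Lambda>) / Z \<Lambda> \<xi>"
    unfolding N_def using assms
    by (intro gibbs_nn_integral measurable_compose[OF measurable_component_singleton[of k \<Lambda> "\<lambda>_. \<gamma>"] exp_weight_\<gamma>])
  then have "N < \<infinity>"
    using weighted_integral_finite[OF assms, of \<xi>] partition_function_bounds[OF assms(4) ne, of \<xi>]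
    by (auto simp: divide_ennreal_def ennreal_mult_eq_top_iff ennreal_inverse_eq_top_iff less_top[symmetric])
  then obtain r where r: "r \<ge> 0" "N = ennreal r" by (cases N) auto
  have "1 \<le> exp_weight \<alpha> \<kappa> \<eta>" for \<eta>
  proof -
    have "1 \<le> ennreal (exp (\<kappa> * L2_sq \<beta> \<eta>))" using assms(3) by (simp add: L2_sq_nonneg)
    then show ?thesis
      unfolding exp_weight_def using mult_mono[OF _ one_le_ennreal_exp, of 1] by fastforce
  qed
  then have "(\<integral>\<^sup>+\<omega>. 1 \<partial>gibbs \<Lambda> \<xi>) \<le> N" unfolding N_def by (intro nn_integral_mono)
  then have "1 \<le> r" using r by (simp add: G.emeasure_space_1)
  then show ?thesis using r by (intro that[of "ln r"]) (simp_all add: N_def)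
qed

text \<open>
  This is Hoelder's inequality: each factor is normalised to have integral at most one, and then
  \<open>exp_sum_le\<close> replaces the product by a convex combination.
\<close>

lemma exp_L2_sum_integral:
  fixes \<xi> :: "'d::finite config"
  assumes \<Lambda>: "finite \<Lambda>" "\<Lambda> \<noteq> {}" and S: "S \<subseteq> \<Lambda>" and \<kappa>: "\<kappa> > 0" and \<theta>: "\<theta> \<ge> 0" "real (card S) * \<theta> \<le> 1"
    and n: "\<And>l. l \<in> S \<Longrightarrow> weight_moment \<alpha> \<kappa> \<Lambda> \<xi> l = ennreal (exp (n l))"
  shows "(\<integral>\<^sup>+\<omega>. ennreal (exp (\<Sum>l\<in>S. \<theta> * (\<kappa> * L2_sq \<beta> (\<omega> l)))) \<partial>gibbs \<Lambda> \<xi>) \<le> ennreal (exp (\<Sum>l\<in>S. \<theta> * n l))"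
proof -
  interpret G: prob_space "gibbs \<Lambda> \<xi>" by (rule gibbs_prob[OF \<Lambda>])
  have fS: "finite S" using S \<Lambda>(1) by (rule finite_subset)
  have [measurable]: "(\<lambda>\<omega>. L2_sq \<beta> (\<omega> l)) \<in> borel_measurable (gibbs \<Lambda> \<xi>)" if "l \<in> S" for l
    using measurable_compose[OF component_gibbs L2_sq_\<gamma>, of l \<Lambda> \<xi>] that S by blast
  have one: "(\<integral>\<^sup>+\<omega>. ennreal (exp (\<kappa> * L2_sq \<beta> (\<omega> l) - n l)) \<partial>gibbs \<Lambda> \<xi>) \<le> 1" if l: "l \<in> S" for l
  proof -
    have "ennreal (exp (\<kappa> * L2_sq \<beta> \<eta> - n l)) \<le> ennreal (exp (- n l)) * exp_weight \<alpha> \<kappa> \<eta>" for \<eta>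
      using mult_left_mono[OF one_le_ennreal_exp[of "holder_norm \<beta> \<alpha> \<eta>"], of "ennreal (exp (\<kappa> * L2_sq \<beta> \<eta> - n l))"]
      by (simp add: exp_weight_def exp_diff exp_minus divide_inverse ennreal_mult mult_ac)
    then have "(\<integral>\<^sup>+\<omega>. ennreal (exp (\<kappa> * L2_sq \<beta> (\<omega> l) - n l)) \<partial>gibbs \<Lambda> \<xi>)
        \<le> (\<integral>\<^sup>+\<omega>. ennreal (exp (- n l)) * exp_weight \<alpha> \<kappa> (\<omega> l) \<partial>gibbs \<Lambda> \<xi>)"
      by (intro nn_integral_mono)
    also have "\<dots> = ennreal (exp (- n l)) * ennreal (exp (n l))"
      unfolding n[OF l, symmetric] using l S
      by (intro nn_integral_cmult measurable_compose[OF component_gibbs exp_weight_\<gamma>]) auto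
    also have "\<dots> = 1" by (simp add: ennreal_mult[symmetric] exp_add[symmetric])
    finally show ?thesis .
  qed
  define s where "s = (\<Sum>l\<in>S. \<theta> * n l)"
  have "(\<integral>\<^sup>+\<omega>. ennreal (exp (\<Sum>l\<in>S. \<theta> * (\<kappa> * L2_sq \<beta> (\<omega> l)))) \<partial>gibbs \<Lambda> \<xi>)
      \<le> (\<integral>\<^sup>+\<omega>. ennreal (exp s) * (ennreal (1 - real (card S) * \<theta>) + (\<Sum>l\<in>S. ennreal \<theta> * ennreal (exp (\<kappa> * L2_sq \<beta> (\<omega> l) - n l)))) \<partial>gibbs \<Lambda> \<xi>)"
  proof (rule nn_integral_mono)
    fix \<omega>
    have "(\<Sum>l\<in>S. \<theta> * (\<kappa> * L2_sq \<beta> (\<omega> l))) = s + (\<Sum>l\<in>S. \<theta> * (\<kappa> * L2_sq \<beta> (\<omega> l) - n l))"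
      by (simp add: s_def sum.distrib[symmetric] algebra_simps)
    then have "exp (\<Sum>l\<in>S. \<theta> * (\<kappa> * L2_sq \<beta> (\<omega> l))) = exp s * exp (\<Sum>l\<in>S. \<theta> * (\<kappa> * L2_sq \<beta> (\<omega> l) - n l))"
      by (simp add: exp_add)
    also have "\<dots> \<le> exp s * (1 - real (card S) * \<theta> + (\<Sum>l\<in>S. \<theta> * exp (\<kappa> * L2_sq \<beta> (\<omega> l) - n l)))"
      by (intro mult_left_mono exp_sum_le fS \<theta>) auto
    finally have "ennreal (exp (\<Sum>l\<in>S. \<theta> * (\<kappa> * L2_sq \<beta> (\<omega> l))))
        \<le> ennreal (exp s * (1 - real (card S) * \<theta> + (\<Sum>l\<in>S. \<theta> * exp (\<kappa> * L2_sq \<beta> (\<omega> l) - n l))))"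
      by (rule ennreal_leI)
    also have "\<dots> = ennreal (exp s) * (ennreal (1 - real (card S) * \<theta>) + (\<Sum>l\<in>S. ennreal \<theta> * ennreal (exp (\<kappa> * L2_sq \<beta> (\<omega> l) - n l))))"
      using \<theta> by (subst ennreal_mult) (auto simp: ennreal_plus sum_nonneg ennreal_mult[symmetric] intro!: add_nonneg_nonneg)
    finally show "ennreal (exp (\<Sum>l\<in>S. \<theta> * (\<kappa> * L2_sq \<beta> (\<omega> l))))
        \<le> ennreal (exp s) * (ennreal (1 - real (card S) * \<theta>) + (\<Sum>l\<in>S. ennreal \<theta> * ennreal (exp (\<kappa> * L2_sq \<beta> (\<omega> l) - n l))))" .
  qed
  also have "\<dots> = ennreal (exp s) * (ennreal (1 - real (card S) * \<theta>)
      + (\<Sum>l\<in>S. ennreal \<theta> * (\<integral>\<^sup>+\<omega>. ennreal (exp (\<kappa> * L2_sq \<beta> (\<omega> l) - n l)) \<partial>gibbs \<Lambda> \<xi>)))"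
    by (subst nn_integral_cmult, measurable, subst nn_integral_add, measurable, subst nn_integral_sum, measurable)
      (simp add: nn_integral_cmult G.emeasure_space_1)
  also have "\<dots> \<le> ennreal (exp s) * (ennreal (1 - real (card S) * \<theta>) + (\<Sum>l\<in>S. ennreal \<theta> * 1))"
    by (intro mult_left_mono add_left_mono sum_mono one) auto
  also have "\<dots> = ennreal (exp s)"
  proof -
    have "(\<Sum>l\<in>S. ennreal \<theta> * 1) = ennreal (real (card S) * \<theta>)"
      using \<theta>(1) by (simp add: ennreal_mult[symmetric] ennreal_of_nat_eq_real_of_nat)
    then show ?thesis using \<theta> by (simp add: ennreal_plus[symmetric] del: ennreal_plus)
  qed
  finally show ?thesis by (simp add: s_def)
qed

text \<open>Since \<Lambda> is finite, the weighted logarithms \<open>w\<close> attain their maximum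
  \<open>A\<close> at some site. There the recursion reads \<open>A \<le> K + A / 2\<close>, where
  \<open>K\<close> gathers the one-site constant and the boundary terms, so \<open>A\<close> is at
  most \<open>2 * K\<close> whatever \<Lambda> is.\<close>

lemma uniform_log_moment:
  fixes \<xi> :: "'d::finite config"
  assumes \<alpha>: "0 \<le> \<alpha>" "\<alpha> < 1 / 2" and \<epsilon>: "\<epsilon> \<ge> 0"
    and S: "\<And>l. exp (- \<epsilon> * lat_norm l) * L2_sq \<beta> (\<xi> l) \<le> S"
  obtains M where "M \<ge> 0" "\<And>\<Lambda> k. finite \<Lambda> \<Longrightarrow> k \<in> \<Lambda> \<Longrightarrow>
    exp_moment \<alpha> \<Lambda> \<xi> k \<le> ennreal (exp (M * exp (\<epsilon> * lat_norm k)))"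
proof -
  define D where "D = real (degree TYPE('d))"
  \<comment> \<open>Makes \<open>(D + 1) * exp \<epsilon> * \<theta>\<close> equal to 1/2. A site
    has \<open>D\<close> neighbours, and the weight may grow by \<open>exp \<epsilon>\<close> from a
    site to its neighbour; \<open>D + 1\<close> instead of \<open>D\<close> keeps \<kappa> positive
    without evaluating the degree.\<close>
  define \<kappa> where "\<kappa> = 4 * J * (D + 1) * exp \<epsilon>"
  define \<theta> where "\<theta> = 2 * J / \<kappa>"
  have D0: "D \<ge> 0" by (simp add: D_def)
  have \<kappa>0: "\<kappa> > 0" using J D0 by (simp add: \<kappa>_def)
  have \<theta>0: "\<theta> \<ge> 0" using J \<kappa>0 by (simp add: \<theta>_def)
  have \<theta>\<kappa>: "\<theta> * \<kappa> = 2 * J" using \<kappa>0 by (simp add: \<theta>_def)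
  have "J * ((D + 1) * exp \<epsilon> * \<theta>) = J * (1 / 2)" using \<theta>\<kappa> by (simp add: \<kappa>_def algebra_simps)
  then have "(D + 1) * exp \<epsilon> * \<theta> = 1 / 2" using J by (simp only: mult_left_cancel)
  moreover have "D * (exp \<epsilon> * \<theta>) \<le> (D + 1) * (exp \<epsilon> * \<theta>)" using \<theta>0 by (intro mult_right_mono) auto
  ultimately have half: "D * exp \<epsilon> * \<theta> \<le> 1 / 2" unfolding mult.assoc by linarith
  have "D * \<theta> * 1 \<le> D * \<theta> * exp \<epsilon>" using D0 \<theta>0 \<epsilon> by (intro mult_left_mono) auto
  then have D\<theta>: "D * \<theta> \<le> 1" using half by (simp add: mult_ac)
  have S0: "S \<ge> 0" using S[of 0] L2_sq_nonneg[of \<beta> "\<xi> 0"] by simp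
  obtain C where C0: "C \<ge> 0" and C: "\<And>(k :: int ^ 'd) y.
    site_moment \<alpha> \<kappa> k y \<le> ennreal (exp (C + 2 * J * neighbour_L2 k y)) * site_partition k y"
    by (rule site_estimate[OF \<alpha>, of \<kappa>]) (use \<kappa>0 in auto)
  define K where "K = C + 2 * J * (D * (S * exp \<epsilon>))"
  have K0: "K \<ge> 0" unfolding K_def using C0 J D0 S0 by simp
  show ?thesis
  proof (rule that[of "2 * K"])
    show "2 * K \<ge> 0" using K0 by simp
    fix \<Lambda> :: "(int ^ 'd) set" and k assume \<Lambda>: "finite \<Lambda>" and k: "k \<in> \<Lambda>"
    then have ne: "\<Lambda> \<noteq> {}" by blast
    have "\<exists>n. l \<in> \<Lambda> \<longrightarrow> n \<ge> 0 \<and> weight_moment \<alpha> \<kappa> \<Lambda> \<xi> l = ennreal (exp n)" for l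
    proof (cases "l \<in> \<Lambda>")
      case True
      show ?thesis by (rule log_moment_exists[OF \<alpha> less_imp_le[OF \<kappa>0] \<Lambda> True, of \<xi>]) blast
    qed blast
    then obtain n where n: "\<And>l. l \<in> \<Lambda> \<Longrightarrow> n l \<ge> 0"
      "\<And>l. l \<in> \<Lambda> \<Longrightarrow> weight_moment \<alpha> \<kappa> \<Lambda> \<xi> l = ennreal (exp (n l))"
      by metis
    have rec: "n l \<le> C + 2 * J * (\<Sum>l' | adjacent l l' \<and> l' \<notin> \<Lambda>. L2_sq \<beta> (\<xi> l')) + (\<Sum>l' | adjacent l l' \<and> l' \<in> \<Lambda>. \<theta> * n l')"
      if l: "l \<in> \<Lambda>" for l
    proof -
      define A where "A = {l'. adjacent l l' \<and> l' \<in> \<Lambda>}"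
      define B where "B = {l'. adjacent l l' \<and> l' \<notin> \<Lambda>}"
      define r where "r = C + 2 * J * (\<Sum>l'\<in>B. L2_sq \<beta> (\<xi> l'))"
      have fin: "finite A" "finite B"
        unfolding A_def B_def by (auto intro: finite_subset[OF _ finite_neighbours[of l]])
      have "card A \<le> card {l'. adjacent l l'}" unfolding A_def by (intro card_mono) auto
      then have "real (card A) \<le> D" by (simp add: card_neighbours D_def)
      \<comment> \<open>The condition for Hoelder's inequality: the exponents of the neighbours
        inside \<Lambda> add up to at most 1.\<close>
      then have cA: "real (card A) * \<theta> \<le> 1" using D\<theta> \<theta>0 mult_right_mono[of "real (card A)" D \<theta>] by linarith
      have glue: "C + 2 * J * neighbour_L2 l (glue \<Lambda> \<xi> \<omega>) = r + (\<Sum>l'\<in>A. \<theta> * (\<kappa> * L2_sq \<beta> (\<omega> l')))" for \<omega>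
      proof -
        have "neighbour_L2 l (glue \<Lambda> \<xi> \<omega>) = (\<Sum>l'\<in>A \<union> B. L2_sq \<beta> (glue \<Lambda> \<xi> \<omega> l'))"
          by (intro sum.cong) (auto simp: A_def B_def)
        also have "\<dots> = (\<Sum>l'\<in>A. L2_sq \<beta> (glue \<Lambda> \<xi> \<omega> l')) + (\<Sum>l'\<in>B. L2_sq \<beta> (glue \<Lambda> \<xi> \<omega> l'))"
          using fin by (intro sum.union_disjoint) (auto simp: A_def B_def)
        also have "\<dots> = (\<Sum>l'\<in>A. L2_sq \<beta> (\<omega> l')) + (\<Sum>l'\<in>B. L2_sq \<beta> (\<xi> l'))"
          by (intro arg_cong2[where f = "(+)"] sum.cong) (auto simp: glue_def A_def B_def)
        finally show ?thesis
          by (simp add: r_def mult.assoc[symmetric] \<theta>\<kappa> sum_distrib_left[symmetric] distrib_left)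
      qed
      have "ennreal (exp (n l)) \<le> (\<integral>\<^sup>+\<omega>. ennreal (exp (C + 2 * J * neighbour_L2 l (glue \<Lambda> \<xi> \<omega>))) \<partial>gibbs \<Lambda> \<xi>)"
      proof -
        have [measurable]: "(\<lambda>\<omega>. L2_sq \<beta> (glue \<Lambda> \<xi> \<omega> l)) \<in> borel_measurable (loop_product \<Lambda>)" for l
          by (rule glue_L2_sq_measurable)
        have 1: "(\<lambda>\<omega>. exp_weight \<alpha> \<kappa> (\<omega> l)) \<in> borel_measurable (loop_product \<Lambda>)"
          by (rule measurable_compose[OF measurable_component_singleton[of l \<Lambda> "\<lambda>_. \<gamma>", OF l] exp_weight_\<gamma>])
        have 2: "(\<lambda>\<omega>. ennreal (exp (C + 2 * J * neighbour_L2 l (glue \<Lambda> \<xi> \<omega>)))) \<in> borel_measurable (loop_product \<Lambda>)"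
          by measurable
        show ?thesis
          unfolding n(2)[OF l, symmetric] gibbs_nn_integral[OF \<Lambda> 1] gibbs_nn_integral[OF \<Lambda> 2]
          by (intro divide_right_mono_ennreal product_estimate[OF C \<Lambda> l])
      qed
      also have "\<dots> = (\<integral>\<^sup>+\<omega>. ennreal (exp r) * ennreal (exp (\<Sum>l'\<in>A. \<theta> * (\<kappa> * L2_sq \<beta> (\<omega> l')))) \<partial>gibbs \<Lambda> \<xi>)"
        unfolding glue exp_add by (simp add: ennreal_mult)
      also have "\<dots> = ennreal (exp r) * (\<integral>\<^sup>+\<omega>. ennreal (exp (\<Sum>l'\<in>A. \<theta> * (\<kappa> * L2_sq \<beta> (\<omega> l')))) \<partial>gibbs \<Lambda> \<xi>)"
      proof (rule nn_integral_cmult)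
        have [measurable]: "(\<lambda>\<omega>. L2_sq \<beta> (\<omega> l')) \<in> borel_measurable (gibbs \<Lambda> \<xi>)" if "l' \<in> A" for l'
          using measurable_compose[OF component_gibbs L2_sq_\<gamma>, of l' \<Lambda> \<xi>] that by (simp add: A_def)
        show "(\<lambda>\<omega>. ennreal (exp (\<Sum>l'\<in>A. \<theta> * (\<kappa> * L2_sq \<beta> (\<omega> l'))))) \<in> borel_measurable (gibbs \<Lambda> \<xi>)"
          by measurable
      qed
      also have "\<dots> \<le> ennreal (exp r) * ennreal (exp (\<Sum>l'\<in>A. \<theta> * n l'))"
        by (intro mult_left_mono exp_L2_sum_integral[OF \<Lambda> ne _ \<kappa>0 \<theta>0 cA n(2)]) (auto simp: A_def)
      finally have "ennreal (exp (n l)) \<le> ennreal (exp (r + (\<Sum>l'\<in>A. \<theta> * n l')))"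
        by (simp add: ennreal_mult[symmetric] exp_add)
      then have "n l \<le> r + (\<Sum>l'\<in>A. \<theta> * n l')" by simp
      then show ?thesis by (simp add: r_def A_def B_def)
    qed
    define w where "w l = exp (- \<epsilon> * lat_norm l) * n l" for l
    define A where "A = Max (w ` \<Lambda>)"
    have wA: "w l \<le> A" if "l \<in> \<Lambda>" for l unfolding A_def using that \<Lambda> by simp
    have "A \<in> w ` \<Lambda>" unfolding A_def using \<Lambda> ne by (intro Max_in) auto
    then obtain l where l: "l \<in> \<Lambda>" "A = w l" by blast
    have A0: "A \<ge> 0" using l n(1) by (simp add: w_def)
    have unweight: "x \<le> y * exp (\<epsilon> * lat_norm l')" if "exp (- \<epsilon> * lat_norm l') * x \<le> y" for x y :: real and l' :: "int ^ 'd"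
      using that by (simp add: exp_minus field_simps)
    have nb: "exp (\<epsilon> * lat_norm l') \<le> exp \<epsilon> * exp (\<epsilon> * lat_norm l)" if "adjacent l l'" for l'
    proof -
      have "\<epsilon> * lat_norm l' \<le> \<epsilon> * (lat_norm l + 1)" using lat_norm_adjacent[OF that] \<epsilon> by (intro mult_left_mono) auto
      then show ?thesis by (simp add: exp_add[symmetric] algebra_simps)
    qed
    define E where "E = exp (\<epsilon> * lat_norm l)"
    have sum_le: "(\<Sum>l'\<in>X. f l') \<le> D * (y * (exp \<epsilon> * E))"
      if X: "X \<subseteq> {l'. adjacent l l'}" and f: "\<And>l'. l' \<in> X \<Longrightarrow> f l' \<le> y * exp (\<epsilon> * lat_norm l')" and y: "y \<ge> 0" for X f y
    proof -
      have "(\<Sum>l'\<in>X. f l') \<le> (\<Sum>l'\<in>X. y * (exp \<epsilon> * E))"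
      proof (rule sum_mono)
        fix l' assume "l' \<in> X"
        then show "f l' \<le> y * (exp \<epsilon> * E)"
          using f[of l'] mult_left_mono[OF nb[of l'] y] X by (force simp: E_def)
      qed
      also have "\<dots> = real (card X) * (y * (exp \<epsilon> * E))" by simp
      also have "\<dots> \<le> D * (y * (exp \<epsilon> * E))"
      proof (rule mult_right_mono)
        have "card X \<le> card {l'. adjacent l l'}" by (intro card_mono X) auto
        then show "real (card X) \<le> D" by (simp add: card_neighbours D_def)
      qed (use y in \<open>simp add: E_def\<close>)
      finally show ?thesis .
    qed
    have b1: "(\<Sum>l' | adjacent l l' \<and> l' \<notin> \<Lambda>. L2_sq \<beta> (\<xi> l')) \<le> D * (S * (exp \<epsilon> * E))"
      by (rule sum_le) (auto intro: unweight S S0)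
    have b2: "(\<Sum>l' | adjacent l l' \<and> l' \<in> \<Lambda>. n l') \<le> D * (A * (exp \<epsilon> * E))"
      by (rule sum_le) (auto intro: unweight wA[unfolded w_def] A0)
    have E1: "E \<ge> 1" using \<epsilon> by (simp add: E_def lat_norm_nonneg)
    have "n l \<le> C + 2 * J * (\<Sum>l' | adjacent l l' \<and> l' \<notin> \<Lambda>. L2_sq \<beta> (\<xi> l')) + \<theta> * (\<Sum>l' | adjacent l l' \<and> l' \<in> \<Lambda>. n l')"
      using rec[OF l(1)] by (simp add: sum_distrib_left)
    also have "\<dots> \<le> C * E + 2 * J * (D * (S * (exp \<epsilon> * E))) + \<theta> * (D * (A * (exp \<epsilon> * E)))"
      using J \<theta>0 C0 E1 mult_left_mono[of 1 E C] by (intro add_mono mult_left_mono b1 b2) auto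
    also have "\<dots> = (K + (D * exp \<epsilon> * \<theta>) * A) * E" by (simp add: K_def algebra_simps)
    also have "\<dots> \<le> (K + 1 / 2 * A) * E"
      using half A0 E1 by (intro mult_right_mono add_left_mono) auto
    finally have "n l \<le> (K + A / 2) * E" by simp
    moreover have "n l = A * E" unfolding l(2) w_def E_def by (simp add: exp_minus)
    ultimately have "A \<le> K + A / 2" using E1 by simp
    then have "A \<le> 2 * K" by simp
    then have "n k \<le> 2 * K * exp (\<epsilon> * lat_norm k)"
      using wA[OF k] by (intro unweight) (simp add: w_def)
    \<comment> \<open>The factor with the squared norm has served the recursion; being at least 1 it
      can now be discarded.\<close>
    have "exp_moment \<alpha> \<Lambda> \<xi> k \<le> weight_moment \<alpha> \<kappa> \<Lambda> \<xi> k"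
    proof (rule nn_integral_mono)
      fix \<omega> :: "'d config"
      have "1 \<le> ennreal (exp (\<kappa> * L2_sq \<beta> (\<omega> k)))" using \<kappa>0 by (simp add: L2_sq_nonneg)
      from mult_right_mono[OF this, of "ennreal_exp (holder_norm \<beta> \<alpha> (\<omega> k))"]
      show "ennreal_exp (holder_norm \<beta> \<alpha> (\<omega> k)) \<le> exp_weight \<alpha> \<kappa> (\<omega> k)" by (simp add: exp_weight_def)
    qed
    also have "\<dots> \<le> ennreal (exp (2 * K * exp (\<epsilon> * lat_norm k)))"
      unfolding n(2)[OF k] using \<open>n k \<le> 2 * K * exp (\<epsilon> * lat_norm k)\<close> by (intro ennreal_leI) simp
    finally show "exp_moment \<alpha> \<Lambda> \<xi> k \<le> ennreal (exp (2 * K * exp (\<epsilon> * lat_norm k)))" .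
  qed
qed

section \<open>From exponential moments to the two claims\<close>

lemma moment_le_log_moment:
  fixes \<xi> :: "'d::finite config"
  assumes "finite \<Lambda>" "k \<in> \<Lambda>" "n \<ge> 0" "Q \<ge> 0"
    and n: "exp_moment \<alpha> \<Lambda> \<xi> k \<le> ennreal (exp n)"
  shows "(\<integral>\<^sup>+\<omega>. ennreal_powr (holder_norm \<beta> \<alpha> (\<omega> k)) Q \<partial>gibbs \<Lambda> \<xi>) \<le> ennreal ((2 * n) powr Q + moment_const Q)"
proof -
  have ne: "\<Lambda> \<noteq> {}" using assms(2) by blast
  interpret G: prob_space "gibbs \<Lambda> \<xi>" by (rule gibbs_prob[OF assms(1) ne])
  have c0: "moment_const Q \<ge> 0" by (simp add: moment_const_def)
  have [measurable]: "(\<lambda>\<omega>. ennreal_exp (holder_norm \<beta> \<alpha> (\<omega> k))) \<in> borel_measurable (gibbs \<Lambda> \<xi>)"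
    by (rule measurable_compose[OF component_gibbs[OF assms(2)]]) measurable
  have "(\<integral>\<^sup>+\<omega>. ennreal_powr (holder_norm \<beta> \<alpha> (\<omega> k)) Q \<partial>gibbs \<Lambda> \<xi>)
      \<le> (\<integral>\<^sup>+\<omega>. ennreal ((2 * n) powr Q) + ennreal (moment_const Q * exp (- n)) * ennreal_exp (holder_norm \<beta> \<alpha> (\<omega> k)) \<partial>gibbs \<Lambda> \<xi>)"
    by (intro nn_integral_mono ennreal_powr_le_exp assms)
  also have "\<dots> = ennreal ((2 * n) powr Q) + ennreal (moment_const Q * exp (- n)) * exp_moment \<alpha> \<Lambda> \<xi> k"
    by (subst nn_integral_add, measurable, subst nn_integral_cmult, measurable) (simp add: G.emeasure_space_1)
  also have "\<dots> \<le> ennreal ((2 * n) powr Q) + ennreal (moment_const Q * exp (- n)) * ennreal (exp n)"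
    by (intro add_left_mono mult_left_mono n) auto
  also have "\<dots> = ennreal ((2 * n) powr Q + moment_const Q)"
    using c0 by (simp add: ennreal_mult[symmetric] mult.assoc exp_add[symmetric])
  finally show ?thesis .
qed

text \<open>The image measure can be integrated by substitution once
  \<open>glue \<Lambda> \<xi>\<close> is known to be measurable into the Borel sets of the product
  topology. Sites in \<Lambda> contribute coordinates of the product measure, all others the
  constant loops of \<xi>.\<close>

lemma local_spec_nn_integral:
  fixes \<xi> :: "'d::finite config"
  assumes \<xi>: "\<xi> \<in> configs \<beta>" and f: "f \<in> borel_measurable borel"
  shows "(\<integral>\<^sup>+\<omega>. f (\<omega> k) \<partial>local_spec \<beta> V J \<gamma> \<Lambda> \<xi>) = (\<integral>\<^sup>+\<omega>. f (glue \<Lambda> \<xi> \<omega> k) \<partial>gibbs \<Lambda> \<xi>)"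
proof -
  have "(\<lambda>\<omega>. glue \<Lambda> \<xi> \<omega> l) \<in> measurable (gibbs \<Lambda> \<xi>) (restrict_space borel (loops \<beta>))" for l
  proof (cases "l \<in> \<Lambda>")
    case True
    then show ?thesis
      using component_gibbs[OF True, of \<xi>] measurable_cong_sets[OF refl sets_\<gamma>, of "gibbs \<Lambda> \<xi>"]
      by (simp add: glue_def)
  next
    case False
    then show ?thesis using \<xi> by (auto simp: glue_def configs_def space_restrict_space)
  qed
  then have g: "glue \<Lambda> \<xi> \<in> measurable (gibbs \<Lambda> \<xi>) (config_borel \<beta>)"
    by (rule measurable_config_borel[OF \<beta>])
  have "(\<lambda>\<omega>::'d config. \<omega> k) \<in> borel_measurable borel"
    by (intro borel_measurable_continuous_onI continuous_on_product_coordinates)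
  then have "(\<lambda>\<omega>::'d config. f (\<omega> k)) \<in> borel_measurable (config_borel \<beta>)"
    unfolding config_borel_def by (intro measurable_restrict_space1 measurable_compose[OF _ f])
  then show ?thesis
    unfolding local_spec_def gibbs_def[symmetric] by (subst nn_integral_distr[OF g]) auto
qed

lemma local_spec_moment_inside:
  fixes \<xi> :: "'d::finite config"
  assumes "\<xi> \<in> configs \<beta>" "finite \<Lambda>" "k \<in> \<Lambda>" "n \<ge> 0" "Q \<ge> 0"
    and "exp_moment \<alpha> \<Lambda> \<xi> k \<le> ennreal (exp n)"
  shows "moment \<alpha> Q \<Lambda> \<xi> k
    \<le> ennreal ((2 * n) powr Q + moment_const Q)"
proof -
  have "(\<lambda>u. ennreal_powr (holder_norm \<beta> \<alpha> u) Q) \<in> borel_measurable borel" by measurable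
  from local_spec_nn_integral[OF assms(1) this, where k = k and \<Lambda> = \<Lambda>] moment_le_log_moment[OF assms(2-6)]
  show ?thesis using assms(3) by (simp add: glue_def)
qed

lemma moment_sup_finite:
  fixes \<xi> :: "'d::finite config"
  assumes \<xi>: "\<xi> \<in> configs \<beta>" and \<alpha>: "0 \<le> \<alpha>" "\<alpha> < 1 / 2" and Q: "Q \<ge> 1"
    and bd: "(SUP k. holder_norm \<beta> \<alpha> (\<xi> k)) < \<infinity>"
  shows "(SUP \<Lambda>\<in>{\<Lambda>. finite \<Lambda> \<and> \<Lambda> \<noteq> {}}. SUP k.
    moment \<alpha> Q \<Lambda> \<xi> k) < \<infinity>"
proof -
  obtain B where B: "B \<ge> 0" "(SUP k. holder_norm \<beta> \<alpha> (\<xi> k)) = ennreal B"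
    using bd by (cases "SUP k. holder_norm \<beta> \<alpha> (\<xi> k)") auto
  have hB: "holder_norm \<beta> \<alpha> (\<xi> k) \<le> ennreal B" for k
    unfolding B(2)[symmetric] by (rule SUP_upper) simp
  have pB: "\<bar>\<xi> k \<tau>\<bar> \<le> B" for k \<tau>
  proof -
    define t where "t = \<tau> - of_int \<lfloor>\<tau> / \<beta>\<rfloor> * \<beta>"
    have "t \<in> circle \<beta>" unfolding t_def circle_def by (rule reduced_in_circle[OF \<beta>])
    then have "ennreal \<bar>\<xi> k t\<bar> \<le> (SUP \<tau>\<in>circle \<beta>. ennreal \<bar>\<xi> k \<tau>\<bar>)" by (rule SUP_upper)
    also have "\<dots> \<le> holder_norm \<beta> \<alpha> (\<xi> k)" unfolding holder_norm_def by (rule add_increasing2) auto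
    also have "\<dots> \<le> ennreal B" by (rule hB)
    finally have "\<bar>\<xi> k t\<bar> \<le> B" using B(1) by simp
    moreover have "\<xi> k \<tau> = \<xi> k t" unfolding t_def
      by (rule loop_reduce[OF \<beta>]) (use \<xi> in \<open>simp add: configs_def\<close>)
    ultimately show ?thesis by simp
  qed
  \<comment> \<open>The case of exponent 0: a bounded boundary condition needs no spatial weight,
    and the resulting bound does not depend on the site.\<close>
  have S: "exp (- 0 * lat_norm l) * L2_sq \<beta> (\<xi> l) \<le> \<beta> * B\<^sup>2" for l
    using L2_sq_le[OF \<beta> pB, of l] by simp
  obtain M where M: "M \<ge> 0" "\<And>\<Lambda> k. finite \<Lambda> \<Longrightarrow> k \<in> \<Lambda> \<Longrightarrow>
    exp_moment \<alpha> \<Lambda> \<xi> k \<le> ennreal (exp (M * exp (0 * lat_norm k)))"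
    using uniform_log_moment[OF \<alpha> order_refl S] by blast
  have "moment \<alpha> Q \<Lambda> \<xi> k
      \<le> ennreal ((2 * M) powr Q + moment_const Q + B powr Q)" if \<Lambda>: "finite \<Lambda>" "\<Lambda> \<noteq> {}" for \<Lambda> k
  proof (cases "k \<in> \<Lambda>")
    case True
    have "moment \<alpha> Q \<Lambda> \<xi> k \<le> ennreal ((2 * M) powr Q + moment_const Q)"
      by (rule local_spec_moment_inside[OF \<xi> \<Lambda>(1) True M(1)]) (use M(2)[OF \<Lambda>(1) True] Q in auto)
    also have "\<dots> \<le> ennreal ((2 * M) powr Q + moment_const Q + B powr Q)" by (intro ennreal_leI) simp
    finally show ?thesis .
  next
    \<comment> \<open>The inner supremum runs over all sites; outside \<Lambda> the configuration is
      frozen to \<xi>, and the integral is that of a constant.\<close>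
    case False
    interpret G: prob_space "gibbs \<Lambda> \<xi>" by (rule gibbs_prob[OF \<Lambda>])
    have "(\<lambda>u. ennreal_powr (holder_norm \<beta> \<alpha> u) Q) \<in> borel_measurable borel" by measurable
    from local_spec_nn_integral[OF \<xi> this, where k = k and \<Lambda> = \<Lambda>]
    have "moment \<alpha> Q \<Lambda> \<xi> k = ennreal_powr (holder_norm \<beta> \<alpha> (\<xi> k)) Q"
      using False by (simp add: glue_def G.emeasure_space_1)
    also have "\<dots> \<le> ennreal_powr (ennreal B) Q" using Q by (intro ennreal_powr_mono hB) simp
    also have "\<dots> = ennreal (B powr Q)" using B(1) by (simp add: ennreal_powr_def)
    also have "\<dots> \<le> ennreal ((2 * M) powr Q + moment_const Q + B powr Q)"
      by (intro ennreal_leI) (simp add: moment_const_def)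
    finally show ?thesis .
  qed
  then have "(SUP \<Lambda>\<in>{\<Lambda>. finite \<Lambda> \<and> \<Lambda> \<noteq> {}}. SUP k.
    moment \<alpha> Q \<Lambda> \<xi> k) \<le> ennreal ((2 * M) powr Q + moment_const Q + B powr Q)"
    by (intro SUP_least) auto
  also have "\<dots> < \<infinity>" by simp
  finally show ?thesis .
qed

lemma weighted_moment_sum_finite:
  fixes \<xi> :: "'d::finite config"
  assumes \<xi>: "\<xi> \<in> tempered_configs \<beta>" and \<alpha>: "0 \<le> \<alpha>" "\<alpha> < 1 / 2" and Q: "Q \<ge> 1" and \<delta>: "\<delta> > 0"
  shows "(SUP \<Lambda>\<in>{\<Lambda>. finite \<Lambda> \<and> \<Lambda> \<noteq> {}}. \<Sum>k\<in>\<Lambda>. ennreal (exp (- \<delta> * lat_norm k)) *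
    moment \<alpha> Q \<Lambda> \<xi> k) < \<infinity>"
proof -
  have \<xi>c: "\<xi> \<in> configs \<beta>" using \<xi> by (simp add: tempered_configs_def)
  \<comment> \<open>The \<open>Q\<close>-th moment grows at most like
    \<open>exp (\<epsilon> * Q * lat_norm k)\<close>, so the first bound leaves the decay rate
    \<delta> / 2 for the sum over sites. The second keeps \<epsilon> below 1, where temperedness
    provides summability.\<close>
  define \<epsilon> where "\<epsilon> = min (\<delta> / (2 * Q)) (1 / 2)"
  have \<epsilon>: "0 < \<epsilon>" "\<epsilon> < 1" using \<delta> Q by (auto simp: \<epsilon>_def)
  have "\<epsilon> \<le> \<delta> / (2 * Q)" by (simp add: \<epsilon>_def)
  then have \<epsilon>Q: "\<epsilon> * Q \<le> \<delta> / 2" using Q by (simp add: field_simps)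
  define f where "f = (\<lambda>l. exp (- \<epsilon> * lat_norm l) * (L2_norm \<beta> (\<xi> l))\<^sup>2)"
  have sq: "(L2_norm \<beta> (\<xi> l))\<^sup>2 = L2_sq \<beta> (\<xi> l)" for l
    using L2_sq_nonneg[of \<beta> "\<xi> l"] by (simp add: L2_norm_def L2_sq_def)
  have "f summable_on UNIV" using \<xi> \<epsilon> unfolding f_def tempered_configs_def by blast
  \<comment> \<open>A single term of a convergent sum of nonnegative terms is at most the sum;
    temperedness thus becomes a growth bound on \<xi> with rate \<epsilon>.\<close>
  then have "f l \<le> infsum f UNIV" for l
    using finite_sum_le_infsum[of f UNIV "{l}"] by (auto simp: f_def)
  then have S: "exp (- \<epsilon> * lat_norm l) * L2_sq \<beta> (\<xi> l) \<le> infsum f UNIV" for l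
    by (simp add: f_def sq)
  obtain M where M: "M \<ge> 0" "\<And>\<Lambda> k. finite \<Lambda> \<Longrightarrow> k \<in> \<Lambda> \<Longrightarrow>
    exp_moment \<alpha> \<Lambda> \<xi> k \<le> ennreal (exp (M * exp (\<epsilon> * lat_norm k)))"
    using uniform_log_moment[OF \<alpha> less_imp_le[OF \<epsilon>(1)] S] by blast
  obtain T where T: "T \<ge> 0" "\<And>\<Lambda> :: (int ^ 'd) set. finite \<Lambda> \<Longrightarrow> (\<Sum>k\<in>\<Lambda>. exp (- (\<delta> / 2) * lat_norm k)) \<le> T"
    using lattice_exp_sum_bounded[of "\<delta> / 2"] \<delta> by auto
  define L where "L = (2 * M) powr Q + moment_const Q"
  have L0: "L \<ge> 0" by (simp add: L_def moment_const_def)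
  have summand: "ennreal (exp (- \<delta> * lat_norm k)) *
      moment \<alpha> Q \<Lambda> \<xi> k
      \<le> ennreal (L * exp (- (\<delta> / 2) * lat_norm k))" if "finite \<Lambda>" "k \<in> \<Lambda>" for \<Lambda> k
  proof -
    define x where "x = lat_norm k"
    have x0: "x \<ge> 0" by (simp add: x_def lat_norm_nonneg)
    have "moment \<alpha> Q \<Lambda> \<xi> k
        \<le> ennreal ((2 * (M * exp (\<epsilon> * x))) powr Q + moment_const Q)"
      by (rule local_spec_moment_inside[OF \<xi>c that]) (use M(1) M(2)[OF that] Q in \<open>auto simp: x_def\<close>)
    then have "ennreal (exp (- \<delta> * x)) * moment \<alpha> Q \<Lambda> \<xi> k
        \<le> ennreal (exp (- \<delta> * x)) * ennreal ((2 * (M * exp (\<epsilon> * x))) powr Q + moment_const Q)"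
      by (rule mult_left_mono) simp
    also have "\<dots> = ennreal (exp (- \<delta> * x) * ((2 * (M * exp (\<epsilon> * x))) powr Q + moment_const Q))"
      by (simp add: ennreal_mult moment_const_def)
    also have "\<dots> \<le> ennreal (L * exp (- (\<delta> / 2) * x))"
    proof (rule ennreal_leI)
      have "(2 * (M * exp (\<epsilon> * x))) powr Q = (2 * M) powr Q * exp (\<epsilon> * x) powr Q"
        using powr_mult[of "2 * M" "exp (\<epsilon> * x)" Q] M(1) by (simp add: mult.assoc)
      also have "exp (\<epsilon> * x) powr Q = exp (\<epsilon> * Q * x)" by (simp add: powr_def mult_ac)
      also have "(2 * M) powr Q * exp (\<epsilon> * Q * x) \<le> (2 * M) powr Q * exp (\<delta> / 2 * x)"
        using mult_right_mono[OF \<epsilon>Q x0] by (intro mult_left_mono) auto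
      finally have 1: "(2 * (M * exp (\<epsilon> * x))) powr Q \<le> (2 * M) powr Q * exp (\<delta> / 2 * x)" .
      have "1 \<le> exp (\<delta> / 2 * x)" using \<delta> x0 by simp
      then have 2: "moment_const Q \<le> moment_const Q * exp (\<delta> / 2 * x)"
        using mult_left_mono[of 1 "exp (\<delta> / 2 * x)" "moment_const Q"] by (simp add: moment_const_def)
      have "exp (- \<delta> * x) * ((2 * (M * exp (\<epsilon> * x))) powr Q + moment_const Q) \<le> exp (- \<delta> * x) * (L * exp (\<delta> / 2 * x))"
        using 1 2 unfolding L_def by (intro mult_left_mono) (auto simp: distrib_right)
      also have "\<dots> = L * (exp (- \<delta> * x) * exp (\<delta> / 2 * x))" by simp
      also have "exp (- \<delta> * x) * exp (\<delta> / 2 * x) = exp (- (\<delta> / 2) * x)"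
        unfolding exp_add[symmetric] by (simp add: field_simps)
      finally show "exp (- \<delta> * x) * ((2 * (M * exp (\<epsilon> * x))) powr Q + moment_const Q) \<le> L * exp (- (\<delta> / 2) * x)" .
    qed
    finally show ?thesis by (simp add: x_def)
  qed
  have "(\<Sum>k\<in>\<Lambda>. ennreal (exp (- \<delta> * lat_norm k)) *
    moment \<alpha> Q \<Lambda> \<xi> k) \<le> ennreal (L * T)"
    if \<Lambda>: "finite \<Lambda>" for \<Lambda>
  proof -
    have "(\<Sum>k\<in>\<Lambda>. ennreal (exp (- \<delta> * lat_norm k)) *
        moment \<alpha> Q \<Lambda> \<xi> k)
        \<le> (\<Sum>k\<in>\<Lambda>. ennreal (L * exp (- (\<delta> / 2) * lat_norm k)))"
      by (intro sum_mono summand \<Lambda>)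
    also have "\<dots> = ennreal (L * (\<Sum>k\<in>\<Lambda>. exp (- (\<delta> / 2) * lat_norm k)))"
      using L0 by (subst sum_ennreal) (auto simp: sum_distrib_left)
    also have "\<dots> \<le> ennreal (L * T)" using L0 T(2)[OF \<Lambda>] by (intro ennreal_leI mult_left_mono)
    finally show ?thesis .
  qed
  then have "(SUP \<Lambda>\<in>{\<Lambda>. finite \<Lambda> \<and> \<Lambda> \<noteq> {}}. \<Sum>k\<in>\<Lambda>. ennreal (exp (- \<delta> * lat_norm k)) *
    moment \<alpha> Q \<Lambda> \<xi> k) \<le> ennreal (L * T)"
    by (intro SUP_least) auto
  also have "\<dots> < \<infinity>" by simp
  finally show ?thesis .
qed

end

theorem mainTheorem3:
  fixes \<beta> m a J \<delta> \<alpha> Q :: real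
    and V :: "real \<Rightarrow> real"
    and \<gamma> :: "loop measure"
    and \<xi> :: "'d::finite config"
  assumes "\<beta> > 0" and "m > 0" and "a\<^sup>2 > 0" and "J > 0"
    and "C2 V" and "polynomial_growth V"
    and "gaussian_loop_measure \<beta> m a \<gamma>"
    and "\<xi> \<in> configs \<beta>"
    and "\<delta> > 0" and "0 \<le> \<alpha>" and "\<alpha> < 1/2" and "Q \<ge> 1"
  shows
    "((SUP k. holder_norm \<beta> \<alpha> (\<xi> k)) < \<infinity> \<longrightarrow>
        (SUP \<Lambda>\<in>{\<Lambda>. finite \<Lambda> \<and> \<Lambda> \<noteq> {}}. SUP k.
           \<integral>\<^sup>+\<omega>. ennreal_powr (holder_norm \<beta> \<alpha> (\<omega> k)) Q \<partial>local_spec \<beta> V J \<gamma> \<Lambda> \<xi>) < \<infinity>) \<and>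
     (\<xi> \<in> tempered_configs \<beta> \<longrightarrow>
        (SUP \<Lambda>\<in>{\<Lambda>. finite \<Lambda> \<and> \<Lambda> \<noteq> {}}. \<Sum>k\<in>\<Lambda>. ennreal (exp (- \<delta> * lat_norm k)) *
           (\<integral>\<^sup>+\<omega>. ennreal_powr (holder_norm \<beta> \<alpha> (\<omega> k)) Q \<partial>local_spec \<beta> V J \<gamma> \<Lambda> \<xi>)) < \<infinity>)"
proof -
  interpret lattice_system \<beta> m a J V \<gamma>
    by unfold_locales (use assms C2_continuous in auto)
  show ?thesis
    using moment_sup_finite[OF assms(8,10,11,12)] weighted_moment_sum_finite[OF _ assms(10,11,12,9)] by blast
qed

end
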